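(* Let $J\subseteq\Delta^d_n$ be an M-convex set and let $0<q<\infty$. Let $\mathrm{B}\subseteq V_J/W_J$ be the closed unit ball with respect to some norm, and let $X=\mathrm{B}\setminus(\underline{\mathrm{Dr}}_J\cap\partial\mathrm{B})$. Then the spaces $\underline{\mathrm{Gr}}_J(\mathbb{T}_q)$ and $\underline{\mathrm{Gr}}^{\mathrm w}_J(\mathbb{T}_q)$ are both homeomorphic to $X$. In particular, these spaces are topological manifolds with boundary which can be compactified to a closed Euclidean ball.
   Context: $\Delta^d_n=\{\alpha\in\mathbb{Z}_{\ge0}^n:\sum\alpha_i=d\}$. $J\subseteq\Delta^d_n$ is M-convex if $J\ne\emptyset$ and for all $\alpha,\beta\in J$, $i$ with $\alpha_i<\beta_i$, there is $j$ with $\alpha_j>\beta_j$ and $\alpha+e_i-e_j,\beta-e_i+e_j\in J$. $\delta^\pm_J$ are the coordinatewise max/min over $J$. A list $b_1,\dots,b_k\ge0$ is $q$-null ($0<q<\infty$) if $b_i^{1/q}\le\sum_{j\ne i}b_j^{1/q}$ for all $i$; $0$-null if all are zero or the maximum is attained at least twice; $\infty$-null if all are zero, or the maximum is attained at least twice, or at least three are nonzero. For $q\in[0,\infty]$, a strong $\mathbb{T}_q$-representation of $J$ is $\rho\colon\Delta^d_n\to\mathbb{R}_{\ge0}$ with support $J$ such that for all $2\le s\le d$, $\alpha\in\Delta^{d-s}_n$ with $\delta^-_J\le\alpha$, $1\le i_0\le\dots\le i_s\le n$, $1\le j_2\le\dots\le j_s\le n$ with $\alpha+\sum e_{i_m}+\sum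 e_{j_m}\le\delta^+_J$, the numbers $\rho(\alpha+\sum_{m\neq k}e_{i_m})\rho(\alpha+e_{i_k}+e_{j_2}+\dots+e_{j_s})$, $k=0,\dots,s$, form a $q$-null list; weak representations require this only for $s=2$. $\mathrm{R}_J(\mathbb{T}_q)$, $\mathrm{R}^{\mathrm w}_J(\mathbb{T}_q)\subseteq\mathbb{R}^J_{>0}$ (Euclidean topology) are the sets of strong/weak representations. The group $\mathbb{R}_{>0}^n$ acts by $(t.\rho)(\alpha)=\prod_i t_i^{\alpha_i}\rho(\alpha)$; $\underline{\mathrm{Gr}}_J(\mathbb{T}_q)$ and $\underline{\mathrm{Gr}}^{\mathrm w}_J(\mathbb{T}_q)$ are the quotients of $\mathrm{R}_J(\mathbb{T}_q)$ and $\mathrm{R}^{\mathrm w}_J(\mathbb{T}_q)$ by this action, with quotient topology. $V_J=\{(\log\rho(\alpha))_{\alpha\in J}:\rho\in\mathrm{R}_J(\mathbb{T}_\infty)\}$, a linear subspace of $\mathbb{R}^J$; $W_J\subseteq V_J$ is the span of the vectors $(\alpha_i)_{\alpha\in J}$, $i\in[n]$. The reduced Dressian $\underline{\mathrm{Dr}}_J\subseteq V_J/W_J$ is the image of $\mathrm{R}_J(\mathbb{T}_0)$ under coordinatewise logarithm and the quotient map. *)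

theory Defs
  imports "HOL-Analysis.Analysis" "HOL-Library.Function_Algebras"
begin

text \<open>
  Conventions.  Indices range over \<^term>\<open>{1..n}\<close>; an exponent vector is a function
  \<^typ>\<open>nat \<Rightarrow> nat\<close> that vanishes off \<^term>\<open>{1..n}\<close>.  For a finite set \<open>J\<close>, a vector in the
  coordinate space of \<open>J\<close> over the reals is a function that vanishes off \<open>J\<close>.  On these functions
  the product topology of the function type restricts to the Euclidean topology (this is the
  convention of \<^const>\<open>Euclidean_space\<close>).  Vector operations and the order are pointwise.
\<close>

instantiation "fun" :: (type, real_vector) real_vector
begin

definition scaleR_fun :: "real \<Rightarrow> ('a \<Rightarrow> 'b) \<Rightarrow> 'a \<Rightarrow> 'b" where
  "scaleR_fun c f = (\<lambda>x. c *\<^sub>R f x)"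

instance
  by standard (simp_all add: scaleR_fun_def fun_eq_iff scaleR_right_distrib scaleR_left_distrib)

end


subsection \<open>M-convex sets\<close>

definition Delta :: "nat \<Rightarrow> nat \<Rightarrow> (nat \<Rightarrow> nat) set" where
  "Delta n d = {\<alpha>. (\<forall>i. i \<notin> {1..n} \<longrightarrow> \<alpha> i = 0) \<and> (\<Sum>i=1..n. \<alpha> i) = d}"

definition unit_vec :: "nat \<Rightarrow> nat \<Rightarrow> nat" where
  "unit_vec i = (\<lambda>k. if k = i then 1 else 0)"

text \<open>
  The differences below are never truncated: the subtracted coordinate of \<open>\<alpha>\<close> (of \<open>\<beta>\<close>)
  is positive because it exceeds that of \<open>\<beta>\<close> (of \<open>\<alpha>\<close>).
\<close>

definition M_convex :: "nat \<Rightarrow> nat \<Rightarrow> (nat \<Rightarrow> nat) set \<Rightarrow> bool" where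
  "M_convex n d J \<longleftrightarrow>
     J \<subseteq> Delta n d \<and> J \<noteq> {} \<and>
     (\<forall>\<alpha>\<in>J. \<forall>\<beta>\<in>J. \<forall>i\<in>{1..n}. \<alpha> i < \<beta> i \<longrightarrow>
        (\<exists>j\<in>{1..n}. \<alpha> j > \<beta> j \<and>
           \<alpha> + unit_vec i - unit_vec j \<in> J \<and> \<beta> - unit_vec i + unit_vec j \<in> J))"

definition delta_minus :: "(nat \<Rightarrow> nat) set \<Rightarrow> nat \<Rightarrow> nat" where
  "delta_minus J = (\<lambda>i. Min ((\<lambda>\<alpha>. \<alpha> i) ` J))"

definition delta_plus :: "(nat \<Rightarrow> nat) set \<Rightarrow> nat \<Rightarrow> nat" where
  "delta_plus J = (\<lambda>i. Max ((\<lambda>\<alpha>. \<alpha> i) ` J))"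


subsection \<open>Null lists and representations\<close>

definition max_attained_twice :: "'k set \<Rightarrow> ('k \<Rightarrow> real) \<Rightarrow> bool" where
  "max_attained_twice K b \<longleftrightarrow> (\<exists>i\<in>K. \<exists>j\<in>K. i \<noteq> j \<and> b i = b j \<and> (\<forall>k\<in>K. b k \<le> b i))"

text \<open>The list is given as a family \<open>b\<close> of nonnegative numbers indexed by a finite set \<open>K\<close>.\<close>

definition q_null :: "ennreal \<Rightarrow> 'k set \<Rightarrow> ('k \<Rightarrow> real) \<Rightarrow> bool" where
  "q_null q K b \<longleftrightarrow>
     (if q = 0 then
        (\<forall>k\<in>K. b k = 0) \<or> max_attained_twice K b
      else if q = \<infinity> then
        (\<forall>k\<in>K. b k = 0) \<or> max_attained_twice K b \<or> card {k\<in>K. b k \<noteq> 0} \<ge> 3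
      else
        (\<forall>i\<in>K. b i powr (1 / enn2real q) \<le> (\<Sum>j\<in>K - {i}. b j powr (1 / enn2real q))))"

text \<open>The Pluecker relations with \<open>s + 1\<close> terms.\<close>

definition pluecker_relations ::
    "nat \<Rightarrow> nat \<Rightarrow> (nat \<Rightarrow> nat) set \<Rightarrow> ennreal \<Rightarrow> nat \<Rightarrow> ((nat \<Rightarrow> nat) \<Rightarrow> real) \<Rightarrow> bool" where
  "pluecker_relations n d J q s \<rho> \<longleftrightarrow>
     (\<forall>\<alpha>\<in>Delta n (d - s). \<forall>i j.
        delta_minus J \<le> \<alpha> \<longrightarrow>
        i ` {0..s} \<subseteq> {1..n} \<longrightarrow> mono_on {0..s} i \<longrightarrow>
        j ` {2..s} \<subseteq> {1..n} \<longrightarrow> mono_on {2..s} j \<longrightarrow>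
        \<alpha> + (\<Sum>m=0..s. unit_vec (i m)) + (\<Sum>m=2..s. unit_vec (j m)) \<le> delta_plus J \<longrightarrow>
        q_null q {0..s}
          (\<lambda>k. \<rho> (\<alpha> + (\<Sum>m\<in>{0..s} - {k}. unit_vec (i m)))
             * \<rho> (\<alpha> + unit_vec (i k) + (\<Sum>m=2..s. unit_vec (j m)))))"

definition strong_reps ::
    "nat \<Rightarrow> nat \<Rightarrow> (nat \<Rightarrow> nat) set \<Rightarrow> ennreal \<Rightarrow> ((nat \<Rightarrow> nat) \<Rightarrow> real) set" where
  "strong_reps n d J q =
     {\<rho>. (\<forall>\<alpha>. \<rho> \<alpha> \<ge> 0) \<and> {\<alpha>. \<rho> \<alpha> \<noteq> 0} = J \<and>
         (\<forall>s. 2 \<le> s \<and> s \<le> d \<longrightarrow> pluecker_relations n d J q s \<rho>)}"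

definition weak_reps ::
    "nat \<Rightarrow> nat \<Rightarrow> (nat \<Rightarrow> nat) set \<Rightarrow> ennreal \<Rightarrow> ((nat \<Rightarrow> nat) \<Rightarrow> real) set" where
  "weak_reps n d J q =
     {\<rho>. (\<forall>\<alpha>. \<rho> \<alpha> \<ge> 0) \<and> {\<alpha>. \<rho> \<alpha> \<noteq> 0} = J \<and>
         (2 \<le> d \<longrightarrow> pluecker_relations n d J q 2 \<rho>)}"


subsection \<open>Quotient topology and the reduced realization spaces\<close>

text \<open>The quotient topology on the image of \<open>X\<close> under a map \<open>f\<close>.\<close>

definition quotient_topology :: "'a topology \<Rightarrow> ('a \<Rightarrow> 'b) \<Rightarrow> 'b topology" where
  "quotient_topology X f =
     topology (\<lambda>U. U \<subseteq> f ` topspace X \<and> openin X {x \<in> topspace X. f x \<in> U})"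

lemma openin_quotient_topology:
  "openin (quotient_topology X f) U \<longleftrightarrow>
     U \<subseteq> f ` topspace X \<and> openin X {x \<in> topspace X. f x \<in> U}"
proof -
  have "istopology (\<lambda>U. U \<subseteq> f ` topspace X \<and> openin X {x \<in> topspace X. f x \<in> U})"
    unfolding istopology_def
  proof (intro conjI allI impI; (elim conjE)?)
    fix S T
    assume "openin X {x \<in> topspace X. f x \<in> S}" "openin X {x \<in> topspace X. f x \<in> T}"
    then have "openin X ({x \<in> topspace X. f x \<in> S} \<inter> {x \<in> topspace X. f x \<in> T})"
      by blast
    also have "{x \<in> topspace X. f x \<in> S} \<inter> {x \<in> topspace X. f x \<in> T}
        = {x \<in> topspace X. f x \<in> S \<inter> T}"
      by auto
    finally show "openin X {x \<in> topspace X. f x \<in> S \<inter> T}" .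
  next
    fix \<K>
    assume "\<forall>K\<in>\<K>. K \<subseteq> f ` topspace X \<and> openin X {x \<in> topspace X. f x \<in> K}"
    then have "openin X (\<Union>K\<in>\<K>. {x \<in> topspace X. f x \<in> K})"
      by blast
    also have "(\<Union>K\<in>\<K>. {x \<in> topspace X. f x \<in> K}) = {x \<in> topspace X. f x \<in> \<Union>\<K>}"
      by auto
    finally show "openin X {x \<in> topspace X. f x \<in> \<Union>\<K>}" .
  qed auto
  then show ?thesis
    by (simp add: quotient_topology_def)
qed

lemma topspace_quotient_topology: "topspace (quotient_topology X f) = f ` topspace X"
proof
  show "topspace (quotient_topology X f) \<subseteq> f ` topspace X"
    using openin_quotient_topology openin_topspace by metis
  have "{x \<in> topspace X. f x \<in> f ` topspace X} = topspace X"
    by auto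
  then have "openin (quotient_topology X f) (f ` topspace X)"
    by (simp add: openin_quotient_topology)
  then show "f ` topspace X \<subseteq> topspace (quotient_topology X f)"
    by (rule openin_subset)
qed

lemma quotient_map_quotient_topology: "quotient_map X (quotient_topology X f) f"
  by (auto simp: quotient_map_def topspace_quotient_topology openin_quotient_topology)

definition torus_act ::
    "nat \<Rightarrow> (nat \<Rightarrow> real) \<Rightarrow> ((nat \<Rightarrow> nat) \<Rightarrow> real) \<Rightarrow> (nat \<Rightarrow> nat) \<Rightarrow> real" where
  "torus_act n t \<rho> = (\<lambda>\<alpha>. (\<Prod>i=1..n. t i ^ \<alpha> i) * \<rho> \<alpha>)"

definition torus_orbit ::
    "nat \<Rightarrow> ((nat \<Rightarrow> nat) \<Rightarrow> real) \<Rightarrow> ((nat \<Rightarrow> nat) \<Rightarrow> real) set" where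
  "torus_orbit n \<rho> = {torus_act n t \<rho> | t. \<forall>i\<in>{1..n}. t i > 0}"

definition reduced_Gr ::
    "nat \<Rightarrow> nat \<Rightarrow> (nat \<Rightarrow> nat) set \<Rightarrow> ennreal \<Rightarrow> ((nat \<Rightarrow> nat) \<Rightarrow> real) set topology" where
  "reduced_Gr n d J q =
     quotient_topology (top_of_set (strong_reps n d J q)) (torus_orbit n)"

definition weak_reduced_Gr ::
    "nat \<Rightarrow> nat \<Rightarrow> (nat \<Rightarrow> nat) set \<Rightarrow> ennreal \<Rightarrow> ((nat \<Rightarrow> nat) \<Rightarrow> real) set topology" where
  "weak_reduced_Gr n d J q =
     quotient_topology (top_of_set (weak_reps n d J q)) (torus_orbit n)"


subsection \<open>The reduced Dressian\<close>

definition log_on :: "'a set \<Rightarrow> ('a \<Rightarrow> real) \<Rightarrow> 'a \<Rightarrow> real" where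
  "log_on J \<rho> = (\<lambda>\<alpha>. if \<alpha> \<in> J then ln (\<rho> \<alpha>) else 0)"

definition V_space :: "nat \<Rightarrow> nat \<Rightarrow> (nat \<Rightarrow> nat) set \<Rightarrow> ((nat \<Rightarrow> nat) \<Rightarrow> real) set" where
  "V_space n d J = log_on J ` strong_reps n d J \<infinity>"

definition W_space :: "nat \<Rightarrow> (nat \<Rightarrow> nat) set \<Rightarrow> ((nat \<Rightarrow> nat) \<Rightarrow> real) set" where
  "W_space n J = span ((\<lambda>i \<alpha>. if \<alpha> \<in> J then real (\<alpha> i) else 0) ` {1..n})"

definition coset :: "'v::real_vector set \<Rightarrow> 'v \<Rightarrow> 'v set" where
  "coset W x = (\<lambda>w. x + w) ` W"

definition VW_topology ::
    "nat \<Rightarrow> nat \<Rightarrow> (nat \<Rightarrow> nat) set \<Rightarrow> ((nat \<Rightarrow> nat) \<Rightarrow> real) set topology" where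
  "VW_topology n d J = quotient_topology (top_of_set (V_space n d J)) (coset (W_space n J))"

definition reduced_Dressian ::
    "nat \<Rightarrow> nat \<Rightarrow> (nat \<Rightarrow> nat) set \<Rightarrow> ((nat \<Rightarrow> nat) \<Rightarrow> real) set set" where
  "reduced_Dressian n d J = coset (W_space n J) ` log_on J ` strong_reps n d J 0"

text \<open>\<open>N\<close> is a norm on the quotient vector space \<open>V/W\<close>, whose elements are cosets.\<close>

definition norm_on_quotient :: "'v::real_vector set \<Rightarrow> 'v set \<Rightarrow> ('v set \<Rightarrow> real) \<Rightarrow> bool" where
  "norm_on_quotient V W N \<longleftrightarrow>
     (\<forall>x\<in>V. N (coset W x) \<ge> 0 \<and> (N (coset W x) = 0 \<longleftrightarrow> coset W x = coset W 0)) \<and>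
     (\<forall>c. \<forall>x\<in>V. N (coset W (c *\<^sub>R x)) = \<bar>c\<bar> * N (coset W x)) \<and>
     (\<forall>x\<in>V. \<forall>y\<in>V. N (coset W (x + y)) \<le> N (coset W x) + N (coset W y))"


subsection \<open>Manifolds with boundary and closed Euclidean balls\<close>

text \<open>For \<open>m = 0\<close> the half-space is a point.\<close>

definition half_space :: "nat \<Rightarrow> (nat \<Rightarrow> real) topology" where
  "half_space m = subtopology (Euclidean_space m) {x. x 0 \<ge> 0}"

definition manifold_with_boundary :: "nat \<Rightarrow> 'a topology \<Rightarrow> bool" where
  "manifold_with_boundary m X \<longleftrightarrow>
     Hausdorff_space X \<and> second_countable X \<and>
     (\<forall>x\<in>topspace X. \<exists>U H. openin X U \<and> x \<in> U \<and> openin (half_space m) H \<and>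
        subtopology X U homeomorphic_space subtopology (half_space m) H)"

definition closed_ball :: "nat \<Rightarrow> (nat \<Rightarrow> real) topology" where
  "closed_ball m = subtopology (Euclidean_space m) {x. (\<Sum>i<m. (x i)\<^sup>2) \<le> 1}"

definition compactifies_to :: "'a topology \<Rightarrow> 'b topology \<Rightarrow> bool" where
  "compactifies_to X K \<longleftrightarrow>
     compact_space K \<and> Hausdorff_space K \<and>
     (\<exists>f. embedding_map X K f \<and> K closure_of (f ` topspace X) = topspace K)"

end

theory Submission
  imports Defs
begin

text \<open>
  Taking logarithms and choosing a linear complement of \<open>W\<close> in \<open>V\<close> turns the quotient of the
  space of representations over \<open>T\<^sub>q\<close> into a closed subset \<open>L\<close> of a coordinate space \<open>\<real>\<^sup>m\<close>.
  A relation with exactly two nonzero terms is a linear equation, which holds on \<open>V\<close>.  A relation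
  with at least three nonzero terms \<open>exp a\<^sub>k\<close> becomes strict when all \<open>a\<^sub>k\<close> are multiplied by some
  \<open>t < 1\<close>.  Hence \<open>t L\<close> lies in the interior of \<open>L\<close> for \<open>t < 1\<close>, so the gauge \<open>g\<close> of \<open>L\<close> is
  continuous; it vanishes precisely on the reduced Dressian.  For every norm \<open>N\<close> the radial map
  \<open>x / (1 - g x + N x)\<close> is a homeomorphism from \<open>{g \<le> 1}\<close> to the ball \<open>{N \<le> 1}\<close> without the points
  where \<open>N = 1\<close> and \<open>g = 0\<close>, with inverse \<open>x / (1 - N x + g x)\<close>.  The Euclidean norm gives the
  manifold structure and the compactification.  The same argument applies to weak
  representations because weak and strong representations agree over \<open>T\<^sub>0\<close> and over \<open>T\<^sub>\<infinity>\<close>.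
\<close>

subsection \<open>Exchange in M-convex sets\<close>

text \<open>Weak representations satisfy fewer inequalities, so their logarithms form a different
  region with a different gauge. The target of the radial map, however, depends on the gauge only
  through its zero set, so it suffices that the weak gauge lives on the same \<open>V\<close> and
  vanishes at the same points. Multiplying logarithms by \<open>t\<close> amounts to replacing
  \<open>q\<close> by \<open>q / t\<close>: the limit \<open>t\<close> to 0 leads to q =
  \<infinity>, which defines \<open>V\<close>, and large \<open>t\<close> leads to q = 0, which
  defines the zero set. Hence only these two extreme values of q have to be compared. M-convexity
  enters in two ways. Exchange between close pairs propagates to distant pairs, which makes weak and
  strong relations agree at the two extremes. And no Pluecker relation has exactly one nonzero term,
  so the origin satisfies every relation. The region is not assumed convex; the fact that it shrinks
  into an open part of itself takes the place of convexity in the construction of the gauge.\<close>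

lemma unit_vec_apply: "unit_vec i k = (if k = i then 1 else 0)"
  by (simp add: unit_vec_def)

lemma unit_vec_split:
  assumes "0 < x u"
  obtains x0 where "x = x0 + unit_vec u"
proof
  show "x = (x - unit_vec u) + unit_vec u"
    using assms by (auto simp: fun_eq_iff unit_vec_apply)
qed

lemma unit_vec_split2:
  assumes "x + unit_vec a = y + unit_vec b" "a \<noteq> b"
  obtains z where "x = z + unit_vec b" "y = z + unit_vec a"
proof
  have *: "x k + (if k = a then 1 else 0) = y k + (if k = b then 1 else 0)" for k
    using fun_cong[OF assms(1), of k] by (simp add: unit_vec_apply)
  show "x = (x - unit_vec b) + unit_vec b"
    using *[of b] assms(2) by (auto simp: fun_eq_iff unit_vec_apply)
  show "y = (x - unit_vec b) + unit_vec a"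
  proof
    fix k
    show "y k = ((x - unit_vec b) + unit_vec a) k"
      using *[of k] assms(2) by (auto simp: unit_vec_apply split: if_splits)
  qed
qed

lemma Delta_add_unit_vec:
  assumes "u \<in> {1..n}"
  shows "x + unit_vec u \<in> Delta n (Suc d) \<longleftrightarrow> x \<in> Delta n d"
proof -
  have 1: "(\<Sum>i=1..n. (x + unit_vec u) i) = Suc (\<Sum>i=1..n. x i)"
    using assms by (simp add: unit_vec_apply sum.distrib)
  have 2: "(\<forall>i. i \<notin> {1..n} \<longrightarrow> (x + unit_vec u) i = 0) \<longleftrightarrow> (\<forall>i. i \<notin> {1..n} \<longrightarrow> x i = 0)"
  proof (intro all_cong1 imp_cong refl)
    fix i assume "i \<notin> {1..n}"
    then have "i \<noteq> u"
      using assms by blast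
    then show "(x + unit_vec u) i = 0 \<longleftrightarrow> x i = 0"
      by (simp add: unit_vec_apply)
  qed
  show ?thesis
    unfolding Delta_def mem_Collect_eq 1 2 nat.inject ..
qed

lemma Delta_eqI:
  assumes "x \<in> Delta n d" "y \<in> Delta n d" "\<And>k. x k \<le> y k"
  shows "x = y"
proof (rule ext)
  fix k
  have "(\<Sum>i=1..n. x i) = (\<Sum>i=1..n. y i)"
    using assms(1,2) by (simp add: Delta_def)
  then have "x i = y i" if "i \<in> {1..n}" for i
    using that assms(3) by (intro sum_mono_inv[of x "{1..n}" y]) auto
  moreover have "x k = y k" if "k \<notin> {1..n}"
    using assms(1,2) that by (simp add: Delta_def)
  ultimately show "x k = y k"
    by (cases "k \<in> {1..n}")
qed

text \<open>Subtraction is truncated, so only coordinates where \<open>x\<close> is larger count.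
  For vectors with equal coordinate sum this is half the l1 distance; it is the induction measure
  for both exchange theorems.\<close>

definition excess :: "nat \<Rightarrow> (nat \<Rightarrow> nat) \<Rightarrow> (nat \<Rightarrow> nat) \<Rightarrow> nat" where
  "excess n x y = (\<Sum>i=1..n. x i - y i)"

lemma excess_less:
  assumes "\<And>k. x' k - y' k \<le> x k - y k" "u \<in> {1..n}" "x' u - y' u < x u - y u"
  shows "excess n x' y' < excess n x y"
  unfolding excess_def using assms by (intro sum_strict_mono_ex1) auto

locale M_convex_set =
  fixes n d :: nat and J :: "(nat \<Rightarrow> nat) set"
  assumes M_convex: "M_convex n d J"
begin

lemma J_Delta: "x \<in> J \<Longrightarrow> x \<in> Delta n d"
  using M_convex by (auto simp: M_convex_def)

lemma J_support: "x \<in> J \<Longrightarrow> 0 < x k \<Longrightarrow> k \<in> {1..n}"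
  using J_Delta[of x] unfolding Delta_def by (cases "k \<in> {1..n}") simp_all

lemma J_eqI: "x + unit_vec u \<in> J \<Longrightarrow> y + unit_vec u \<in> J \<Longrightarrow> (\<And>k. x k \<le> y k) \<Longrightarrow> x = y"
proof -
  assume *: "x + unit_vec u \<in> J" "y + unit_vec u \<in> J" "\<And>k. x k \<le> y k"
  have "x + unit_vec u = y + unit_vec u"
    by (rule Delta_eqI[OF J_Delta[OF *(1)] J_Delta[OF *(2)]]) (simp add: *(3))
  then show ?thesis
    by (rule add_right_imp_eq)
qed

lemma finite_J: "finite J"
proof (rule finite_subset)
  show "J \<subseteq> (\<lambda>f k. if k \<in> {1..n} then f k else 0) ` ({1..n} \<rightarrow>\<^sub>E {..d})"
  proof
    fix x assume "x \<in> J"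
    then have x: "\<And>i. i \<notin> {1..n} \<Longrightarrow> x i = 0" "(\<Sum>i=1..n. x i) = d"
      using J_Delta by (auto simp: Delta_def)
    have "x i \<le> d" if "i \<in> {1..n}" for i
      unfolding x(2)[symmetric] using that by (intro member_le_sum) auto
    then have "restrict x {1..n} \<in> {1..n} \<rightarrow>\<^sub>E {..d}"
      by auto
    moreover have "x = (\<lambda>k. if k \<in> {1..n} then restrict x {1..n} k else 0)"
      using x(1) by (auto simp: fun_eq_iff)
    ultimately show "x \<in> (\<lambda>f k. if k \<in> {1..n} then f k else 0) ` ({1..n} \<rightarrow>\<^sub>E {..d})"
      by blast
  qed
  show "finite ((\<lambda>f k. if k \<in> {1..n} then f k else (0::nat)) ` ({1..n} \<rightarrow>\<^sub>E {..d}))"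
    by (intro finite_imageI finite_PiE) auto
qed

text \<open>The exchange axiom without subtraction: splitting off the moved unit vector turns later
  rearrangements into identities in a cancellative commutative monoid.\<close>

lemma exchange:
  assumes "x \<in> J" "y \<in> J" "y u < x u"
  obtains x0 y0 v where "x = x0 + unit_vec u" "y = y0 + unit_vec v" "x v < y v"
    "x0 + unit_vec v \<in> J" "y0 + unit_vec u \<in> J" "u \<in> {1..n}" "v \<in> {1..n}" "u \<noteq> v"
proof -
  have u: "u \<in> {1..n}"
    using assms J_support by force
  then obtain v where v: "v \<in> {1..n}" "x v < y v"
      "y + unit_vec u - unit_vec v \<in> J" "x - unit_vec u + unit_vec v \<in> J"
    using M_convex assms unfolding M_convex_def by blast
  obtain x0 where x0: "x = x0 + unit_vec u"
    using assms(3) unit_vec_split by (metis gr_zeroI not_less0)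
  obtain y0 where y0: "y = y0 + unit_vec v"
    using v(2) unit_vec_split by (metis gr_zeroI not_less0)
  have "x0 + unit_vec v \<in> J" "y0 + unit_vec u \<in> J"
    using v(3,4) unfolding x0 y0
    by (metis add.commute add.left_commute add_diff_cancel_left')+
  moreover have "u \<noteq> v"
    using assms(3) v(2) by auto
  ultimately show ?thesis
    using that u v x0 y0 by blast
qed

end

subsection \<open>Three-term relations imply all relations\<close>

text \<open>For three nonnegative numbers, \<open>null3_zero\<close> and
  \<open>null3_infinity\<close> are nullity at q = 0 and q = \<infinity>, in a form that is visibly
  symmetric in the three entries.\<close>

definition null3_zero :: "real \<Rightarrow> real \<Rightarrow> real \<Rightarrow> bool" where
  "null3_zero a b c \<longleftrightarrow> a \<le> max b c \<and> b \<le> max a c \<and> c \<le> max a b"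

definition null3_infinity :: "real \<Rightarrow> real \<Rightarrow> real \<Rightarrow> bool" where
  "null3_infinity a b c \<longleftrightarrow> (a = 0 \<longrightarrow> b = c) \<and> (b = 0 \<longrightarrow> a = c) \<and> (c = 0 \<longrightarrow> a = b)"

text \<open>The three terms are the three ways of distributing four unit vectors over two pairs.
  Neither an order of the indices nor bounds on \<open>S\<close> are imposed, so that the inductions
  can invoke a relation at any base point.\<close>

definition three_term ::
    "nat \<Rightarrow> (real \<Rightarrow> real \<Rightarrow> real \<Rightarrow> bool) \<Rightarrow> ((nat \<Rightarrow> nat) \<Rightarrow> real) \<Rightarrow> bool" where
  "three_term n P \<rho> \<longleftrightarrow>
     (\<forall>S. \<forall>a\<in>{1..n}. \<forall>b\<in>{1..n}. \<forall>c\<in>{1..n}. \<forall>e\<in>{1..n}.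
        P (\<rho> (S + unit_vec a + unit_vec b) * \<rho> (S + unit_vec c + unit_vec e))
          (\<rho> (S + unit_vec a + unit_vec c) * \<rho> (S + unit_vec b + unit_vec e))
          (\<rho> (S + unit_vec a + unit_vec e) * \<rho> (S + unit_vec b + unit_vec c)))"

lemma three_termD:
  assumes "three_term n P \<rho>" "{a, b, c, e} \<subseteq> {1..n}"
  shows "P (\<rho> (S + unit_vec a + unit_vec b) * \<rho> (S + unit_vec c + unit_vec e))
           (\<rho> (S + unit_vec a + unit_vec c) * \<rho> (S + unit_vec b + unit_vec e))
           (\<rho> (S + unit_vec a + unit_vec e) * \<rho> (S + unit_vec b + unit_vec c))"
  using assms unfolding three_term_def by auto

locale M_convex_function = M_convex_set +
  fixes \<rho> :: "(nat \<Rightarrow> nat) \<Rightarrow> real"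
  assumes nonneg: "\<rho> x \<ge> 0" and support: "\<rho> x \<noteq> 0 \<longleftrightarrow> x \<in> J"
begin

lemma pos: "0 < \<rho> x \<longleftrightarrow> x \<in> J"
  using nonneg[of x] support[of x] by linarith

lemma zero: "x \<notin> J \<Longrightarrow> \<rho> x = 0"
  using support by blast

text \<open>
  Valuated exchange propagates from close pairs to all pairs: in a closest counterexample
  \<open>x\<close>, \<open>y\<close>, \<open>u\<close> the potential \<open>p\<close> makes all exchanges of \<open>u\<close> tight at \<open>x\<close> and losing at \<open>y\<close>;
  the best exchange of some \<open>u0\<close> into \<open>y\<close> then yields a closer counterexample.
\<close>

lemma valuated_exchange:
  assumes local: "three_term n null3_zero \<rho>"
    and "x \<in> J" "y \<in> J" "y u < x u"
  shows "\<exists>x0 y0 v. x = x0 + unit_vec u \<and> y = y0 + unit_vec v \<and> x v < y v \<and> v \<in> {1..n} \<and>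
    \<rho> x * \<rho> y \<le> \<rho> (x0 + unit_vec v) * \<rho> (y0 + unit_vec u)"
  using assms(2-)
proof (induction "excess n x y" arbitrary: x y u rule: less_induct)
  case less
  obtain x0 y1 w where x0: "x = x0 + unit_vec u"
    and y1: "y = y1 + unit_vec w" "x w < y w" "x0 + unit_vec w \<in> J" "y1 + unit_vec u \<in> J"
    and uw: "u \<in> {1..n}" "w \<in> {1..n}" "u \<noteq> w"
    by (rule exchange[OF less.prems])
  show ?case
  proof (cases "\<exists>u0. y u0 < x u0 \<and> (u0 = u \<longrightarrow> y u + 2 \<le> x u)")
    \<comment> \<open>Here \<open>x\<close> exceeds \<open>y\<close> only at \<open>u\<close>, and
      only by one. So \<open>x\<close> and \<open>y\<close> differ by one exchange, which merely
      swaps them.\<close>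
    case False
    have "x0 = y1"
    proof (rule J_eqI)
      show "x0 + unit_vec w \<in> J" "y1 + unit_vec w \<in> J"
        using y1 less.prems by auto
      fix k show "x0 k \<le> y1 k"
      proof -
        have "\<not> y k < x k \<or> (k = u \<and> \<not> y u + 2 \<le> x u)"
          using False by auto
        moreover have "x k = x0 k + (if k = u then 1 else 0)" "y k = y1 k + (if k = w then 1 else 0)"
          by (simp_all add: x0 y1(1) unit_vec_apply)
        ultimately show ?thesis
          using y1(2) uw(3) by (cases "k = w"; cases "k = u"; simp; linarith?)
      qed
    qed
    then have "\<rho> x * \<rho> y \<le> \<rho> (x0 + unit_vec w) * \<rho> (y1 + unit_vec u)"
      by (simp add: x0 y1(1))
    then show ?thesis
      using x0 y1 uw by blast
  next
    \<comment> \<open>A unit of \<open>x\<close> at \<open>u0\<close> can be moved into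
      \<open>y\<close> so that \<open>u\<close> still has a unit to spare; this brings
      \<open>y\<close> closer to \<open>x\<close> without destroying the exchange problem at
      \<open>u\<close>.\<close>
    case True
    then obtain u0 where u0: "y u0 < x u0" "u0 = u \<longrightarrow> y u + 2 \<le> x u"
      by blast
    show ?thesis
    proof (rule ccontr)
      assume "\<not> ?thesis"
      then have fail: "\<rho> (x0 + unit_vec v) * \<rho> (y0 + unit_vec u) < \<rho> x * \<rho> y"
        if "y = y0 + unit_vec v" "x v < y v" "v \<in> {1..n}" for y0 v
        using that x0 not_le by blast
      have xy: "0 < \<rho> x" "0 < \<rho> y"
        using less.prems pos by auto
      define A where "A = {v\<in>{1..n}. x v < y v}"
      \<comment> \<open>If the exchange is possible at \<open>x\<close>, the first value gives
        \<open>p v * \<rho> (x0 + unit_vec v) = \<rho> x\<close>, and failure of the claim becomes a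
        loss at \<open>y\<close>. Otherwise the second value forces that loss; the summand 1 makes
        it strict and keeps \<open>p\<close> positive.\<close>
      define p where "p v = (if x0 + unit_vec v \<in> J then \<rho> x / \<rho> (x0 + unit_vec v)
         else (\<rho> (y - unit_vec v + unit_vec u) + 1) / \<rho> y)" for v
      have p_pos: "0 < p v" for v
        using xy pos nonneg[of "y - unit_vec v + unit_vec u"] by (simp add: p_def)
      have lose: "\<rho> (y0 + unit_vec u) < p v * \<rho> y" if "y = y0 + unit_vec v" "v \<in> A" for y0 v
      proof (cases "x0 + unit_vec v \<in> J")
        case True
        then show ?thesis
          using fail[of y0 v] that pos[of "x0 + unit_vec v"] by (simp add: A_def p_def field_simps)
      next
        case False
        have "y - unit_vec v = y0"
          using that(1) by simp
        then show ?thesis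
          using False xy by (simp add: p_def)
      qed
      obtain x2 y2 w' where w': "y = y2 + unit_vec w'" "x w' < y w'" "y2 + unit_vec u0 \<in> J"
          "w' \<in> {1..n}" and u0n: "u0 \<in> {1..n}"
        by (rule exchange[OF less.prems(1,2) u0(1)])
      \<comment> \<open>The gain of bringing \<open>u0\<close> into \<open>y\<close> in exchange for
        \<open>v\<close>, weighted by the potential. A maximizer \<open>v0\<close> has positive gain
        because the plain exchange partner \<open>w'\<close> of \<open>u0\<close> has, so the new
        point lies in \<open>J\<close>.\<close>
      define h where "h v = \<rho> (y - unit_vec v + unit_vec u0) / p v" for v
      have "finite A" "A \<noteq> {}"
        using w' by (auto simp: A_def)
      then have "Max (h ` A) \<in> h ` A"
        by simp
      then obtain v0 where "v0 \<in> A" "Max (h ` A) = h v0"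
        by blast
      then have v0: "v0 \<in> A" "\<And>v. v \<in> A \<Longrightarrow> h v \<le> h v0"
        using \<open>finite A\<close> Max_ge[of "h ` A"] by auto
      obtain y3 where y3: "y = y3 + unit_vec v0"
        using unit_vec_split[of y v0] v0(1) by (auto simp: A_def)
      have "y - unit_vec w' = y2" "y - unit_vec v0 = y3"
        by (simp add: w'(1), simp add: y3)
      moreover have "h w' \<le> h v0"
        using v0(2) w' by (auto simp: A_def)
      ultimately have "0 < \<rho> (y3 + unit_vec u0)"
        using pos w'(3) p_pos[of w'] p_pos[of v0] unfolding h_def
        by (smt (verit) divide_nonpos_pos divide_pos_pos)
      then have y': "y3 + unit_vec u0 \<in> J"
        using pos by blast
      let ?y' = "y3 + unit_vec u0"
      have v0A: "x v0 < y v0" "v0 \<in> {1..n}"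
        using v0 by (auto simp: A_def)
      have u0v0: "u0 \<noteq> v0"
        using u0 v0A by auto
      have *: "?y' k = y k + (if k = u0 then 1 else 0) - (if k = v0 then 1 else 0)" for k
        by (simp add: y3 unit_vec_apply)
      have closer: "excess n x ?y' < excess n x y"
      proof (rule excess_less)
        show "u0 \<in> {1..n}" "x u0 - ?y' u0 < x u0 - y u0"
          using u0n u0 * u0v0 by auto
        show "x k - ?y' k \<le> x k - y k" for k
          using * v0A(1) by auto
      qed
      have "?y' u < x u"
        using * u0 less.prems(3) by auto
      \<comment> \<open>The new pair is closer and hence not a counterexample; its exchange partner
        \<open>v\<close> is the fourth index of the three-term relation below.\<close>
      from less.hyps[OF closer less.prems(1) y' this]
      obtain x0' y0 v where x0': "x = x0' + unit_vec u" and v: "?y' = y0 + unit_vec v" "x v < ?y' v" "v \<in> {1..n}"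
        and le': "\<rho> x * \<rho> ?y' \<le> \<rho> (x0' + unit_vec v) * \<rho> (y0 + unit_vec u)"
        by blast
      have le: "\<rho> x * \<rho> ?y' \<le> \<rho> (x0 + unit_vec v) * \<rho> (y0 + unit_vec u)"
        using le' x0' unfolding x0 by (simp only: add_right_cancel)
      have vu0: "v \<noteq> u0"
        using v(2) * u0 u0v0 by auto
      have vA: "v \<in> A"
        using v(2,3) *[of v] vu0 by (auto simp: A_def split: if_splits)
      obtain S where S: "y3 = S + unit_vec v" "y0 = S + unit_vec u0"
        by (rule unit_vec_split2[OF v(1)]) (use vu0 in auto)
      have "0 < \<rho> x * \<rho> ?y'"
        using xy y' pos by simp
      then have "0 < \<rho> (x0 + unit_vec v) * \<rho> (y0 + unit_vec u)"
        using le by linarith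
      then have x0v: "0 < \<rho> (x0 + unit_vec v)"
        using nonneg by (metis less_le mult_eq_0_iff)
      then have pv: "p v = \<rho> x / \<rho> (x0 + unit_vec v)"
        using pos by (simp add: p_def)
      have 1: "p v * \<rho> ?y' \<le> \<rho> (y0 + unit_vec u)"
        using le x0v by (simp add: pv field_simps)
      have 2: "\<rho> (y3 + unit_vec u) < p v0 * \<rho> y"
        using lose y3 v0 by blast
      have 3: "\<rho> (S + unit_vec v0 + unit_vec u) < p v * \<rho> y"
        by (rule lose[OF _ vA]) (simp add: y3 S ac_simps)
      have "y - unit_vec v = S + unit_vec v0"
        unfolding y3 S(1) by (metis add.commute add.left_commute add_diff_cancel_right')
      then have 4: "\<rho> (S + unit_vec v0 + unit_vec u0) \<le> \<rho> ?y' / p v0 * p v"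
        using v0(2)[OF vA] p_pos \<open>y - unit_vec v0 = y3\<close> by (simp add: h_def field_simps)
      have y'pos: "0 < \<rho> ?y'"
        using y' pos by blast
      \<comment> \<open>Now \<open>y = S + unit_vec v + unit_vec v0\<close> and
        \<open>?y' = S + unit_vec v + unit_vec u0\<close>. In the relation at \<open>S\<close>, the
        first term is at least \<open>p v * \<rho> ?y' * \<rho> y\<close> by fact 1, while both
        others are strictly smaller: one by the losses at \<open>y\<close> and the maximality of
        \<open>v0\<close>, the other by a loss alone.\<close>
      have "{u, u0, v, v0} \<subseteq> {1..n}"
        using uw u0n v v0A by auto
      then have "\<rho> (S + unit_vec u + unit_vec u0) * \<rho> (S + unit_vec v + unit_vec v0)
          \<le> max (\<rho> (S + unit_vec u + unit_vec v) * \<rho> (S + unit_vec u0 + unit_vec v0))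
              (\<rho> (S + unit_vec u + unit_vec v0) * \<rho> (S + unit_vec u0 + unit_vec v))"
        using three_termD[OF local] unfolding null3_zero_def by blast
      then have 5: "\<rho> (y0 + unit_vec u) * \<rho> y
          \<le> max (\<rho> (y3 + unit_vec u) * \<rho> (S + unit_vec v0 + unit_vec u0))
              (\<rho> (S + unit_vec v0 + unit_vec u) * \<rho> ?y')"
        by (simp add: S y3 ac_simps)
      have "\<rho> (y3 + unit_vec u) * \<rho> (S + unit_vec v0 + unit_vec u0)
          \<le> \<rho> (y3 + unit_vec u) * (\<rho> ?y' / p v0 * p v)"
        by (rule mult_left_mono[OF 4 nonneg])
      also have "\<dots> < (p v0 * \<rho> y) * (\<rho> ?y' / p v0 * p v)"
        using 2 p_pos y'pos by (intro mult_strict_right_mono) auto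
      also have "\<dots> = p v * \<rho> ?y' * \<rho> y"
        using p_pos[of v0] by simp
      finally have 6: "\<rho> (y3 + unit_vec u) * \<rho> (S + unit_vec v0 + unit_vec u0) < p v * \<rho> ?y' * \<rho> y" .
      have 7: "\<rho> (S + unit_vec v0 + unit_vec u) * \<rho> ?y' < p v * \<rho> ?y' * \<rho> y"
        using mult_strict_right_mono[OF 3 y'pos] by (simp add: ac_simps)
      have "p v * \<rho> ?y' * \<rho> y \<le> \<rho> (y0 + unit_vec u) * \<rho> y"
        using 1 xy by simp
      then show False
        using 5 6 7 by linarith
    qed
  qed
qed

end

context M_convex_function
begin

text \<open>
  The induction replaces \<open>x\<close> or \<open>y\<close> by a neighbour for which \<open>u\<close>, \<open>v\<close> is still the only
  exchange; the neighbour and its partner are linked by a three-term relation with a zero term.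
\<close>

lemma unique_exchange_balanced:
  assumes local: "three_term n null3_infinity \<rho>"
    and "x0 + unit_vec u \<in> J" "y0 + unit_vec v \<in> J" "x0 + unit_vec v \<in> J" "y0 + unit_vec u \<in> J"
    and "u \<noteq> v" "y0 u \<le> x0 u" "y0 v = x0 v"
    and "\<And>z y1. y0 + unit_vec v = y1 + unit_vec z \<Longrightarrow> z \<noteq> v \<Longrightarrow>
      x0 z + unit_vec u z < y0 z + unit_vec v z \<Longrightarrow> x0 + unit_vec z \<in> J \<Longrightarrow> y1 + unit_vec u \<notin> J"
  shows "\<rho> (x0 + unit_vec u) * \<rho> (y0 + unit_vec v) = \<rho> (x0 + unit_vec v) * \<rho> (y0 + unit_vec u)"
  using assms(2-)
proof (induction "excess n (x0 + unit_vec u) (y0 + unit_vec v)" arbitrary: x0 y0 rule: less_induct)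
  case less
  note xJ = less.prems(1) and yJ = less.prems(2) and xvJ = less.prems(3) and yuJ = less.prems(4)
    and uv = less.prems(5) and xu = less.prems(6) and xv = less.prems(7) and unique = less.prems(8)
  have in_n: "a \<in> {1..n}" if "z + unit_vec a \<in> J" for z a
    using J_support[OF that, of a] by (simp add: unit_vec_apply)
  show ?case
  proof (cases "\<exists>c. c \<noteq> v \<and> x0 c + unit_vec u c < y0 c + unit_vec v c")
    \<comment> \<open>Only \<open>v\<close> has larger coordinate in \<open>y\<close>, so
      \<open>x\<close> and \<open>y\<close> are neighbours and both sides are the same
      product.\<close>
    case False
    have "y0 = x0"
    proof (rule J_eqI[OF yuJ xJ])
      fix k
      have "k \<noteq> v \<Longrightarrow> y0 k + unit_vec v k \<le> x0 k + unit_vec u k"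
        using False not_le by blast
      then show "y0 k \<le> x0 k"
        using xu xv by (cases "k = v"; cases "k = u"; simp add: unit_vec_apply)
    qed
    then show ?thesis
      by (simp add: mult.commute)
  next
    case True
    then obtain c where c: "c \<noteq> v" "x0 c + unit_vec u c < y0 c + unit_vec v c"
      by blast
    have cu: "c \<noteq> u"
      using c xu by (auto simp: unit_vec_apply)
    have "(x0 + unit_vec u) c < (y0 + unit_vec v) c"
      using c by simp
    from exchange[OF yJ xJ this]
    obtain y1 x1 w where y1: "y0 + unit_vec v = y1 + unit_vec c"
      and x1: "x0 + unit_vec u = x1 + unit_vec w" "(y0 + unit_vec v) w < (x0 + unit_vec u) w"
      "y1 + unit_vec w \<in> J" "x1 + unit_vec c \<in> J" and cw: "c \<in> {1..n}" "w \<in> {1..n}" "c \<noteq> w"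
      by metis
    have wv: "w \<noteq> v"
      using x1(2) xv uv by (auto simp: unit_vec_apply)
    have uvn: "u \<in> {1..n}" "v \<in> {1..n}"
      using in_n xJ yJ by blast+
    show ?thesis
    proof (cases "x0 + unit_vec c \<in> J")
      \<comment> \<open>Here \<open>x\<close> is replaced by its neighbour
        \<open>S + unit_vec u + unit_vec c\<close>, which has lost a unit at \<open>w\<close> and
        gained one at \<open>c\<close>.\<close>
      case False
      have wu: "w \<noteq> u"
      proof
        assume "w = u"
        then have "x1 = x0"
          using x1(1) by simp
        then show False
          using False x1(4) by simp
      qed
      obtain S where S: "x0 = S + unit_vec w" "x1 = S + unit_vec u"
        by (rule unit_vec_split2[OF x1(1)]) (use wu in auto)
      \<comment> \<open>Since \<open>S + unit_vec w + unit_vec c = x0 + unit_vec c\<close> is not in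
        \<open>J\<close>, one term of the relation vanishes and the other two agree. The case
        \<open>z = v\<close> transfers the claim between \<open>x\<close> and its neighbour; general
        \<open>z\<close> transfers uniqueness, because the two factors at
        \<open>S + unit_vec u\<close> are positive.\<close>
      have T: "\<rho> (S + unit_vec u + unit_vec w) * \<rho> (S + unit_vec c + unit_vec z)
          = \<rho> (S + unit_vec u + unit_vec c) * \<rho> (S + unit_vec w + unit_vec z)" if "z \<in> {1..n}" for z
      proof -
        have "\<rho> (S + unit_vec w + unit_vec c) = 0"
          using False S(1) zero by simp
        moreover have "{u, w, c, z} \<subseteq> {1..n}"
          using that uvn cw by auto
        ultimately show ?thesis
          using three_termD[OF local, of u w c z S] by (simp add: null3_infinity_def)
      qed
      have xw: "x0 + unit_vec u = S + unit_vec u + unit_vec w" and x'J: "S + unit_vec u + unit_vec c \<in> J"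
        using S x1(4) by (simp_all add: ac_simps)
      have pos2: "0 < \<rho> (S + unit_vec u + unit_vec w)" "0 < \<rho> (S + unit_vec u + unit_vec c)"
        using xJ x'J pos by (simp_all only: xw)
      have x'v: "S + unit_vec c + unit_vec v \<in> J"
        using T[OF uvn(2)] pos2 xvJ pos[of "S + unit_vec w + unit_vec v"]
          support[of "S + unit_vec c + unit_vec v"] S(1) by auto
      have less: "(S + unit_vec c) k + unit_vec u k < y0 k + unit_vec v k \<Longrightarrow>
          x0 k + unit_vec u k < y0 k + unit_vec v k" if "k \<noteq> w" for k
        using that by (simp add: S unit_vec_apply)
      have val: "(S + unit_vec c) k + unit_vec u k + (if k = w then 1 else 0)
          = x0 k + unit_vec u k + (if k = c then 1 else 0)" for k
        by (simp add: S unit_vec_apply)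
      have cgt: "x0 c + unit_vec u c < y0 c + unit_vec v c" "y0 w + unit_vec v w < x0 w + unit_vec u w"
        using c x1(2) by simp_all
      have "\<rho> (S + unit_vec c + unit_vec u) * \<rho> (y0 + unit_vec v)
          = \<rho> (S + unit_vec c + unit_vec v) * \<rho> (y0 + unit_vec u)"
      proof (rule less.hyps)
        show "S + unit_vec c + unit_vec u \<in> J"
          using x'J by (simp only: ac_simps)
        show "y0 u \<le> (S + unit_vec c) u" "y0 v = (S + unit_vec c) v"
          using xu xv cu c(1) wu wv by (simp_all add: S unit_vec_apply)
        show "excess n (S + unit_vec c + unit_vec u) (y0 + unit_vec v)
            < excess n (x0 + unit_vec u) (y0 + unit_vec v)"
        proof (rule excess_less[OF _ cw(2)])
          show "(S + unit_vec c + unit_vec u) k - (y0 + unit_vec v) k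
              \<le> (x0 + unit_vec u) k - (y0 + unit_vec v) k" for k
            using val[of k] cgt by (cases "k = c"; cases "k = w"; simp)
          show "(S + unit_vec c + unit_vec u) w - (y0 + unit_vec v) w
              < (x0 + unit_vec u) w - (y0 + unit_vec v) w"
            using val[of w] cgt cw by simp
        qed
        fix z y2
        assume z: "y0 + unit_vec v = y2 + unit_vec z" "z \<noteq> v"
          "(S + unit_vec c) z + unit_vec u z < y0 z + unit_vec v z" "S + unit_vec c + unit_vec z \<in> J"
        have "z \<noteq> w"
          using z(3) val[of z] cgt cw by auto
        then have "x0 z + unit_vec u z < y0 z + unit_vec v z"
          using less z(3) by blast
        moreover have "S + unit_vec w + unit_vec z \<in> J"
          using T[OF in_n[OF z(4)]] pos2 pos[of "S + unit_vec c + unit_vec z"] z(4)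
            support[of "S + unit_vec w + unit_vec z"] by auto
        ultimately show "y2 + unit_vec u \<notin> J"
          using unique[OF z(1,2)] S(1) by simp
      qed (use yJ x'v yuJ uv in simp_all)
      then have IH: "\<rho> (S + unit_vec u + unit_vec c) * \<rho> (y0 + unit_vec v)
          = \<rho> (S + unit_vec c + unit_vec v) * \<rho> (y0 + unit_vec u)"
        by (simp only: ac_simps)
      have "(\<rho> (S + unit_vec u + unit_vec w) * \<rho> (y0 + unit_vec v)) * \<rho> (S + unit_vec u + unit_vec c)
          = \<rho> (S + unit_vec u + unit_vec w) * (\<rho> (S + unit_vec u + unit_vec c) * \<rho> (y0 + unit_vec v))"
        by (simp only: mult.commute mult.left_commute)
      also have "\<dots> = (\<rho> (S + unit_vec u + unit_vec w) * \<rho> (S + unit_vec c + unit_vec v)) * \<rho> (y0 + unit_vec u)"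
        unfolding IH by (simp only: mult.assoc)
      also have "\<dots> = (\<rho> (S + unit_vec w + unit_vec v) * \<rho> (y0 + unit_vec u)) * \<rho> (S + unit_vec u + unit_vec c)"
        unfolding T[OF uvn(2)] by (simp only: mult.commute mult.left_commute)
      finally show ?thesis
        using pos2 by (simp add: S(1) ac_simps)
    next
      \<comment> \<open>The dual situation: uniqueness excludes \<open>y1 + unit_vec u\<close> from
        \<open>J\<close>, and now \<open>y\<close> is replaced by its neighbour
        \<open>y1 + unit_vec w\<close>.\<close>
      case True
      have y1u: "y1 + unit_vec u \<notin> J"
        using unique[OF y1 c True] .
      have wu: "w \<noteq> u"
        using x1(3) y1u by auto
      obtain S where S: "y0 = S + unit_vec c" "y1 = S + unit_vec v"
        by (rule unit_vec_split2[OF y1]) (use c in auto)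
      \<comment> \<open>The vanishing term contains \<open>y1 + unit_vec u\<close>. The
        decomposition \<open>S' + z\<close> of \<open>S + unit_vec v\<close> stays free because the
        transfer of uniqueness needs it with another unit vector split off.\<close>
      have T: "\<rho> (S' + unit_vec c + z) * \<rho> (S' + unit_vec w + unit_vec u)
          = \<rho> (S' + unit_vec c + unit_vec u) * \<rho> (S' + unit_vec w + z)"
        if "S' + z = S + unit_vec v" "z = unit_vec e" "e \<in> {1..n}" for S' z e
      proof -
        have "S' + unit_vec u + z = y1 + unit_vec u"
          using that(1) S(2) by (metis add.assoc add.commute)
        then have "\<rho> (S' + unit_vec e + unit_vec u) = 0"
          using y1u zero that(2) by (simp add: ac_simps)
        moreover have "{c, e, w, u} \<subseteq> {1..n}"
          using that uvn cw by auto
        ultimately show ?thesis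
          using three_termD[OF local, of c e w u S'] that(2) by (simp add: null3_infinity_def ac_simps)
      qed
      have Tv: "\<rho> (S + unit_vec c + unit_vec v) * \<rho> (S + unit_vec w + unit_vec u)
          = \<rho> (S + unit_vec c + unit_vec u) * \<rho> (S + unit_vec w + unit_vec v)"
        using T[OF refl refl uvn(2)] .
      have y'J: "S + unit_vec w + unit_vec v \<in> J"
        using x1(3) S(2) by (simp only: ac_simps)
      have pos2: "0 < \<rho> (S + unit_vec c + unit_vec v)" "0 < \<rho> (S + unit_vec w + unit_vec v)"
          "0 < \<rho> (S + unit_vec c + unit_vec u)"
        using yJ yuJ y'J pos by (simp_all only: S(1))
      have y'u: "S + unit_vec w + unit_vec u \<in> J"
        using Tv pos2 support[of "S + unit_vec w + unit_vec u"] by auto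
      have val: "(S + unit_vec w) k + unit_vec v k + (if k = c then 1 else 0)
          = y0 k + unit_vec v k + (if k = w then 1 else 0)" for k
        by (simp add: S unit_vec_apply)
      have cgt: "x0 c + unit_vec u c < y0 c + unit_vec v c" "y0 w + unit_vec v w < x0 w + unit_vec u w"
        using c x1(2) by simp_all
      have IH: "\<rho> (x0 + unit_vec u) * \<rho> (S + unit_vec w + unit_vec v)
          = \<rho> (x0 + unit_vec v) * \<rho> (S + unit_vec w + unit_vec u)"
      proof (rule less.hyps)
        show "(S + unit_vec w) u \<le> x0 u" "(S + unit_vec w) v = x0 v"
          using xu xv cu c(1) wu wv by (simp_all add: S unit_vec_apply)
        show "excess n (x0 + unit_vec u) (S + unit_vec w + unit_vec v)
            < excess n (x0 + unit_vec u) (y0 + unit_vec v)"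
        proof (rule excess_less[OF _ cw(2)])
          show "(x0 + unit_vec u) k - (S + unit_vec w + unit_vec v) k
              \<le> (x0 + unit_vec u) k - (y0 + unit_vec v) k" for k
            using val[of k] cgt by (cases "k = c"; cases "k = w"; simp)
          show "(x0 + unit_vec u) w - (S + unit_vec w + unit_vec v) w
              < (x0 + unit_vec u) w - (y0 + unit_vec v) w"
            using val[of w] cgt cw by simp
        qed
        fix z y2
        assume z: "S + unit_vec w + unit_vec v = y2 + unit_vec z" "z \<noteq> v"
          "x0 z + unit_vec u z < (S + unit_vec w) z + unit_vec v z" "x0 + unit_vec z \<in> J"
        have zw: "z \<noteq> w"
          using z(3) val[of z] cgt cw by auto
        have zlt: "x0 z + unit_vec u z < y0 z + unit_vec v z"
          using z(3) val[of z] zw by (auto split: if_splits)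
        have "S + unit_vec v + unit_vec w = y2 + unit_vec z"
          using z(1) by (simp only: ac_simps)
        then obtain R where R: "S + unit_vec v = R + unit_vec z" "y2 = R + unit_vec w"
          by (rule unit_vec_split2) (use zw in auto)
        show "y2 + unit_vec u \<notin> J"
        proof
          assume "y2 + unit_vec u \<in> J"
          then have 1: "0 < \<rho> (R + unit_vec w + unit_vec u)"
            using R pos by simp
          have y: "y0 + unit_vec v = R + unit_vec c + unit_vec z"
            using R(1) S(1) by (metis add.assoc add.commute)
          then have "0 < \<rho> (R + unit_vec c + unit_vec z)"
            using yJ pos by simp
          then have "R + unit_vec c + unit_vec u \<in> J"
            using T[OF R(1)[symmetric] refl in_n[OF z(4)]] 1 support[of "R + unit_vec c + unit_vec u"]
            by auto
          then show False
            using unique[OF y z(2) zlt z(4)] by simp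
        qed
      qed (use xJ xvJ y'J y'u uv in simp_all)
      have "(\<rho> (x0 + unit_vec u) * \<rho> (S + unit_vec c + unit_vec v)) * \<rho> (S + unit_vec w + unit_vec v)
          = (\<rho> (x0 + unit_vec u) * \<rho> (S + unit_vec w + unit_vec v)) * \<rho> (S + unit_vec c + unit_vec v)"
        by (simp only: mult.commute mult.left_commute)
      also have "\<dots> = \<rho> (x0 + unit_vec v) * (\<rho> (S + unit_vec c + unit_vec v) * \<rho> (S + unit_vec w + unit_vec u))"
        unfolding IH by (simp only: mult.commute mult.left_commute)
      also have "\<dots> = (\<rho> (x0 + unit_vec v) * \<rho> (S + unit_vec c + unit_vec u)) * \<rho> (S + unit_vec w + unit_vec v)"
        unfolding Tv by (simp only: mult.assoc)
      finally show ?thesis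
        using pos2 unfolding S(1) by simp
    qed
  qed
qed

end

section \<open>The terms of a Pluecker relation as exchange pairs\<close>

lemma sum_fun_apply: "(\<Sum>m\<in>A. f m) k = (\<Sum>m\<in>A. f m k)" for f :: "'b \<Rightarrow> 'c \<Rightarrow> 'd::comm_monoid_add"
  by (induction A rule: infinite_finite_induct) auto

text \<open>Applied to a largest term, the domination hypothesis produces a second index at which
  the maximum is attained.\<close>

lemma q_null_zeroI:
  assumes "finite K" "\<And>k. k \<in> K \<Longrightarrow> 0 \<le> b k"
    and "\<And>k. k \<in> K \<Longrightarrow> 0 < b k \<Longrightarrow> \<exists>l\<in>K. l \<noteq> k \<and> b k \<le> b l"
  shows "q_null 0 K b"
proof (cases "\<forall>k\<in>K. b k = 0")
  case False
  then obtain k0 where k0: "k0 \<in> K" "0 < b k0"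
    using assms(2) by force
  then have "Max (b ` K) \<in> b ` K"
    using assms(1) by (intro Max_in) auto
  then obtain k where k: "k \<in> K" "\<And>l. l \<in> K \<Longrightarrow> b l \<le> b k"
    using assms(1) by (metis (no_types, lifting) Max_ge finite_imageI image_eqI imageE)
  then obtain l where "l \<in> K" "l \<noteq> k" "b k \<le> b l"
    using assms(3) k0 by (meson less_le_trans)
  then have "max_attained_twice K b"
    unfolding max_attained_twice_def using k by (intro bexI[of _ k] bexI[of _ l]) (auto intro: antisym)
  then show ?thesis
    by (simp add: q_null_def)
qed (simp add: q_null_def)

context
  fixes \<alpha> :: "nat \<Rightarrow> nat" and i j :: "nat \<Rightarrow> nat" and s :: nat
begin

text \<open>The arguments of the two factors of the \<open>k\<close>-th term. Passing from index
  \<open>k\<close> to \<open>l\<close> adds \<open>unit_vec (i k)\<close> to the left argument and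
  \<open>unit_vec (i l)\<close> to the right one while removing the opposite unit, so any two terms
  are related by an exchange.\<close>

definition left_term :: "nat \<Rightarrow> nat \<Rightarrow> nat" where
  "left_term k = \<alpha> + (\<Sum>m\<in>{0..s} - {k}. unit_vec (i m))"

definition right_term :: "nat \<Rightarrow> nat \<Rightarrow> nat" where
  "right_term k = \<alpha> + unit_vec (i k) + (\<Sum>m=2..s. unit_vec (j m))"

lemma left_term_add:
  "k \<le> s \<Longrightarrow> left_term k + unit_vec (i k) = \<alpha> + (\<Sum>m=0..s. unit_vec (i m))"
  by (simp add: left_term_def sum.remove[of "{0..s}" k] ac_simps)

lemma left_term_swap:
  assumes "left_term k = z + unit_vec (i l)" "k \<le> s" "l \<le> s"
  shows "left_term l = z + unit_vec (i k)"
proof -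
  have "left_term l + unit_vec (i l) = (z + unit_vec (i k)) + unit_vec (i l)"
    using left_term_add[OF assms(2)] left_term_add[OF assms(3)] assms(1) by (simp only: ac_simps)
  then show ?thesis
    by (rule add_right_imp_eq)
qed

lemma left_term_cong: "i k = i l \<Longrightarrow> k \<le> s \<Longrightarrow> l \<le> s \<Longrightarrow> left_term k = left_term l"
  using left_term_add[of k] left_term_add[of l] by (metis add_right_imp_eq)

lemma right_term_cong: "i k = i l \<Longrightarrow> right_term k = right_term l"
  by (simp add: right_term_def)

lemma right_term_eq: "right_term k = (\<alpha> + (\<Sum>m=2..s. unit_vec (j m))) + unit_vec (i k)"
  by (simp add: right_term_def ac_simps)

lemma left_term_apply: "left_term k v = \<alpha> v + card {m\<in>{0..s}. m \<noteq> k \<and> i m = v}"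
proof -
  have "(\<Sum>m\<in>{0..s} - {k}. unit_vec (i m) v) = card {m\<in>{0..s}. m \<noteq> k \<and> i m = v}"
    unfolding unit_vec_apply by (subst sum.inter_filter[symmetric]) (auto intro: arg_cong[where f=card])
  then show ?thesis
    by (simp add: left_term_def sum_fun_apply)
qed

lemma index_of_left_term:
  assumes "\<alpha> v < left_term k v"
  obtains m where "m \<le> s" "m \<noteq> k" "i m = v"
proof -
  have "{m\<in>{0..s}. m \<noteq> k \<and> i m = v} \<noteq> {}"
  proof
    assume "{m\<in>{0..s}. m \<noteq> k \<and> i m = v} = {}"
    then show False
      using assms unfolding left_term_apply by (simp only: card.empty)
  qed
  then show ?thesis
    using that by auto
qed

lemma le_left_term: "\<alpha> v \<le> left_term k v"
  by (simp add: left_term_apply)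

lemma le_right_term: "\<alpha> v \<le> right_term k v"
  by (simp add: right_term_def)

end

text \<open>If the value \<open>i k\<close> occurs twice, two terms coincide. Otherwise the right
  argument exceeds the left one at \<open>i k\<close>, and an exchange partner \<open>v\<close> must
  be some \<open>i m\<close>, since the left argument exceeds \<alpha> there; the exchanged pair is
  the \<open>m\<close>-th term. Exchange is a hypothesis here so that the lemma covers both valuated
  exchange and mere membership in \<open>J\<close>.\<close>

lemma (in M_convex_function) relation_partner:
  assumes exch: "\<And>x y u. x \<in> J \<Longrightarrow> y \<in> J \<Longrightarrow> y u < x u \<Longrightarrow>
      \<exists>x0 y0 v. x = x0 + unit_vec u \<and> y = y0 + unit_vec v \<and> x v < y v \<and> v \<in> {1..n} \<and>
        \<rho> x * \<rho> y \<le> \<rho> (x0 + unit_vec v) * \<rho> (y0 + unit_vec u)"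
    and k: "k \<le> s" "0 < \<rho> (left_term \<alpha> i s k) * \<rho> (right_term \<alpha> i j s k)"
  shows "\<exists>l\<le>s. l \<noteq> k \<and>
    \<rho> (left_term \<alpha> i s k) * \<rho> (right_term \<alpha> i j s k) \<le> \<rho> (left_term \<alpha> i s l) * \<rho> (right_term \<alpha> i j s l)"
proof (cases "\<exists>m\<le>s. m \<noteq> k \<and> i m = i k")
  case True
  then show ?thesis
    using left_term_cong right_term_cong k(1) by (metis order_refl)
next
  case False
  have J: "left_term \<alpha> i s k \<in> J" "right_term \<alpha> i j s k \<in> J"
    using k(2) support by force+
  have "\<not> \<alpha> (i k) < left_term \<alpha> i s k (i k)"
    using False index_of_left_term by blast
  moreover have "\<alpha> (i k) < right_term \<alpha> i j s k (i k)"
    by (simp add: right_term_def unit_vec_apply)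
  ultimately have "left_term \<alpha> i s k (i k) < right_term \<alpha> i j s k (i k)"
    by simp
  from exch[OF J(2,1) this] obtain x0 y0 v where x0: "right_term \<alpha> i j s k = x0 + unit_vec (i k)"
    and y0: "left_term \<alpha> i s k = y0 + unit_vec v" and v: "right_term \<alpha> i j s k v < left_term \<alpha> i s k v"
    and le: "\<rho> (right_term \<alpha> i j s k) * \<rho> (left_term \<alpha> i s k) \<le> \<rho> (x0 + unit_vec v) * \<rho> (y0 + unit_vec (i k))"
    by blast
  have "\<alpha> v < left_term \<alpha> i s k v"
    using v le_right_term[of \<alpha> v i j s k] by simp
  then obtain m where m: "m \<le> s" "m \<noteq> k" "i m = v"
    by (rule index_of_left_term)
  have "left_term \<alpha> i s m = y0 + unit_vec (i k)"
    by (rule left_term_swap[OF _ k(1) m(1)]) (simp only: y0 m(3))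
  moreover have "x0 = \<alpha> + (\<Sum>m=2..s. unit_vec (j m))"
    by (rule add_right_imp_eq[OF x0[unfolded right_term_eq, symmetric]])
  ultimately show ?thesis
    using m le by (intro exI[of _ m]) (simp add: right_term_eq mult.commute)
qed

lemma (in M_convex_function) pluecker_zero:
  assumes "three_term n null3_zero \<rho>"
  shows "pluecker_relations n d J 0 s \<rho>"
  unfolding pluecker_relations_def left_term_def[symmetric] right_term_def[symmetric]
proof (intro ballI allI impI q_null_zeroI)
  fix \<alpha> i j k
  assume "k \<in> {0..s}" "0 < \<rho> (left_term \<alpha> i s k) * \<rho> (right_term \<alpha> i j s k)"
  then show "\<exists>l\<in>{0..s}. l \<noteq> k \<and> \<rho> (left_term \<alpha> i s k) * \<rho> (right_term \<alpha> i j s k)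
      \<le> \<rho> (left_term \<alpha> i s l) * \<rho> (right_term \<alpha> i j s l)"
    using relation_partner[OF valuated_exchange[OF assms], where i=i and s=s and k=k and \<alpha>=\<alpha> and j=j] by auto
qed (use nonneg in auto)

text \<open>The indicator function of \<open>J\<close> satisfies the exchange hypothesis by
  M-convexity alone, so domination of terms becomes existence of a second nonzero term.\<close>

lemma (in M_convex_set) support_partner:
  assumes "k \<le> s" "left_term \<alpha> i s k \<in> J" "right_term \<alpha> i j s k \<in> J"
  shows "\<exists>l\<le>s. l \<noteq> k \<and> left_term \<alpha> i s l \<in> J \<and> right_term \<alpha> i j s l \<in> J"
proof -
  interpret indic: M_convex_function n d J "\<lambda>x. if x \<in> J then 1 else 0"
    by unfold_locales auto
  have "\<exists>l\<le>s. l \<noteq> k \<and>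
      (if left_term \<alpha> i s k \<in> J then 1 else 0) * (if right_term \<alpha> i j s k \<in> J then 1 else 0)
      \<le> (if left_term \<alpha> i s l \<in> J then 1 else 0) * (if right_term \<alpha> i j s l \<in> J then 1 else 0 :: real)"
  proof (rule indic.relation_partner)
    fix x y u assume xy: "x \<in> J" "y \<in> J" "y u < (x u :: nat)"
    then obtain x0 y0 v where "x = x0 + unit_vec u" "y = y0 + unit_vec v" "x v < y v"
      "x0 + unit_vec v \<in> J" "y0 + unit_vec u \<in> J" "v \<in> {1..n}"
      by (rule exchange)
    then show "\<exists>x0 y0 v. x = x0 + unit_vec u \<and> y = y0 + unit_vec v \<and> x v < y v \<and> v \<in> {1..n} \<and>
        (if x \<in> J then 1 else 0) * (if y \<in> J then 1 else 0)
        \<le> (if x0 + unit_vec v \<in> J then 1 else 0) * (if y0 + unit_vec u \<in> J then 1 else 0 :: real)"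
      by (intro exI[of _ x0] exI[of _ y0] exI[of _ v]) simp
  qed (use assms in auto)
  then show ?thesis
    using assms by (auto split: if_splits)
qed

text \<open>A single nonzero term is excluded and three or more impose nothing. If exactly two terms
  survive, their indices describe the only possible exchange between the factors of a term, and
  \<open>unique_exchange_balanced\<close> makes the terms equal.\<close>

lemma (in M_convex_function) pluecker_infinity:
  assumes local: "three_term n null3_infinity \<rho>"
  shows "pluecker_relations n d J \<infinity> s \<rho>"
  unfolding pluecker_relations_def left_term_def[symmetric] right_term_def[symmetric]
proof (intro ballI allI impI)
  fix \<alpha> i j
  define X where "X = left_term \<alpha> i s"
  define Y where "Y = right_term \<alpha> i j s"
  define Z where "Z = \<alpha> + (\<Sum>m=2..s. unit_vec (j m))"
  have Y: "Y k = Z + unit_vec (i k)" for k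
    by (simp only: Y_def right_term_eq Z_def)
  define K where "K = {k\<in>{0..s}. \<rho> (X k) * \<rho> (Y k) \<noteq> 0}"
  have K: "k \<in> K \<longleftrightarrow> k \<le> s \<and> X k \<in> J \<and> Y k \<in> J" for k
    by (simp add: K_def support)
  have "finite K"
    by (simp add: K_def)
  have partner: "\<exists>l\<in>K. l \<noteq> k" if "k \<in> K" for k
  proof -
    have "k \<le> s" "left_term \<alpha> i s k \<in> J" "right_term \<alpha> i j s k \<in> J"
      using that unfolding K by (simp_all only: X_def Y_def)
    from support_partner[OF this] obtain l where
      "l \<le> s" "l \<noteq> k" "left_term \<alpha> i s l \<in> J" "right_term \<alpha> i j s l \<in> J"
      by blast
    then have "l \<in> K"
      unfolding K by (simp only: X_def Y_def)
    then show ?thesis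
      using \<open>l \<noteq> k\<close> by blast
  qed
  show "q_null \<infinity> {0..s} (\<lambda>k. \<rho> (left_term \<alpha> i s k) * \<rho> (right_term \<alpha> i j s k))"
    unfolding X_def[symmetric] Y_def[symmetric]
  proof (cases "K = {} \<or> 3 \<le> card K")
    case True
    then show "q_null \<infinity> {0..s} (\<lambda>k. \<rho> (X k) * \<rho> (Y k))"
    proof
      assume "K = {}"
      then have "\<rho> (X k) * \<rho> (Y k) = 0" if "k \<in> {0..s}" for k
        using that unfolding K_def by blast
      then show ?thesis
        by (simp add: q_null_def)
    next
      assume "3 \<le> card K"
      then show ?thesis
        by (simp add: q_null_def K_def)
    qed
  next
    case False
    then obtain a b where ab: "a \<in> K" "b \<in> K" "a \<noteq> b"
      using partner by blast
    have "K = {a, b}"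
      using False ab card_seteq[OF \<open>finite K\<close>, of "{a, b}"] by auto
    have ab_s: "a \<le> s" "b \<le> s" and ab_J: "X a \<in> J" "Y a \<in> J" "X b \<in> J" "Y b \<in> J"
      using ab(1,2)[unfolded K] by blast+
    have eq: "\<rho> (X a) * \<rho> (Y a) = \<rho> (X b) * \<rho> (Y b)"
    proof (cases "i a = i b")
      case True
      then show ?thesis
        using left_term_cong[of i a b s \<alpha>] right_term_cong[of i a b] ab_s by (simp add: X_def Y_def)
    next
      case False
      have only: "m = a \<or> m = b" if "m \<le> s" "i m = i a \<or> i m = i b" for m
      proof -
        have "m \<in> K"
          using that left_term_cong[of i m a s \<alpha>] right_term_cong[of i m a]
            left_term_cong[of i m b s \<alpha>] right_term_cong[of i m b] ab K by (auto simp: X_def Y_def)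
        then show ?thesis
          using \<open>K = {a, b}\<close> by blast
      qed
      \<comment> \<open>The value \<open>i k\<close> occurs only at the index \<open>k\<close>,
        which \<open>left_term\<close> omits.\<close>
      have at_alpha: "X k (i k) = \<alpha> (i k)" if "k \<in> {a, b}" for k
      proof (rule ccontr)
        assume "X k (i k) \<noteq> \<alpha> (i k)"
        then have "\<alpha> (i k) < X k (i k)"
          using le_left_term[of \<alpha> "i k" i s k] by (simp add: X_def)
        then obtain m where m: "m \<le> s" "m \<noteq> k" "i m = i k"
          unfolding X_def by (rule index_of_left_term)
        then have "m = a \<or> m = b"
          using that only by blast
        then show False
          using m that False by auto
      qed
      \<comment> \<open>Exchanging \<open>i a\<close> out of \<open>Y a\<close> must hit the other
        surviving index, so \<open>Z (i b) < X a (i b)\<close>; the right side is one more than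
        \<open>\<alpha> (i b)\<close>.\<close>
      have Z_le: "Z (i b) \<le> \<alpha> (i b)" if ab: "a \<in> K" "b \<in> K" "a \<noteq> b" "i a \<noteq> i b" "K = {a, b}"
          "X a (i a) = \<alpha> (i a)" "X b (i b) = \<alpha> (i b)" for a b
      proof -
        have *: "X a (i a) < Y a (i a)"
          unfolding that(6) by (simp add: Y Z_def unit_vec_apply)
        have YJ: "Y a \<in> J" "X a \<in> J" and as: "a \<le> s"
          using ab(1)[unfolded K] by blast+
        obtain x0 y0 v where x0: "Y a = x0 + unit_vec (i a)"
          and y0: "X a = y0 + unit_vec v" "Y a v < X a v" "x0 + unit_vec v \<in> J" "y0 + unit_vec (i a) \<in> J"
          by (rule exchange[OF YJ *])
        have "\<alpha> v < X a v"
          using y0(2) by (simp add: Y Z_def)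
        then obtain m where m: "m \<le> s" "m \<noteq> a" "i m = v"
          unfolding X_def by (rule index_of_left_term)
        have "X m = y0 + unit_vec (i a)"
          unfolding X_def by (rule left_term_swap[OF _ as m(1)]) (simp only: y0(1)[unfolded X_def] m(3))
        moreover have "x0 = Z"
          by (rule add_right_imp_eq[OF x0[unfolded Y, symmetric]])
        ultimately have "m \<in> K"
          using y0 m K by (simp add: Y)
        then have "m = b"
          using that(5) m by blast
        have "X b = y0 + unit_vec (i a)" "i b = v"
          using \<open>X m = _\<close> m \<open>m = b\<close> by simp_all
        then have "X b (i b) = y0 v" "X a v = y0 v + 1" "Y a v = Z v"
          using ab(4) y0(1) by (simp_all add: unit_vec_apply Y)
        then show ?thesis
          using y0(2) that(7) \<open>i b = v\<close> by simp
      qed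
      have Za: "Z (i a) = \<alpha> (i a)" and Zb: "Z (i b) = \<alpha> (i b)"
        using Z_le[of a b] Z_le[of b a] ab False \<open>K = {a, b}\<close> at_alpha by (auto simp: Z_def)
      have "\<alpha> (i b) < X a (i b)"
        using ab(3) ab_s unfolding X_def left_term_apply by (auto simp: card_gt_0_iff)
      then obtain I where I: "X a = I + unit_vec (i b)"
        using unit_vec_split by (metis less_nat_zero_code neq0_conv)
      have I': "X b = I + unit_vec (i a)"
        unfolding X_def by (rule left_term_swap[OF I[unfolded X_def] ab_s])
      have Ia: "I (i a) = \<alpha> (i a)"
        using at_alpha[of a] False unfolding I by (simp add: unit_vec_apply)
      have Ib: "I (i b) = \<alpha> (i b)"
        using at_alpha[of b] False unfolding I' by (simp add: unit_vec_apply)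
      \<comment> \<open>The pair is \<open>Y a\<close>, \<open>X a\<close> with
        \<open>u = i a\<close> and \<open>v = i b\<close>. Any other possible exchange would be an
        index outside \<open>{a, b}\<close> with a nonzero term.\<close>
      have "\<rho> (Z + unit_vec (i a)) * \<rho> (I + unit_vec (i b)) = \<rho> (Z + unit_vec (i b)) * \<rho> (I + unit_vec (i a))"
      proof (rule unique_exchange_balanced[OF local])
        fix z y1
        assume z: "I + unit_vec (i b) = y1 + unit_vec z" "z \<noteq> i b"
          "Z z + unit_vec (i a) z < I z + unit_vec (i b) z" "Z + unit_vec z \<in> J"
        have "\<alpha> z < X a z"
          using z(3) by (simp add: I Z_def)
        then obtain m where m: "m \<le> s" "m \<noteq> a" "i m = z"
          unfolding X_def by (rule index_of_left_term)
        have "X m = y1 + unit_vec (i a)"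
          unfolding X_def by (rule left_term_swap[OF _ ab_s(1) m(1)]) (simp only: I[unfolded X_def] z(1) m(3))
        moreover have "m \<notin> K"
          using m z(2) \<open>K = {a, b}\<close> by blast
        ultimately show "y1 + unit_vec (i a) \<notin> J"
          using m z(4) K Y by auto
      qed (use ab_J[unfolded I I' Y] False Za Zb Ia Ib in simp_all)
      then show ?thesis
        by (simp add: I I' Y mult.commute)
    qed
    have le: "\<rho> (X k) * \<rho> (Y k) \<le> \<rho> (X a) * \<rho> (Y a)" if "k \<in> {0..s}" for k
    proof (cases "k \<in> K")
      case True
      then show ?thesis
        using eq \<open>K = {a, b}\<close> by auto
    next
      case False
      then have "\<rho> (X k) * \<rho> (Y k) = 0"
        using that unfolding K_def by blast
      then show ?thesis
        using mult_nonneg_nonneg[OF nonneg[of "X a"] nonneg[of "Y a"]] by linarith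
    qed
    have "max_attained_twice {0..s} (\<lambda>k. \<rho> (X k) * \<rho> (Y k))"
      unfolding max_attained_twice_def
      by (rule bexI[of _ a], rule bexI[of _ b]) (use ab(3) eq le ab_s in simp_all)
    then show "q_null \<infinity> {0..s} (\<lambda>k. \<rho> (X k) * \<rho> (Y k))"
      by (simp add: q_null_def)
  qed
qed

section \<open>From the relations with s = 2 to unrestricted three-term relations\<close>

lemma null3_sym:
  "null3_zero x y z \<Longrightarrow> null3_zero y x z" "null3_zero x y z \<Longrightarrow> null3_zero x z y"
  "null3_infinity x y z \<Longrightarrow> null3_infinity y x z" "null3_infinity x y z \<Longrightarrow> null3_infinity x z y"
  unfolding null3_zero_def null3_infinity_def le_max_iff_disj by blast+

lemma null3_of_paired:
  assumes "x \<noteq> 0 \<Longrightarrow> x = y \<or> x = z" "y \<noteq> 0 \<Longrightarrow> y = x \<or> y = z" "z \<noteq> 0 \<Longrightarrow> z = x \<or> z = y"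
    and "0 \<le> x" "0 \<le> y" "0 \<le> z"
  shows "null3_zero x y z" "null3_infinity x y z"
  using assms unfolding null3_zero_def null3_infinity_def le_max_iff_disj by force+

lemma q_null_three:
  assumes "q = 0 \<and> P = null3_zero \<or> q = \<infinity> \<and> P = null3_infinity"
    and null: "q_null q {0..2::nat} b" and "\<And>k. 0 \<le> b k"
  shows "P (b 0) (b 1) (b 2)"
proof -
  have K: "{0..2::nat} = {0, 1, 2}"
    by auto
  have max: "null3_zero (b 0) (b 1) (b 2) \<and> null3_infinity (b 0) (b 1) (b 2)"
    if "(\<forall>k\<in>{0..2}. b k = 0) \<or> max_attained_twice {0..2} b"
    using that assms(3)[of 0] assms(3)[of 1] assms(3)[of 2]
    unfolding K max_attained_twice_def null3_zero_def null3_infinity_def by auto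
  show ?thesis
  proof (cases "(\<forall>k\<in>{0..2}. b k = 0) \<or> max_attained_twice {0..2} b")
    case True
    then show ?thesis
      using max assms(1) by auto
  next
    case False
    have "P = null3_infinity" "3 \<le> card {k\<in>{0..2}. b k \<noteq> 0}"
      using null assms(1) False unfolding q_null_def by (auto split: if_splits)
    moreover have "card {0..2::nat} = 3"
      by simp
    ultimately have "{k\<in>{0..2}. b k \<noteq> 0} = {0..2}"
      by (intro card_seteq) auto
    then have "b 0 \<noteq> 0" "b 1 \<noteq> 0" "b 2 \<noteq> 0"
      by (metis (mono_tags, lifting) K insertCI mem_Collect_eq)+
    then show ?thesis
      using \<open>P = null3_infinity\<close> by (simp add: null3_infinity_def)
  qed
qed

text \<open>
  The bounds in the definition of the relations only exclude relations that hold trivially.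
\<close>

lemma (in M_convex_function) three_termI:
  assumes P: "q = 0 \<and> P = null3_zero \<or> q = \<infinity> \<and> P = null3_infinity"
    and weak: "2 \<le> d \<Longrightarrow> pluecker_relations n d J q 2 \<rho>"
  shows "three_term n P \<rho>"
proof -
  define t where "t S a b c e = \<rho> (S + unit_vec a + unit_vec b) * \<rho> (S + unit_vec c + unit_vec e)"
    for S a b c e
  have t_sym: "t S b a c e = t S a b c e" "t S a b e c = t S a b c e" "t S c e a b = t S a b c e"
    for S a b c e
    by (simp_all add: t_def ac_simps)
  have t_nonneg: "0 \<le> t S a b c e" for S a b c e
    using nonneg by (simp add: t_def)
  have P_sym: "P x y z \<Longrightarrow> P y x z" "P x y z \<Longrightarrow> P x z y" for x y z
    using P null3_sym by metis+
  have P_eq: "P x y z" if "x \<noteq> 0 \<Longrightarrow> x = y \<or> x = z" "y \<noteq> 0 \<Longrightarrow> y = x \<or> y = z"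
      "z \<noteq> 0 \<Longrightarrow> z = x \<or> z = y" "0 \<le> x" "0 \<le> y" "0 \<le> z" for x y z
    using P null3_of_paired[OF that] by metis
  have sorted: "P (t S a b c e) (t S a c b e) (t S a e b c)"
    if "a \<le> b" "b \<le> c" and abce: "{a, b, c, e} \<subseteq> {1..n}" for S a b c e
  proof (cases "2 \<le> d \<and> S \<in> Delta n (d - 2) \<and> delta_minus J \<le> S \<and>
      S + unit_vec a + unit_vec b + unit_vec c + unit_vec e \<le> delta_plus J")
    case True
    \<comment> \<open>With \<open>i = (a, b, c)\<close> and \<open>j 2 = e\<close>, the terms with k
      = 0, 1, 2 pair \<open>e\<close> with \<open>a\<close>, \<open>b\<close>, \<open>c\<close>
      respectively.\<close>
    define i where "i = (\<lambda>m::nat. if m = 0 then a else if m = 1 then b else c)"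
    have K: "{0..2} = {0, 1, 2::nat}" "{2..2} = {2::nat}" "{0, 1, 2} - {0} = {1, 2::nat}"
      "{0, Suc 0, 2} - {Suc 0} = {0, 2}" "{0, Suc 0, 2} - {2} = {0, Suc 0}"
      by auto
    have "mono_on {0..2} i"
      using that by (auto simp: i_def mono_on_def)
    moreover have "i ` {0..2} \<subseteq> {1..n}" "(\<lambda>_. e) ` {2..2::nat} \<subseteq> {1..n}"
      using abce by (auto simp: i_def)
    moreover have "mono_on {2..2::nat} (\<lambda>_. e)"
      by (simp add: mono_on_def)
    moreover have "S + (\<Sum>m=0..2. unit_vec (i m)) + (\<Sum>m=2..2::nat. unit_vec e) \<le> delta_plus J"
      using True by (simp add: K i_def add.assoc)
    ultimately have null: "q_null q {0..2} (\<lambda>k. \<rho> (S + (\<Sum>m\<in>{0..2} - {k}. unit_vec (i m)))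
        * \<rho> (S + unit_vec (i k) + (\<Sum>m=2..2::nat. unit_vec e)))"
      using weak True unfolding pluecker_relations_def by blast
    have "P (t S b c a e) (t S a c b e) (t S a b c e)"
      using q_null_three[OF P null mult_nonneg_nonneg[OF nonneg nonneg]] by (simp add: K i_def t_def add.assoc)
    moreover have "t S b c a e = t S a e b c"
      by (rule t_sym)
    ultimately show ?thesis
      using P_sym by metis
  next
    case False
    \<comment> \<open>If the two pairs of a nonzero term shared no index, then at each coordinate
      \<open>S\<close> would agree with one of its two factors and the full sum with one as well, so
      \<open>S\<close> would satisfy the degree and bound conditions just excluded. Hence a nonzero
      term has a shared index, and exchanging the other two indices shows that it equals another
      term.\<close>
    have common: "x = z \<or> x = w \<or> y = z \<or> y = w"
      if nz: "t S x y z w \<noteq> 0" and perm: "unit_vec x + unit_vec y + unit_vec z + unit_vec w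
        = unit_vec a + unit_vec b + unit_vec c + unit_vec e"
        and xyn: "{x, y, z, w} \<subseteq> {1..n}" for x y z w
    proof (rule ccontr)
      assume neq: "\<not> ?thesis"
      have J: "S + unit_vec x + unit_vec y \<in> J" "S + unit_vec z + unit_vec w \<in> J"
        using nz support by (auto simp: t_def)
      have d: "2 \<le> d" and S: "S \<in> Delta n (d - 2)"
      proof -
        have "S + unit_vec x + unit_vec y \<in> Delta n d"
          using J J_Delta by blast
        moreover from this have "d = (\<Sum>i=1..n. S i) + 2"
          using xyn by (simp add: Delta_def unit_vec_apply sum.distrib)
        moreover from this have "d = Suc (Suc (d - 2))"
          by simp
        ultimately show "2 \<le> d" "S \<in> Delta n (d - 2)"
          using xyn Delta_add_unit_vec by (simp, metis insert_subset)
      qed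
      have bounds: "delta_minus J v \<le> z v" "z v \<le> delta_plus J v" if "z \<in> J" for z v
        using that finite_J by (auto simp: delta_minus_def delta_plus_def)
      have "delta_minus J v \<le> S v" for v
        using bounds(1)[OF J(1), of v] bounds(1)[OF J(2), of v] neq
        by (auto simp: unit_vec_apply split: if_splits)
      moreover have "(S + unit_vec x + unit_vec y + unit_vec z + unit_vec w) v \<le> delta_plus J v" for v
        using bounds(2)[OF J(1), of v] bounds(2)[OF J(2), of v] neq
        by (auto simp: unit_vec_apply split: if_splits)
      moreover have "S + unit_vec x + unit_vec y + unit_vec z + unit_vec w
          = S + unit_vec a + unit_vec b + unit_vec c + unit_vec e"
        using arg_cong[OF perm, of "\<lambda>z. S + z"] by (simp only: add.assoc)
      ultimately show False
        using False d S unfolding le_fun_def by auto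
    qed
    show ?thesis
    proof (rule P_eq)
      show "t S a b c e = t S a c b e \<or> t S a b c e = t S a e b c" if "t S a b c e \<noteq> 0"
        using common[OF that refl abce] by (auto simp: t_def ac_simps)
      show "t S a c b e = t S a b c e \<or> t S a c b e = t S a e b c" if "t S a c b e \<noteq> 0"
      proof -
        have "a = b \<or> a = e \<or> c = b \<or> c = e"
          by (rule common[OF that]) (use abce in \<open>auto simp: ac_simps\<close>)
        then show ?thesis
          by (auto simp: t_def ac_simps)
      qed
      show "t S a e b c = t S a b c e \<or> t S a e b c = t S a c b e" if "t S a e b c \<noteq> 0"
      proof -
        have "a = b \<or> a = c \<or> e = b \<or> e = c"
          by (rule common[OF that]) (use abce in \<open>auto simp: ac_simps\<close>)
        then show ?thesis
          by (auto simp: t_def ac_simps)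
      qed
    qed (rule t_nonneg)+
  qed
  \<comment> \<open>Only the first three indices have to be sorted; two adjacent transpositions
    reach all six orders.\<close>
  have swap: "P (t S b a c e) (t S b c a e) (t S b e a c)" "P (t S a c b e) (t S a b c e) (t S a e c b)"
    if "P (t S a b c e) (t S a c b e) (t S a e b c)" for S a b c e
  proof -
    have eqs: "t S b a c e = t S a b c e" "t S b c a e = t S a e b c" "t S b e a c = t S a c b e"
      "t S a e c b = t S a e b c"
      by (simp_all add: t_def ac_simps)
    show "P (t S b a c e) (t S b c a e) (t S b e a c)" "P (t S a c b e) (t S a b c e) (t S a e c b)"
      by (simp_all only: eqs P_sym(2)[OF that] P_sym(1)[OF that])
  qed
  have "P (t S a b c e) (t S a c b e) (t S a e b c)" if abce: "{a, b, c, e} \<subseteq> {1..n}" for S a b c e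
  proof -
    have *: "{a, c, b, e} \<subseteq> {1..n}" "{b, a, c, e} \<subseteq> {1..n}" "{b, c, a, e} \<subseteq> {1..n}"
      "{c, a, b, e} \<subseteq> {1..n}" "{c, b, a, e} \<subseteq> {1..n}"
      using abce by auto
    consider "a \<le> b" "b \<le> c" | "a \<le> c" "c \<le> b" | "b \<le> a" "a \<le> c" | "b \<le> c" "c \<le> a"
      | "c \<le> a" "a \<le> b" | "c \<le> b" "b \<le> a"
      by linarith
    then show ?thesis
    proof cases
      case 1 then show ?thesis by (rule sorted[OF _ _ abce])
    next
      case 2 then show ?thesis by (intro swap(2)[OF sorted[OF _ _ *(1)]])
    next
      case 3 then show ?thesis by (intro swap(1)[OF sorted[OF _ _ *(2)]])
    next
      case 4 then show ?thesis by (intro swap(1)[OF swap(2)[OF sorted[OF _ _ *(3)]]])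
    next
      case 5 then show ?thesis by (intro swap(2)[OF swap(1)[OF sorted[OF _ _ *(4)]]])
    next
      case 6 then show ?thesis by (intro swap(1)[OF swap(2)[OF swap(1)[OF sorted[OF _ _ *(5)]]]])
    qed
  qed
  then show ?thesis
    unfolding three_term_def t_def[symmetric] by blast
qed

lemma weak_reps_eq_strong_reps:
  assumes "M_convex n d J" "q = 0 \<or> q = \<infinity>"
  shows "weak_reps n d J q = strong_reps n d J q"
proof
  show "strong_reps n d J q \<subseteq> weak_reps n d J q"
    by (auto simp: strong_reps_def weak_reps_def)
  show "weak_reps n d J q \<subseteq> strong_reps n d J q"
  proof
    fix \<rho> assume \<rho>: "\<rho> \<in> weak_reps n d J q"
    interpret M_convex_function n d J \<rho>
      using \<rho> assms(1) by unfold_locales (auto simp: weak_reps_def)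
    have weak: "2 \<le> d \<Longrightarrow> pluecker_relations n d J q 2 \<rho>"
      using \<rho> by (simp add: weak_reps_def)
    have "pluecker_relations n d J q s \<rho>" for s
      using assms(2) pluecker_zero pluecker_infinity three_termI[OF _ weak] by blast
    then show "\<rho> \<in> strong_reps n d J q"
      using \<rho> by (simp add: weak_reps_def strong_reps_def)
  qed
qed

subsection \<open>Quotients and coordinates\<close>

text \<open>When \<open>f\<close> and \<open>p\<close> have the same fibers, the preimage under
  \<open>f\<close> of the image of \<open>U\<close> is the preimage of \<open>U\<close> under
  \<open>p\<close>, hence open. This identifies both the torus quotient and V/W with coordinate
  sets, and no properness of the action has to be discussed.\<close>

lemma homeomorphic_map_quotient_section:
  assumes p: "continuous_map X Y p" and s: "continuous_map Y X s"
    and ps: "\<And>y. y \<in> topspace Y \<Longrightarrow> p (s y) = y"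
    and fibers: "\<And>x x'. x \<in> topspace X \<Longrightarrow> x' \<in> topspace X \<Longrightarrow> f x = f x' \<longleftrightarrow> p x = p x'"
  shows "homeomorphic_map Y (quotient_topology X f) (f \<circ> s)"
proof (rule bijective_open_imp_homeomorphic_map)
  have sX: "s y \<in> topspace X" if "y \<in> topspace Y" for y
    using continuous_map_image_subset_topspace[OF s] that by blast
  have pY: "p x \<in> topspace Y" if "x \<in> topspace X" for x
    using continuous_map_image_subset_topspace[OF p] that by blast
  have fs: "f (s (p x)) = f x" if "x \<in> topspace X" for x
    using fibers[OF sX[OF pY[OF that]] that] ps[OF pY[OF that]] by simp
  show "continuous_map Y (quotient_topology X f) (f \<circ> s)"
    by (rule continuous_map_compose[OF s quotient_imp_continuous_map[OF quotient_map_quotient_topology]])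
  show "inj_on (f \<circ> s) (topspace Y)"
  proof (rule inj_onI)
    fix y y' assume "y \<in> topspace Y" "y' \<in> topspace Y" "(f \<circ> s) y = (f \<circ> s) y'"
    then show "y = y'"
      using fibers[OF sX sX, of y y'] ps[of y] ps[of y'] by simp
  qed
  show "(f \<circ> s) ` topspace Y = topspace (quotient_topology X f)"
    unfolding topspace_quotient_topology
  proof
    show "(f \<circ> s) ` topspace Y \<subseteq> f ` topspace X"
      using sX by auto
    show "f ` topspace X \<subseteq> (f \<circ> s) ` topspace Y"
    proof
      fix z assume "z \<in> f ` topspace X"
      then obtain x where x: "x \<in> topspace X" "z = f x"
        by blast
      then have "z = (f \<circ> s) (p x)"
        using fs by simp
      then show "z \<in> (f \<circ> s) ` topspace Y"
        using pY x by blast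
    qed
  qed
  show "open_map Y (quotient_topology X f) (f \<circ> s)"
    unfolding open_map_def
  proof (intro allI impI)
    fix U assume U: "openin Y U"
    have "x \<in> topspace X \<and> f x \<in> (f \<circ> s) ` U \<longleftrightarrow> x \<in> topspace X \<and> p x \<in> U" for x
    proof -
      have "f x = f (s y) \<longleftrightarrow> p x = y" if "x \<in> topspace X" "y \<in> U" for y
        using fibers[OF that(1) sX] ps that openin_subset[OF U] by auto
      then show ?thesis
        by auto
    qed
    then have "{x \<in> topspace X. f x \<in> (f \<circ> s) ` U} = {x \<in> topspace X. p x \<in> U}"
      by blast
    moreover have "openin X {x \<in> topspace X. p x \<in> U}"
      by (rule openin_continuous_map_preimage[OF p U])
    moreover have "(f \<circ> s) ` U \<subseteq> f ` topspace X"
      using sX openin_subset[OF U] by auto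
    ultimately show "openin (quotient_topology X f) ((f \<circ> s) ` U)"
      by (simp add: openin_quotient_topology)
  qed
qed

definition coord_space :: "nat \<Rightarrow> (nat \<Rightarrow> real) set" where
  "coord_space m = {x. \<forall>i\<ge>m. x i = 0}"

lemma Euclidean_space_eq: "Euclidean_space m = top_of_set (coord_space m)"
  by (simp add: Euclidean_space_def euclidean_product_topology coord_space_def)

lemma zero_in_coord_space: "0 \<in> coord_space m"
  by (simp add: coord_space_def)

lemma scaleR_fun_apply [simp]: "(c *\<^sub>R f) x = c *\<^sub>R f x" for f :: "'a \<Rightarrow> 'b::real_vector"
  by (simp add: scaleR_fun_def)

lemma scaleR_in_coord_space: "x \<in> coord_space m \<Longrightarrow> c *\<^sub>R x \<in> coord_space m"
  by (simp add: coord_space_def)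

lemma continuous_on_scaleR_fun:
  fixes f :: "'b::topological_space \<Rightarrow> 'a \<Rightarrow> real"
  assumes "continuous_on S h" "continuous_on S f"
  shows "continuous_on S (\<lambda>x. h x *\<^sub>R f x)"
  unfolding continuous_on_coordinatewise_iff
  using assms by (auto simp: intro!: continuous_intros dest: continuous_on_product_then_coordinatewise)

text \<open>A linear functional on all functions need not be continuous in the product topology; on
  functions supported in a finite set it is a finite sum of coordinates.\<close>

lemma linear_on_finite_support:
  fixes \<phi> :: "('a \<Rightarrow> real) \<Rightarrow> real"
  assumes "linear \<phi>" "finite J" "\<And>a. a \<notin> J \<Longrightarrow> v a = 0"
  shows "\<phi> v = (\<Sum>a\<in>J. v a * \<phi> (\<lambda>b. if b = a then 1 else 0))"
proof -
  have "v = (\<Sum>a\<in>J. v a *\<^sub>R (\<lambda>b. if b = a then 1 else 0))"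
    using assms(2,3) by (auto simp: fun_eq_iff sum_fun_apply if_distrib[of "\<lambda>x. _ * x"] cong: if_cong)
  then have "\<phi> v = \<phi> (\<Sum>a\<in>J. v a *\<^sub>R (\<lambda>b. if b = a then 1 else 0))"
    by simp
  also have "\<dots> = (\<Sum>a\<in>J. v a * \<phi> (\<lambda>b. if b = a then 1 else 0))"
    using assms(1) by (simp add: linear_sum linear_cmul)
  finally show ?thesis .
qed

text \<open>A basis of \<open>W\<close> is extended to one of \<open>V\<close>; the added basis
  vectors span a complement. Coefficients along them give \<open>\<pi>\<close>, and the
  corresponding linear combinations give the section \<open>\<sigma>\<close>.\<close>

lemma quotient_coordinates:
  fixes V W :: "('a \<Rightarrow> real) set"
  assumes J: "finite J" and off: "\<forall>v\<in>V. \<forall>a. a \<notin> J \<longrightarrow> v a = 0"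
    and V: "subspace V" and W: "subspace W" "W \<subseteq> V"
  obtains m \<pi> \<sigma> where "linear \<pi>" "linear \<sigma>" "continuous_on V \<pi>" "continuous_on UNIV \<sigma>"
    "\<And>x. \<sigma> x \<in> V" "\<And>v. \<pi> v \<in> coord_space m" "\<And>x. x \<in> coord_space m \<Longrightarrow> \<pi> (\<sigma> x) = x"
    "\<And>v. v \<in> V \<Longrightarrow> v - \<sigma> (\<pi> v) \<in> W" "\<And>w. w \<in> W \<Longrightarrow> \<pi> w = 0"
proof -
  obtain BW where BW: "BW \<subseteq> W" "independent BW" "W \<subseteq> span BW"
    using maximal_independent_subset by blast
  obtain BV where BV: "BW \<subseteq> BV" "BV \<subseteq> V" "independent BV" "V \<subseteq> span BV"
    by (rule maximal_independent_subset_extend[OF subset_trans[OF BW(1) W(2)] BW(2)])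
  \<comment> \<open>Extending further to a basis of the whole function space makes the coefficient
    maps linear everywhere, as the type-wide predicate \<open>linear\<close> demands.\<close>
  define D where "D = real_vector.extend_basis BV"
  have D: "BV \<subseteq> D" "independent D" "span D = UNIV"
    unfolding D_def
    by (rule real_vector.extend_basis_superset[OF BV(3)], rule real_vector.independent_extend_basis[OF BV(3)],
        rule real_vector.span_extend_basis[OF BV(3)])
  define \<delta> :: "'a \<Rightarrow> 'a \<Rightarrow> real" where "\<delta> a = (\<lambda>b. if b = a then 1 else 0)" for a
  have "V \<subseteq> span (\<delta> ` J)"
  proof
    fix v assume "v \<in> V"
    then have "v = (\<Sum>a\<in>J. v a *\<^sub>R \<delta> a)"
      using J off \<open>v \<in> V\<close> by (auto simp: fun_eq_iff sum_fun_apply \<delta>_def if_distrib[of "\<lambda>x. _ * x"] cong: if_cong)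
    moreover have "(\<Sum>a\<in>J. v a *\<^sub>R \<delta> a) \<in> span (\<delta> ` J)"
      by (intro span_sum span_scale span_base) auto
    ultimately show "v \<in> span (\<delta> ` J)"
      by simp
  qed
  then have "BV \<subseteq> span (\<delta> ` J)"
    using BV(2) by blast
  then have finBV: "finite BV"
    using independent_span_bound[OF _ BV(3)] J by blast
  then obtain u where u: "bij_betw u {..<card (BV - BW)} (BV - BW)"
    using ex_bij_betw_nat_finite[of "BV - BW"] by (auto simp: lessThan_atLeast0)
  define m where "m = card (BV - BW)"
  note u = u[folded m_def]
  define R where "R v b = real_vector.representation D v b" for v b
  define \<pi> where "\<pi> v = (\<lambda>i. if i < m then R v (u i) else 0)" for v
  define \<sigma> where "\<sigma> x = (\<Sum>i<m. x i *\<^sub>R u i)" for x :: "nat \<Rightarrow> real"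
  have linR: "linear (\<lambda>v. R v b)" for b
  proof (rule linearI)
    show "R (x + y) b = R x b + R y b" for x y
      unfolding R_def using D by (simp add: real_vector.representation_add)
    show "R (c *\<^sub>R x) b = c *\<^sub>R R x b" for c x
      unfolding R_def using D by (simp add: real_vector.representation_scale)
  qed
  have Rb: "R b b' = (if b' = b then 1 else 0)" if "b \<in> D" for b b'
    unfolding R_def by (simp add: real_vector.representation_basis[OF D(2) that])
  have RV: "R v = real_vector.representation B v" if "v \<in> span B" "B \<subseteq> D" for B v
    unfolding R_def using real_vector.representation_extend[OF D(2) that] by blast
  have uV: "u i \<in> BV - BW" if "i < m" for i
    using u that by (auto simp: bij_betw_def)
  have inj: "u i = u k \<longleftrightarrow> i = k" if "i < m" "k < m" for i k
    using u that by (auto simp: bij_betw_def inj_on_def)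
  show ?thesis
  proof (rule that[of \<pi> \<sigma> m])
    show lp: "linear \<pi>"
      by (rule linearI) (auto simp: \<pi>_def fun_eq_iff linear_add[OF linR] linear_cmul[OF linR])
    show "linear \<sigma>"
      by (rule linearI)
        (simp_all add: \<sigma>_def scaleR_add_left sum.distrib scaleR_right.sum)
    show "continuous_on V \<pi>"
    proof (rule continuous_on_coordinatewise_then_product)
      fix i
      have "\<pi> v i = (if i < m then \<Sum>a\<in>J. v a * R (\<lambda>b. if b = a then 1 else 0) (u i) else 0)"
        if "v \<in> V" for v
        unfolding \<pi>_def using linear_on_finite_support[OF linR J, of v] off that by simp
      moreover have "continuous_on V
          (\<lambda>v. if i < m then \<Sum>a\<in>J. v a * R (\<lambda>b. if b = a then 1 else 0) (u i) else 0)"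
      proof (cases "i < m")
        case True
        have "continuous_on V (\<lambda>v. v a)" for a
          by (rule continuous_on_subset[OF continuous_on_product_coordinates subset_UNIV])
        then show ?thesis
          using True by (simp add: continuous_on_sum continuous_on_mult_right)
      qed simp
      ultimately show "continuous_on V (\<lambda>v. \<pi> v i)"
        by (simp cong: continuous_on_cong)
    qed
    show "continuous_on UNIV \<sigma>"
      unfolding \<sigma>_def
      by (rule continuous_on_coordinatewise_then_product)
        (auto simp: sum_fun_apply intro!: continuous_intros)
    show "\<sigma> x \<in> V" for x
      unfolding \<sigma>_def using uV BV(2) V by (auto intro!: subspace_sum subspace_scale)
    show "\<pi> v \<in> coord_space m" for v
      by (simp add: \<pi>_def coord_space_def)
    show "\<pi> (\<sigma> x) = x" if "x \<in> coord_space m" for x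
    proof
      fix k
      show "\<pi> (\<sigma> x) k = x k"
      proof (cases "k < m")
        case True
        have "R (\<sigma> x) (u k) = (\<Sum>i<m. x i * R (u i) (u k))"
          unfolding \<sigma>_def by (simp add: linear_sum[OF linR] linear_cmul[OF linR])
        also have "\<dots> = (\<Sum>i<m. if i = k then x i else 0)"
          using uV D(1) True inj by (intro sum.cong) (auto simp: Rb subset_iff)
        also have "\<dots> = x k"
          using True by simp
        finally show ?thesis
          using True by (simp add: \<pi>_def)
      qed (use that in \<open>simp add: \<pi>_def coord_space_def\<close>)
    qed
    show "\<pi> w = 0" if "w \<in> W" for w
    proof
      fix i
      have "R w = real_vector.representation BW w"
        using RV BW BV D that by blast
      then have "R w (u i) = 0" if "i < m"
        using real_vector.representation_ne_zero[of BW w "u i"] uV[OF that] by auto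
      then show "\<pi> w i = 0 i"
        by (simp add: \<pi>_def)
    qed
    show "v - \<sigma> (\<pi> v) \<in> W" if "v \<in> V" for v
    proof -
      have vB: "v \<in> span BV"
        using that BV by blast
      have "v = (\<Sum>b\<in>BV. R v b *\<^sub>R b)"
        using real_vector.sum_representation_eq[OF BV(3) vB finBV order_refl] RV[OF vB D(1)] by simp
      also have "\<dots> = (\<Sum>b\<in>BV - BW. R v b *\<^sub>R b) + (\<Sum>b\<in>BW. R v b *\<^sub>R b)"
        by (rule sum.subset_diff[OF BV(1) finBV])
      also have "(\<Sum>b\<in>BV - BW. R v b *\<^sub>R b) = (\<Sum>i<m. R v (u i) *\<^sub>R u i)"
        by (rule sum.reindex_bij_betw[OF u, symmetric])
      also have "\<dots> = \<sigma> (\<pi> v)"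
        by (simp add: \<sigma>_def \<pi>_def)
      finally have "v - \<sigma> (\<pi> v) = (\<Sum>b\<in>BW. R v b *\<^sub>R b)"
        by (metis add_diff_cancel_left')
      also have "\<dots> \<in> W"
        using BW(1) by (intro subspace_sum[OF W(1)] subspace_scale[OF W(1)]) auto
      finally show ?thesis .
    qed
  qed
qed

subsection \<open>Gauges and radial homeomorphisms\<close>

text \<open>Just what gauges and norms share. Subadditivity and symmetry are absent because a gauge
  here need not come from a convex or symmetric set.\<close>

definition homogeneous_on :: "('a \<Rightarrow> real) set \<Rightarrow> (('a \<Rightarrow> real) \<Rightarrow> real) \<Rightarrow> bool" where
  "homogeneous_on E g \<longleftrightarrow> (\<forall>x\<in>E. 0 \<le> g x \<and> (\<forall>t\<ge>0. g (t *\<^sub>R x) = t * g x))"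

text \<open>The values below \<open>c\<close> are detected by \<open>U\<close> and the values at
  most \<open>c\<close> by \<open>L\<close>, after rescaling by \<open>inverse c\<close>. The first
  set is open and the second closed, which yields semicontinuity from both sides.\<close>

lemma continuous_gauge:
  fixes E L U :: "('a \<Rightarrow> real) set"
  assumes E: "\<And>x c. x \<in> E \<Longrightarrow> c *\<^sub>R x \<in> E"
    and L: "closedin (top_of_set E) L" "0 \<in> L" and U: "openin (top_of_set E) U" "U \<subseteq> L"
    and scale: "\<And>x t. x \<in> L \<Longrightarrow> 0 \<le> t \<Longrightarrow> t < 1 \<Longrightarrow> t *\<^sub>R x \<in> U"
  obtains g where "homogeneous_on E g" "continuous_on E g" "L = {x\<in>E. g x \<le> 1}"
    "\<And>x. x \<in> E \<Longrightarrow> g x = 0 \<longleftrightarrow> (\<forall>t\<ge>0. t *\<^sub>R x \<in> L)"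
proof -
  define S where "S x = {c. 0 < c \<and> inverse c *\<^sub>R x \<in> L}" for x
  define g where "g x = Inf (S x)" for x
  have LE: "L \<subseteq> E"
    using L(1) closedin_imp_subset by blast
  have zero: "0 \<in> U"
    using scale[OF L(2), of 0] by simp
  have ray: "continuous_on UNIV (\<lambda>t. t *\<^sub>R x)" for x :: "'a \<Rightarrow> real"
    by (intro continuous_on_scaleR_fun continuous_intros)
  have openray: "openin euclidean {t. t *\<^sub>R x \<in> U}" if "x \<in> E" for x
  proof -
    have "continuous_map euclidean (top_of_set E) (\<lambda>t. t *\<^sub>R x)"
      using ray E[OF that] by (auto simp: continuous_map_in_subtopology)
    then have "openin euclidean {t \<in> topspace euclidean. t *\<^sub>R x \<in> U}"
      using openin_continuous_map_preimage U(1) by blast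
    then show ?thesis
      by simp
  qed
  have closedray: "closedin euclidean {t. t *\<^sub>R x \<in> L}" if "x \<in> E" for x
  proof -
    have "continuous_map euclidean (top_of_set E) (\<lambda>t. t *\<^sub>R x)"
      using ray E[OF that] by (auto simp: continuous_map_in_subtopology)
    then have "closedin euclidean {t \<in> topspace euclidean. t *\<^sub>R x \<in> L}"
      using closedin_continuous_map_preimage L(1) by blast
    then show ?thesis
      by simp
  qed
  \<comment> \<open>Openness of \<open>U\<close> along the ray: from a point of \<open>U\<close> one
    can go slightly further out. At \<open>t = 0\<close> this shows that every ray meets
    \<open>U\<close> away from its start.\<close>
  have beyond: "\<exists>s>t. s *\<^sub>R x \<in> U" if x: "x \<in> E" "t *\<^sub>R x \<in> U" for x t
  proof -
    have "open {t. t *\<^sub>R x \<in> U}"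
      using openray[OF x(1)] by simp
    then obtain e where e: "0 < e" "ball t e \<subseteq> {t. t *\<^sub>R x \<in> U}"
      using x(2) openE by blast
    then have "t + e / 2 \<in> {t. t *\<^sub>R x \<in> U}"
      by (intro subsetD[OF e(2)]) (simp add: dist_real_def)
    then show ?thesis
      using e(1) by (intro exI[of _ "t + e / 2"]) simp
  qed
  have S_ne: "S x \<noteq> {}" if x: "x \<in> E" for x
  proof -
    obtain s where "0 < s" "s *\<^sub>R x \<in> U"
      using beyond[OF x, of 0] zero by auto
    then have "inverse s \<in> S x"
      using U(2) by (auto simp: S_def)
    then show ?thesis
      by blast
  qed
  have bdd: "bdd_below (S x)" for x
    by (rule bdd_belowI[of _ 0]) (simp add: S_def)
  have g_nonneg: "0 \<le> g x" if "x \<in> E" for x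
    unfolding g_def by (rule cInf_greatest[OF S_ne[OF that]]) (simp add: S_def)
  \<comment> \<open>Forward, a smaller admissible \<open>c0\<close> leaves the factor
    \<open>c0 / c < 1\<close>, and \<open>scale\<close> moves the point into \<open>U\<close>.
    Backward, \<open>beyond\<close> gives a larger multiple and thus an admissible value below
    \<open>c\<close>.\<close>
  have lt: "g x < c \<longleftrightarrow> inverse c *\<^sub>R x \<in> U" if x: "x \<in> E" "0 < c" for x c
  proof
    assume "g x < c"
    then obtain c0 where c0: "c0 \<in> S x" "c0 < c"
      unfolding g_def using cInf_lessD[OF S_ne[OF x(1)]] by blast
    then have "(c0 / c) *\<^sub>R (inverse c0 *\<^sub>R x) \<in> U"
      using x by (intro scale) (auto simp: S_def)
    moreover have "(c0 / c) * inverse c0 = inverse c"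
      using c0 by (simp add: S_def field_simps)
    ultimately show "inverse c *\<^sub>R x \<in> U"
      by simp
  next
    assume "inverse c *\<^sub>R x \<in> U"
    then obtain s where s: "inverse c < s" "s *\<^sub>R x \<in> U"
      using beyond x by blast
    have spos: "0 < s"
      using s(1) x(2) by (meson inverse_positive_iff_positive less_trans)
    then have "inverse s \<in> S x"
      using s(2) U(2) by (auto simp: S_def)
    then have "g x \<le> inverse s"
      unfolding g_def by (rule cInf_lower[OF _ bdd])
    also have "inverse s < c"
      using s(1) spos x(2) by (metis inverse_inverse_eq inverse_less_iff_less inverse_positive_iff_positive)
    finally show "g x < c" .
  qed
  have le: "g x \<le> c \<longleftrightarrow> inverse c *\<^sub>R x \<in> L" if x: "x \<in> E" and c: "0 < c" for x c
  proof
    assume "inverse c *\<^sub>R x \<in> L"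
    then have "c \<in> S x"
      using c by (simp add: S_def)
    then show "g x \<le> c"
      unfolding g_def by (rule cInf_lower[OF _ bdd])
  next
    assume gc: "g x \<le> c"
    \<comment> \<open>The infimum may equal \<open>c\<close> exactly, so \<open>lt\<close> is used
      at levels decreasing to \<open>c\<close>, and closedness of \<open>L\<close> on the ray
      handles the limit.\<close>
    define t where "t k = inverse (c + inverse (real (Suc k)))" for k
    have "t k *\<^sub>R x \<in> L" for k
      unfolding t_def
      using lt[OF x, of "c + inverse (real (Suc k))"] gc c U(2)
      by (metis add_pos_pos inverse_positive_iff_positive le_less_trans less_add_same_cancel1
          of_nat_0_less_iff subsetD zero_less_Suc)
    moreover have "t \<longlonglongrightarrow> inverse (c + 0)"
      unfolding t_def using c by (intro tendsto_intros LIMSEQ_inverse_real_of_nat) auto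
    moreover have "closed {t. t *\<^sub>R x \<in> L}"
      using closedray[OF x] by simp
    ultimately show "inverse c *\<^sub>R x \<in> L"
      using closed_sequentially[of "{t. t *\<^sub>R x \<in> L}" t "inverse (c + 0)"] by simp
  qed
  show ?thesis
  proof (rule that[of g])
    have eqI: "a = b" if "0 \<le> a" "0 \<le> b" "\<And>c. 0 < c \<Longrightarrow> a < c \<longleftrightarrow> b < c" for a b :: real
      using that(3)[of a] that(3)[of b] that(1,2) by (metis less_irrefl linorder_neqE order_le_less_trans)
    have g0: "g 0 = 0"
    proof (rule antisym)
      have 0: "0 \<in> E"
        using LE L(2) by blast
      then show "0 \<le> g 0"
        by (rule g_nonneg)
      show "g 0 \<le> 0"
        by (rule field_le_epsilon) (use le[OF 0] L(2) in simp)
    qed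
    have "g (t *\<^sub>R x) = t * g x" if x: "x \<in> E" and t: "0 \<le> t" for x t
    proof (cases "t = 0")
      case False
      show ?thesis
      proof (rule eqI)
        show "0 \<le> g (t *\<^sub>R x)" "0 \<le> t * g x"
          using g_nonneg E x t by auto
        fix c :: real assume c: "0 < c"
        have "g (t *\<^sub>R x) < c \<longleftrightarrow> (inverse c * t) *\<^sub>R x \<in> U"
          using lt[OF E[OF x] c] by simp
        also have "inverse c * t = inverse (c / t)"
          by (simp add: field_simps)
        also have "inverse (c / t) *\<^sub>R x \<in> U \<longleftrightarrow> g x < c / t"
          using lt[OF x, of "c / t"] c t False by simp
        also have "\<dots> \<longleftrightarrow> t * g x < c"
          using t False by (simp add: field_simps)
        finally show "g (t *\<^sub>R x) < c \<longleftrightarrow> t * g x < c" .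
      qed
    qed (simp add: g0)
    then show "homogeneous_on E g"
      using g_nonneg by (simp add: homogeneous_on_def)
    show "L = {x\<in>E. g x \<le> 1}"
      using le[of _ 1] LE by auto
    show "g x = 0 \<longleftrightarrow> (\<forall>t\<ge>0. t *\<^sub>R x \<in> L)" if x: "x \<in> E" for x
    proof
      assume "g x = 0"
      then have "t *\<^sub>R x \<in> L" if "0 < t" for t
        using le[OF x, of "inverse t"] that by simp
      then show "\<forall>t\<ge>0. t *\<^sub>R x \<in> L"
        using L(2) by (metis less_eq_real_def scaleR_zero_left)
    next
      assume *: "\<forall>t\<ge>0. t *\<^sub>R x \<in> L"
      have "g x \<le> c" if "0 < c" for c
        using le[OF x that] * that by simp
      then show "g x = 0"
        using g_nonneg[OF x] by (metis dense leD less_eq_real_def)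
    qed
    have scale_cont: "continuous_map (top_of_set E) (top_of_set E) (\<lambda>x. c *\<^sub>R x)" for c
    proof -
      have "continuous_on E (\<lambda>x. c *\<^sub>R x)"
        by (rule continuous_on_scaleR_fun[OF continuous_on_const continuous_on_id])
      then show ?thesis
        using E by (auto simp: continuous_map_in_subtopology)
    qed
    have lt_open: "openin (top_of_set E) {x\<in>E. g x < c}" for c
    proof (cases "0 < c")
      case True
      then have "{x\<in>E. g x < c} = {x \<in> topspace (top_of_set E). inverse c *\<^sub>R x \<in> U}"
        using lt by auto
      then show ?thesis
        using openin_continuous_map_preimage[OF scale_cont U(1)] by simp
    next
      case False
      then have "{x\<in>E. g x < c} = {}"
        using g_nonneg by force
      then show ?thesis
        by (simp only: openin_empty)
    qed
    have gt_open_pos: "openin (top_of_set E) {x\<in>E. c < g x}" if c: "0 < c" for c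
    proof -
      have "{x\<in>E. c < g x} = E - {x \<in> topspace (top_of_set E). inverse c *\<^sub>R x \<in> L}"
        using le[OF _ c] by (auto simp flip: not_le)
      also have "openin (top_of_set E) \<dots>"
        by (rule openin_diff[OF openin_subtopology_self closedin_continuous_map_preimage[OF scale_cont L(1)]])
      finally show ?thesis .
    qed
    have gt_open: "openin (top_of_set E) {x\<in>E. c < g x}" for c
    proof -
      consider "0 < c" | "c = 0" | "c < 0"
        by linarith
      then show ?thesis
      proof cases
        \<comment> \<open>Rescaling by \<open>inverse c\<close> needs a positive level, so the
          positive set is exhausted by the sets above positive levels.\<close>
        case 2
        have "{x\<in>E. c < g x} = (\<Union>e\<in>{0<..}. {x\<in>E. e < g x})"
          unfolding 2 using dense by fastforce
        then show ?thesis
          using gt_open_pos by (auto intro!: openin_Union)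
      next
        case 3
        then have "{x\<in>E. c < g x} = E"
          using g_nonneg by force
        then show ?thesis
          by (simp only: openin_subtopology_self)
      qed (rule gt_open_pos)
    qed
    have "continuous_map (top_of_set E) euclideanreal g"
      unfolding continuous_map_upper_lower_semicontinuous_lt using lt_open gt_open by simp
    then show "continuous_on E g"
      by simp
  qed
qed

text \<open>For \<open>y\<close> the image of \<open>x\<close>, homogeneity gives
  \<open>1 - N y = (1 - g x) / a x\<close> and \<open>g y = g x / a x\<close>, so
  \<open>b y = 1 / a x\<close>; this is why exchanging \<open>g\<close> and \<open>N\<close> inverts
  the map. Points with \<open>g x = 1\<close> land on the unit sphere of \<open>N\<close>, whereas a
  ray with \<open>g = 0\<close> is compressed to \<open>N / (1 + N)\<close> and never reaches
  it.\<close>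

lemma gauge_ball_homeomorphic:
  fixes E :: "('a \<Rightarrow> real) set"
  assumes E: "\<And>x c. x \<in> E \<Longrightarrow> c *\<^sub>R x \<in> E"
    and g: "homogeneous_on E g" "continuous_on E g"
    and N: "homogeneous_on E N" "continuous_on E N" "\<And>x. x \<in> E \<Longrightarrow> N x = 0 \<Longrightarrow> x = 0"
  shows "top_of_set {x\<in>E. g x \<le> 1} homeomorphic_space
    top_of_set {x\<in>E. N x \<le> 1 \<and> \<not> (N x = 1 \<and> g x = 0)}"
proof -
  have hom: "0 \<le> g x" "0 \<le> N x" "0 \<le> t \<Longrightarrow> g (t *\<^sub>R x) = t * g x" "0 \<le> t \<Longrightarrow> N (t *\<^sub>R x) = t * N x"
    if "x \<in> E" for x t
    using g(1) N(1) that by (auto simp: homogeneous_on_def)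
  define a where "a x = 1 - g x + N x" for x
  define b where "b x = 1 - N x + g x" for x
  \<comment> \<open>The sum of the nonnegative numbers \<open>1 - g x\<close> and \<open>N x\<close>
    vanishes only if \<open>g x = 1\<close> and \<open>N x = 0\<close>, but definiteness of
    \<open>N\<close> then gives \<open>x = 0\<close> and \<open>g x = 0\<close>. Dually,
    \<open>b\<close> vanishes on the ball exactly at the removed points.\<close>
  have a: "0 < a x" if "x \<in> E" "g x \<le> 1" for x
  proof -
    have "g 0 = 0"
      using hom(3)[OF that(1), of 0] by simp
    then have "N x = 0 \<Longrightarrow> g x \<noteq> 1"
      using N(3)[OF that(1)] by auto
    then show ?thesis
      using that hom[OF that(1)] unfolding a_def by (cases "N x = 0") auto
  qed
  have b: "0 < b x" if "x \<in> E" "N x \<le> 1" "\<not> (N x = 1 \<and> g x = 0)" for x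
    using that hom[OF that(1)] unfolding b_def by (cases "g x = 0") auto
  have cancel: "A * (1 - inverse A * r + inverse A * t) = A - r + t" if "0 < A" for A r t :: real
    using that by (simp add: field_simps)
  have ab: "a x * b (inverse (a x) *\<^sub>R x) = 1" if "x \<in> E" "g x \<le> 1" for x
    using a[OF that] cancel[OF a[OF that], of "N x" "g x"] hom[OF that(1)]
    by (simp add: b_def) (simp add: a_def)
  have ba: "b x * a (inverse (b x) *\<^sub>R x) = 1" if "x \<in> E" "N x \<le> 1" "\<not> (N x = 1 \<and> g x = 0)" for x
    using b[OF that] cancel[OF b[OF that], of "g x" "N x"] hom[OF that(1)]
    by (simp add: a_def) (simp add: b_def)
  have "homeomorphic_maps (top_of_set {x\<in>E. g x \<le> 1})
      (top_of_set {x\<in>E. N x \<le> 1 \<and> \<not> (N x = 1 \<and> g x = 0)})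
      (\<lambda>x. inverse (a x) *\<^sub>R x) (\<lambda>x. inverse (b x) *\<^sub>R x)"
    unfolding homeomorphic_maps_def
  proof (intro conjI ballI)
    have sub: "continuous_on {x\<in>E. P x} g" "continuous_on {x\<in>E. P x} N" for P
      by (rule continuous_on_subset[OF g(2)], blast) (rule continuous_on_subset[OF N(2)], blast)
    have "inverse (a x) *\<^sub>R x \<in> {x\<in>E. N x \<le> 1 \<and> \<not> (N x = 1 \<and> g x = 0)}" if "x \<in> E" "g x \<le> 1" for x
    proof -
      have "N x \<le> a x" "N x = a x \<Longrightarrow> g x \<noteq> 0"
        using that by (auto simp: a_def)
      then have "inverse (a x) * N x \<le> 1" "\<not> (inverse (a x) * N x = 1 \<and> inverse (a x) * g x = 0)"
        using a[OF that] by (auto simp: field_simps)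
      then show ?thesis
        using E[OF that(1)] a[OF that] hom[OF that(1)] by simp
    qed
    moreover have "continuous_on {x\<in>E. g x \<le> 1} (\<lambda>x. inverse (a x) *\<^sub>R x)"
    proof (rule continuous_on_scaleR_fun[OF _ continuous_on_id])
      have "continuous_on {x\<in>E. g x \<le> 1} a"
        unfolding a_def by (intro continuous_on_add continuous_on_diff continuous_on_const sub)
      then show "continuous_on {x\<in>E. g x \<le> 1} (\<lambda>x. inverse (a x))"
        using a by (intro continuous_on_inverse) force+
    qed
    ultimately show "continuous_map (top_of_set {x\<in>E. g x \<le> 1})
      (top_of_set {x\<in>E. N x \<le> 1 \<and> \<not> (N x = 1 \<and> g x = 0)}) (\<lambda>x. inverse (a x) *\<^sub>R x)"
      unfolding continuous_map_in_subtopology by auto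
    have "inverse (b x) *\<^sub>R x \<in> {x\<in>E. g x \<le> 1}" if "x \<in> E" "N x \<le> 1" "\<not> (N x = 1 \<and> g x = 0)" for x
    proof -
      have "inverse (b x) * g x \<le> 1"
        using b[OF that] that(2) by (simp add: field_simps b_def)
      then show ?thesis
        using E[OF that(1)] b[OF that] hom[OF that(1)] by simp
    qed
    moreover have "continuous_on {x\<in>E. N x \<le> 1 \<and> \<not> (N x = 1 \<and> g x = 0)} (\<lambda>x. inverse (b x) *\<^sub>R x)"
    proof (rule continuous_on_scaleR_fun[OF _ continuous_on_id])
      have "continuous_on {x\<in>E. N x \<le> 1 \<and> \<not> (N x = 1 \<and> g x = 0)} b"
        unfolding b_def by (intro continuous_on_add continuous_on_diff continuous_on_const sub)
      then show "continuous_on {x\<in>E. N x \<le> 1 \<and> \<not> (N x = 1 \<and> g x = 0)} (\<lambda>x. inverse (b x))"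
        using b by (intro continuous_on_inverse) force+
    qed
    ultimately show "continuous_map (top_of_set {x\<in>E. N x \<le> 1 \<and> \<not> (N x = 1 \<and> g x = 0)})
      (top_of_set {x\<in>E. g x \<le> 1}) (\<lambda>x. inverse (b x) *\<^sub>R x)"
      unfolding continuous_map_in_subtopology by auto
  next
    fix x assume "x \<in> topspace (top_of_set {x\<in>E. g x \<le> 1})"
    then have x: "x \<in> E" "g x \<le> 1"
      by auto
    have "inverse (b (inverse (a x) *\<^sub>R x)) * inverse (a x) = 1"
      using ab[OF x] by (metis inverse_1 inverse_mult_distrib mult.commute)
    then show "inverse (b (inverse (a x) *\<^sub>R x)) *\<^sub>R (inverse (a x) *\<^sub>R x) = x"
      by simp
  next
    fix x assume "x \<in> topspace (top_of_set {x\<in>E. N x \<le> 1 \<and> \<not> (N x = 1 \<and> g x = 0)})"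
    then have x: "x \<in> E" "N x \<le> 1" "\<not> (N x = 1 \<and> g x = 0)"
      by auto
    have "inverse (a (inverse (b x) *\<^sub>R x)) * inverse (b x) = 1"
      using ba[OF x] by (metis inverse_1 inverse_mult_distrib mult.commute)
    then show "inverse (a (inverse (b x) *\<^sub>R x)) *\<^sub>R (inverse (b x) *\<^sub>R x) = x"
      by simp
  qed
  then show ?thesis
    unfolding homeomorphic_space_def by blast
qed

subsection \<open>The closed ball without a closed set of boundary points\<close>

definition sq_norm :: "nat \<Rightarrow> (nat \<Rightarrow> real) \<Rightarrow> real" where
  "sq_norm m x = (\<Sum>i<m. (x i)\<^sup>2)"

lemma sq_norm_nonneg: "0 \<le> sq_norm m x"
  by (simp add: sq_norm_def sum_nonneg)

lemma sq_norm_scaleR: "sq_norm m (t *\<^sub>R x) = t\<^sup>2 * sq_norm m x"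
  by (simp add: sq_norm_def sum_distrib_left power_mult_distrib)

lemma continuous_on_coordinate: "continuous_on S (\<lambda>x. x i :: real)"
  by (rule continuous_on_subset[OF continuous_on_product_coordinates subset_UNIV])

lemma continuous_on_sq_norm: "continuous_on S (sq_norm m)"
  unfolding sq_norm_def[abs_def]
  by (intro continuous_on_sum continuous_on_power continuous_on_coordinate)

lemma homogeneous_on_norm: "homogeneous_on S (\<lambda>x. sqrt (sq_norm m x))"
  by (simp add: homogeneous_on_def sq_norm_scaleR sq_norm_nonneg real_sqrt_mult)

lemma sq_norm_eq_0: "x \<in> coord_space m \<Longrightarrow> sq_norm m x = 0 \<Longrightarrow> x = 0"
proof
  fix i
  assume x: "x \<in> coord_space m" "sq_norm m x = 0"
  have "\<forall>i\<in>{..<m}. (x i)\<^sup>2 = 0"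
    using x(2) unfolding sq_norm_def by (subst (asm) sum_nonneg_eq_0_iff) auto
  then show "x i = 0 i"
    using x(1) by (cases "i < m") (auto simp: coord_space_def)
qed

definition unit_ball :: "nat \<Rightarrow> (nat \<Rightarrow> real) set" where
  "unit_ball m = {x \<in> coord_space m. sq_norm m x \<le> 1}"

lemma closed_ball_eq: "closed_ball m = top_of_set (unit_ball m)"
  by (simp add: closed_ball_def Euclidean_space_eq subtopology_subtopology unit_ball_def sq_norm_def
      Int_def)

lemma half_space_eq: "half_space m = top_of_set {x \<in> coord_space m. 0 \<le> x 0}"
  by (simp add: half_space_def Euclidean_space_eq subtopology_subtopology Int_def)

lemma second_countable_top_of_set:
  "second_countable (top_of_set (S :: 'a::second_countable_topology set))"
proof (rule second_countable_subtopology)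
  obtain B :: "'a set set" where "countable B" "topological_basis B"
    using ex_countable_basis by blast
  then show "second_countable (euclidean :: 'a topology)"
    unfolding second_countable_def
  proof (intro exI[of _ B] conjI ballI allI impI)
    show "openin euclidean V" if "V \<in> B" for V
      using topological_basis_open[OF \<open>topological_basis B\<close> that] by simp
    fix U and x :: 'a
    assume "openin euclidean U \<and> x \<in> U"
    then have "open U" "x \<in> U"
      by simp_all
    then show "\<exists>V\<in>B. x \<in> V \<and> V \<subseteq> U"
      using topological_basisE[OF \<open>topological_basis B\<close>] by metis
  qed
qed

text \<open>Points live in an infinite product, so compactness comes from Tychonoff: the ball is
  closed in a product of intervals that are trivial from coordinate \<open>m\<close> on.\<close>

lemma compact_space_closed_ball: "compact_space (closed_ball m)"
proof -
  define P where "P = PiE UNIV (\<lambda>i. if i < m then {-1..1} else {0::real})"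
  have "compactin euclidean P"
    unfolding euclidean_product_topology[symmetric] P_def compactin_PiE by simp
  moreover have "closed (unit_ball m)"
  proof -
    have "closed {x. sq_norm m x \<le> 1}"
      using closed_Collect_le[OF continuous_on_sq_norm continuous_on_const] by simp
    moreover have "closed (coord_space m)"
      using closedin_Euclidean_imp_closed[of m "coord_space m"]
      by (metis closedin_topspace topspace_Euclidean_space coord_space_def)
    moreover have "unit_ball m = coord_space m \<inter> {x. sq_norm m x \<le> 1}"
      by (auto simp: unit_ball_def)
    ultimately show ?thesis
      by (simp add: closed_Int)
  qed
  moreover have "unit_ball m \<subseteq> P"
  proof
    fix x assume x: "x \<in> unit_ball m"
    have "x i \<in> (if i < m then {-1..1} else {0})" for i
    proof (cases "i < m")
      case True
      have "(x i)\<^sup>2 \<le> sq_norm m x"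
        unfolding sq_norm_def using True by (intro member_le_sum) auto
      then have "\<bar>x i\<bar> \<le> 1"
        using x abs_square_le_1[of "x i"] by (simp add: unit_ball_def)
      then show ?thesis
        using True by auto
    qed (use x in \<open>simp add: unit_ball_def coord_space_def\<close>)
    then show "x \<in> P"
      unfolding P_def by (intro PiE_I) auto
  qed
  ultimately have "compactin euclidean (unit_ball m)"
    using closed_compactin[of euclidean P "unit_ball m"] by simp
  then show ?thesis
    by (simp add: closed_ball_eq compactin_subspace)
qed

text \<open>With \<open>a = z 0 + 1\<close> and \<open>w - a\<^sup>2 = rest z\<close> the left side
  is the squared norm of \<open>cayley_inv z\<close>; the right side is
  \<open>1 - 4 * z 0 / w\<close>, so the half-space condition is exactly the ball condition.\<close>

lemma inversion_identity:
  "w \<noteq> 0 \<Longrightarrow> (1 - 2 * a / w)\<^sup>2 + (2 / w)\<^sup>2 * (w - a\<^sup>2) = 1 - 4 * (a - 1) / w" for a w :: real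
  by (simp add: field_simps power2_eq_square)

text \<open>For \<open>q = a\<^sup>2 + r\<close> the right side is \<open>4 / q\<close>: the
  denominators of \<open>cayley\<close> and \<open>cayley_inv\<close> at corresponding points have
  product 4.\<close>

lemma scaled_squares: "(2 * a / q)\<^sup>2 + (2 / q)\<^sup>2 * r = 4 * (a\<^sup>2 + r) / q\<^sup>2" for a q r :: real
  by (simp add: power_divide power_mult_distrib add_divide_distrib distrib_left)

text \<open>
  The Cayley transform: inversion at the boundary point \<open>\<epsilon> e\<^sub>0\<close> maps the rest of the ball
  to a half-space.
\<close>

context
  fixes m :: nat and \<epsilon> :: real
  assumes m: "0 < m" and \<epsilon>: "\<epsilon>\<^sup>2 = 1"
begin

definition rest :: "(nat \<Rightarrow> real) \<Rightarrow> real" where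
  "rest x = (\<Sum>i=1..<m. (x i)\<^sup>2)"

definition pole :: "nat \<Rightarrow> real" where
  "pole = (\<lambda>i. if i = 0 then \<epsilon> else 0)"

text \<open>On \<open>coord_space m\<close> the denominator is the squared distance to
  \<open>pole\<close>, since \<open>\<epsilon>\<^sup>2 = 1\<close>. The numerator at 0 is one minus
  the squared norm, so the sphere without the pole goes to the boundary hyperplane.\<close>

definition cayley :: "(nat \<Rightarrow> real) \<Rightarrow> nat \<Rightarrow> real" where
  "cayley x = (\<lambda>i. (if i = 0 then 1 - (x 0)\<^sup>2 - rest x else 2 * x i) / ((1 - \<epsilon> * x 0)\<^sup>2 + rest x))"

definition cayley_inv :: "(nat \<Rightarrow> real) \<Rightarrow> nat \<Rightarrow> real" where
  "cayley_inv z = (\<lambda>i. if i = 0 then \<epsilon> * (1 - 2 * (z 0 + 1) / ((z 0 + 1)\<^sup>2 + rest z))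
     else 2 * z i / ((z 0 + 1)\<^sup>2 + rest z))"

lemma sq_norm_eq_rest: "sq_norm m x = (x 0)\<^sup>2 + rest x"
  unfolding sq_norm_def rest_def lessThan_atLeast0 using m by (simp add: sum.atLeast_Suc_lessThan)

lemma rest_nonneg: "0 \<le> rest x"
  by (simp add: rest_def sum_nonneg)

lemma rest_scale: "(\<And>i. i \<noteq> 0 \<Longrightarrow> y i = c * x i) \<Longrightarrow> rest y = c\<^sup>2 * rest x"
  unfolding rest_def sum_distrib_left by (intro sum.cong) (auto simp: power_mult_distrib)

lemma continuous_on_rest: "continuous_on S rest"
  unfolding rest_def[abs_def]
  by (intro continuous_on_sum continuous_on_power continuous_on_coordinate)

lemma sign_mult: "\<epsilon> * (\<epsilon> * t) = t"
  using \<epsilon> by (simp add: power2_eq_square mult.assoc[symmetric])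

lemma dist_pole_pos:
  assumes "x \<in> unit_ball m" "x \<noteq> pole"
  shows "0 < (1 - \<epsilon> * x 0)\<^sup>2 + rest x"
proof (rule ccontr)
  assume "\<not> ?thesis"
  moreover have "0 \<le> (1 - \<epsilon> * x 0)\<^sup>2"
    by simp
  ultimately have *: "(1 - \<epsilon> * x 0)\<^sup>2 = 0" "rest x = 0"
    using rest_nonneg[of x] by linarith+
  have "\<epsilon> * x 0 = 1"
    using *(1) by simp
  then have "x 0 = \<epsilon>"
    using sign_mult[of "x 0"] by (metis mult_1_right)
  moreover have "x i = 0" if "i \<noteq> 0" for i
  proof (cases "i < m")
    case True
    then show ?thesis
      using *(2) that by (simp add: rest_def sum_nonneg_eq_0_iff)
  next
    case False
    then show ?thesis
      using assms(1) by (simp add: unit_ball_def coord_space_def)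
  qed
  ultimately have "x = pole"
    by (auto simp: pole_def)
  then show False
    using assms(2) by simp
qed

lemma cayley_homeomorphic_maps:
  "homeomorphic_maps (top_of_set (unit_ball m - {pole})) (half_space m) cayley cayley_inv"
  unfolding homeomorphic_maps_def half_space_eq
proof (intro conjI ballI)
  let ?H = "{x \<in> coord_space m. 0 \<le> x 0}"
  have w_pos: "0 < (z 0 + 1)\<^sup>2 + rest z" if "0 \<le> z 0" for z
    using that rest_nonneg[of z] by (smt (verit) zero_less_power)
  have Q: "(1 - \<epsilon> * x)\<^sup>2 = 1 - 2 * \<epsilon> * x + x\<^sup>2" for x
    using \<epsilon> by (simp add: power2_diff power_mult_distrib)
  have "continuous_on (unit_ball m - {pole}) cayley"
    unfolding cayley_def[abs_def]
  proof (rule continuous_on_coordinatewise_then_product)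
    fix i
    have "(1 - \<epsilon> * x 0)\<^sup>2 + rest x \<noteq> 0" if "x \<in> unit_ball m - {pole}" for x
      using dist_pole_pos[of x] that by auto
    then show "continuous_on (unit_ball m - {pole})
        (\<lambda>x. (if i = 0 then 1 - (x 0)\<^sup>2 - rest x else 2 * x i) / ((1 - \<epsilon> * x 0)\<^sup>2 + rest x))"
      by (cases "i = 0")
        (simp_all, (intro continuous_on_divide continuous_on_add continuous_on_diff continuous_on_power
          continuous_on_mult continuous_on_const continuous_on_coordinate continuous_on_rest; simp)+)
  qed
  moreover have "cayley x \<in> ?H" if "x \<in> unit_ball m - {pole}" for x
    using that dist_pole_pos[of x] m sq_norm_eq_rest[of x]
    by (auto simp: cayley_def unit_ball_def coord_space_def)
  ultimately show "continuous_map (top_of_set (unit_ball m - {pole})) (top_of_set ?H) cayley"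
    unfolding continuous_map_in_subtopology by auto
  have "continuous_on ?H cayley_inv"
    unfolding cayley_inv_def[abs_def]
  proof (rule continuous_on_coordinatewise_then_product)
    fix i
    have "(z 0 + 1)\<^sup>2 + rest z \<noteq> 0" if "z \<in> ?H" for z
      using w_pos[of z] that by auto
    then show "continuous_on ?H
        (\<lambda>z. if i = 0 then \<epsilon> * (1 - 2 * (z 0 + 1) / ((z 0 + 1)\<^sup>2 + rest z))
          else 2 * z i / ((z 0 + 1)\<^sup>2 + rest z))"
      by (cases "i = 0")
        (simp_all, (intro continuous_on_divide continuous_on_add continuous_on_diff continuous_on_power
          continuous_on_mult continuous_on_const continuous_on_coordinate continuous_on_rest; simp)+)
  qed
  moreover have inv_val: "rest (cayley_inv z) = (2 / ((z 0 + 1)\<^sup>2 + rest z))\<^sup>2 * rest z" for z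
    by (rule rest_scale) (simp add: cayley_inv_def)
  moreover have "cayley_inv z \<in> unit_ball m - {pole}" if "z \<in> ?H" for z
  proof -
    define w where "w = (z 0 + 1)\<^sup>2 + rest z"
    have w: "0 < w"
      using w_pos that by (simp add: w_def)
    have "cayley_inv z 0 \<noteq> \<epsilon>"
      using \<epsilon> w that by (auto simp: cayley_inv_def w_def[symmetric])
    then have "cayley_inv z \<noteq> pole"
      by (auto simp: pole_def)
    moreover have "sq_norm m (cayley_inv z) = 1 - 4 * z 0 / w"
    proof -
      have "sq_norm m (cayley_inv z) = (1 - 2 * (z 0 + 1) / w)\<^sup>2 + (2 / w)\<^sup>2 * (w - (z 0 + 1)\<^sup>2)"
        using \<epsilon> unfolding sq_norm_eq_rest inv_val
        by (simp add: cayley_inv_def w_def power_mult_distrib)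
      also have "\<dots> = 1 - 4 * (z 0 + 1 - 1) / w"
        using w by (intro inversion_identity) simp
      finally show ?thesis
        by simp
    qed
    ultimately show ?thesis
      using w that m by (auto simp: unit_ball_def coord_space_def cayley_inv_def)
  qed
  ultimately show "continuous_map (top_of_set ?H) (top_of_set (unit_ball m - {pole})) cayley_inv"
    unfolding continuous_map_in_subtopology by auto
  show "cayley_inv (cayley x) = x" if x': "x \<in> topspace (top_of_set (unit_ball m - {pole}))" for x
  proof -
    define Q where "Q = (1 - \<epsilon> * x 0)\<^sup>2 + rest x"
    have x: "x \<in> unit_ball m" "x \<noteq> pole" and Qpos: "0 < Q"
      using x' dist_pole_pos[of x] by (auto simp: Q_def)
    \<comment> \<open>By expansion, the numerator at 0 plus \<open>Q\<close> is
      \<open>2 - 2 * \<epsilon> * x 0\<close>.\<close>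
    have 0: "cayley x 0 + 1 = 2 * (1 - \<epsilon> * x 0) / Q"
    proof -
      have "cayley x 0 + 1 = (1 - (x 0)\<^sup>2 - rest x + Q) / Q"
        using Qpos by (simp add: cayley_def Q_def[symmetric] add_divide_distrib)
      then show ?thesis
        by (simp add: Q_def Q)
    qed
    have "rest (cayley x) = (2 / Q)\<^sup>2 * rest x"
      by (rule rest_scale) (simp add: cayley_def Q_def)
    then have "(cayley x 0 + 1)\<^sup>2 + rest (cayley x) = 4 * Q / Q\<^sup>2"
      unfolding 0 by (simp only: scaled_squares Q_def)
    then have w: "(cayley x 0 + 1)\<^sup>2 + rest (cayley x) = 4 / Q"
      using Qpos by (simp add: power2_eq_square)
    show ?thesis
    proof
      fix i
      show "cayley_inv (cayley x) i = x i"
      proof (cases "i = 0")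
        case True
        have "cayley_inv (cayley x) 0 = \<epsilon> * (1 - 2 * (cayley x 0 + 1) / (4 / Q))"
          by (simp add: cayley_inv_def w)
        also have "2 * (cayley x 0 + 1) / (4 / Q) = 1 - \<epsilon> * x 0"
          unfolding 0 using Qpos by (simp add: field_simps)
        finally show ?thesis
          using True by (simp add: sign_mult)
      next
        case False
        then have "cayley_inv (cayley x) i = 2 * (2 * x i / Q) / (4 / Q)"
          unfolding cayley_inv_def w by (simp add: cayley_def Q_def)
        then show ?thesis
          using Qpos by simp
      qed
    qed
  qed
  show "cayley (cayley_inv z) = z" if "z \<in> topspace (top_of_set ?H)" for z
  proof -
    define w where "w = (z 0 + 1)\<^sup>2 + rest z"
    have w: "0 < w"
      using w_pos that by (simp add: w_def)
    define y where "y = cayley_inv z"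
    have y0: "y 0 = \<epsilon> * (1 - 2 * (z 0 + 1) / w)" and yi: "\<And>i. i \<noteq> 0 \<Longrightarrow> y i = 2 * z i / w"
      by (simp_all add: y_def cayley_inv_def w_def)
    have r: "rest y = (2 / w)\<^sup>2 * rest z"
      unfolding y_def inv_val w_def ..
    have "1 - \<epsilon> * y 0 = 2 * (z 0 + 1) / w"
      unfolding y0 sign_mult by simp
    then have "(1 - \<epsilon> * y 0)\<^sup>2 + rest y = 4 * w / w\<^sup>2"
      unfolding r by (simp only: scaled_squares w_def)
    then have Q: "(1 - \<epsilon> * y 0)\<^sup>2 + rest y = 4 / w"
      using w by (simp add: power2_eq_square)
    have "(y 0)\<^sup>2 + rest y = (1 - 2 * (z 0 + 1) / w)\<^sup>2 + (2 / w)\<^sup>2 * (w - (z 0 + 1)\<^sup>2)"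
      unfolding r y0 using \<epsilon> by (simp add: power_mult_distrib w_def)
    also have "\<dots> = 1 - 4 * (z 0 + 1 - 1) / w"
      using w by (intro inversion_identity) simp
    finally have "1 - (y 0)\<^sup>2 - rest y = 4 * z 0 / w"
      by simp
    then show ?thesis
      unfolding y_def[symmetric] cayley_def Q using w yi by (auto simp: fun_eq_iff)
  qed
qed

end

section \<open>Manifold structure and compactification of the cut ball\<close>

lemma homeomorphic_manifold_with_boundary:
  assumes "X homeomorphic_space Y" "manifold_with_boundary m Y"
  shows "manifold_with_boundary m X"
  unfolding manifold_with_boundary_def
proof (intro conjI ballI)
  obtain f where f: "homeomorphic_map X Y f"
    using assms(1) homeomorphic_space by blast
  show "Hausdorff_space X"
    using assms homeomorphic_Hausdorff_space manifold_with_boundary_def by blast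
  show "second_countable X"
    using assms homeomorphic_space_second_countability manifold_with_boundary_def by blast
  fix x assume x: "x \<in> topspace X"
  then have "f x \<in> topspace Y"
    using homeomorphic_imp_surjective_map[OF f] by blast
  then obtain U H where UH: "openin Y U" "f x \<in> U" "openin (half_space m) H"
      "subtopology Y U homeomorphic_space subtopology (half_space m) H"
    using assms(2) unfolding manifold_with_boundary_def by blast
  let ?V = "{x \<in> topspace X. f x \<in> U}"
  have "openin X ?V"
    by (rule openin_continuous_map_preimage[OF homeomorphic_imp_continuous_map[OF f] UH(1)])
  moreover have "homeomorphic_map (subtopology X ?V) (subtopology Y U) f"
    by (rule homeomorphic_map_subtopologies_alt[OF f]) simp
  then have "subtopology X ?V homeomorphic_space subtopology (half_space m) H"
    using UH(4) homeomorphic_map_imp_homeomorphic_space homeomorphic_space_trans by blast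
  ultimately show "\<exists>U H. openin X U \<and> x \<in> U \<and> openin (half_space m) H \<and>
      subtopology X U homeomorphic_space subtopology (half_space m) H"
    using UH(2,3) x by blast
qed

lemma homeomorphic_compactifies_to:
  assumes "X homeomorphic_space Y" "compactifies_to Y K"
  shows "compactifies_to X K"
proof -
  obtain f where f: "homeomorphic_map X Y f"
    using assms(1) homeomorphic_space by blast
  obtain h where h: "embedding_map Y K h" "K closure_of (h ` topspace Y) = topspace K"
    using assms(2) unfolding compactifies_to_def by blast
  have "embedding_map X Y f"
    using f homeomorphic_imp_surjective_map[OF f] by (simp add: embedding_map_def)
  then have "embedding_map X K (h \<circ> f)"
    using h(1) by (rule embedding_map_compose)
  moreover have "(h \<circ> f) ` topspace X = h ` topspace Y"
    using homeomorphic_imp_surjective_map[OF f] by (simp only: image_comp[symmetric])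
  ultimately show ?thesis
    using assms(2) h(2) unfolding compactifies_to_def by metis
qed

text \<open>The target of \<open>gauge_ball_homeomorphic\<close> for the Euclidean norm; the square
  roots are kept so that it is literally an instance.\<close>

definition cut_ball :: "nat \<Rightarrow> ((nat \<Rightarrow> real) \<Rightarrow> real) \<Rightarrow> (nat \<Rightarrow> real) set" where
  "cut_ball m g = {x \<in> coord_space m. sqrt (sq_norm m x) \<le> 1 \<and> \<not> (sqrt (sq_norm m x) = 1 \<and> g x = 0)}"

lemma cut_ball_subset: "cut_ball m g \<subseteq> unit_ball m"
  by (auto simp: cut_ball_def unit_ball_def)

lemma interior_in_cut_ball: "x \<in> coord_space m \<Longrightarrow> sq_norm m x < 1 \<Longrightarrow> x \<in> cut_ball m g"
  by (auto simp: cut_ball_def)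

text \<open>On the ball both \<open>1 - sq_norm m x\<close> and \<open>g x\<close> are nonnegative,
  so the removed points form the zero set of their continuous sum.\<close>

lemma openin_cut_ball:
  assumes "homogeneous_on (coord_space m) g" "continuous_on (coord_space m) g"
  shows "openin (top_of_set (unit_ball m)) (cut_ball m g)"
proof -
  have sub: "unit_ball m \<subseteq> coord_space m"
    by (auto simp: unit_ball_def)
  have "continuous_on (unit_ball m) (\<lambda>x. 1 - sq_norm m x + g x)"
    by (intro continuous_on_add continuous_on_diff continuous_on_const continuous_on_sq_norm
        continuous_on_subset[OF assms(2) sub])
  then have "openin (top_of_set (unit_ball m)) (unit_ball m \<inter> (\<lambda>x. 1 - sq_norm m x + g x) -` {0<..})"
    by (rule continuous_openin_preimage_gen) simp
  also have "unit_ball m \<inter> (\<lambda>x. 1 - sq_norm m x + g x) -` {0<..} = cut_ball m g"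
  proof -
    have "0 < 1 - sq_norm m x + g x \<longleftrightarrow> \<not> (sq_norm m x = 1 \<and> g x = 0)"
      if "x \<in> coord_space m" "sq_norm m x \<le> 1" for x
    proof -
      have "0 \<le> g x"
        using assms(1) that by (simp add: homogeneous_on_def)
      then show ?thesis
        using that(2) by linarith
    qed
    then show ?thesis
      by (auto simp: unit_ball_def cut_ball_def)
  qed
  finally show ?thesis .
qed

text \<open>The inclusion is the embedding. It is dense because every \<open>t *\<^sub>R x\<close>
  with \<open>0 < t < 1\<close> lies in the open ball, which is kept entirely.\<close>

lemma cut_ball_compactifies:
  assumes "homogeneous_on (coord_space m) g" "continuous_on (coord_space m) g"
  shows "compactifies_to (top_of_set (cut_ball m g)) (closed_ball m)"
proof -
  have "embedding_map (top_of_set (cut_ball m g)) (closed_ball m) id"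
    using cut_ball_subset[of m g]
    by (simp add: embedding_map_def closed_ball_eq subtopology_subtopology Int_absorb1)
  moreover have "closed_ball m closure_of cut_ball m g = unit_ball m"
  proof
    show "closed_ball m closure_of cut_ball m g \<subseteq> unit_ball m"
      using closure_of_subset_topspace[of "closed_ball m"] by (simp add: closed_ball_eq)
    show "unit_ball m \<subseteq> closed_ball m closure_of cut_ball m g"
    proof
      fix x assume x: "x \<in> unit_ball m"
      have "\<exists>y\<in>cut_ball m g. y \<in> T" if xT: "x \<in> T" and T: "openin (top_of_set (unit_ball m)) T" for T
      proof -
        obtain T' where T': "open T'" "T = unit_ball m \<inter> T'"
          using T by (auto simp: openin_open)
        have "continuous_on UNIV (\<lambda>t. t *\<^sub>R x)"
          by (intro continuous_on_scaleR_fun continuous_on_id continuous_on_const)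
        then have "open ((\<lambda>t. t *\<^sub>R x) -` T')"
          using T'(1) by (simp add: open_vimage)
        moreover have "1 \<in> (\<lambda>t. t *\<^sub>R x) -` T'"
          using xT T'(2) by simp
        ultimately obtain e where e: "0 < e" "ball 1 e \<subseteq> (\<lambda>t. t *\<^sub>R x) -` T'"
          using openE by blast
        define t where "t = 1 - min (e / 2) (1 / 2)"
        have t: "0 < t" "t < 1" "t \<in> ball 1 e"
          using e(1) by (auto simp: t_def dist_real_def min_def)
        have "t\<^sup>2 < 1"
          using t by (simp add: power_less_one_iff)
        moreover have "t\<^sup>2 * sq_norm m x \<le> t\<^sup>2 * 1"
          using x by (intro mult_left_mono) (auto simp: unit_ball_def)
        ultimately have "sq_norm m (t *\<^sub>R x) < 1"
          by (simp add: sq_norm_scaleR)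
        moreover have "t *\<^sub>R x \<in> coord_space m"
          using x by (auto simp: unit_ball_def intro: scaleR_in_coord_space)
        ultimately have "t *\<^sub>R x \<in> cut_ball m g"
          by (intro interior_in_cut_ball)
        moreover have "t *\<^sub>R x \<in> T'"
          using e(2) t(3) by blast
        ultimately show ?thesis
          using T'(2) cut_ball_subset by blast
      qed
      then show "x \<in> closed_ball m closure_of cut_ball m g"
        using x by (auto simp: closed_ball_eq in_closure_of)
    qed
  qed
  moreover have "Hausdorff_space (closed_ball m)"
    unfolding closed_ball_eq by (intro Hausdorff_space_subtopology Hausdorff_space_euclidean)
  ultimately show ?thesis
    unfolding compactifies_to_def using compact_space_closed_ball
    by (intro conjI exI[of _ id]) (simp_all add: closed_ball_eq)
qed

lemma cut_ball_manifold:
  assumes "homogeneous_on (coord_space m) g" "continuous_on (coord_space m) g"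
  shows "manifold_with_boundary m (top_of_set (cut_ball m g))"
  unfolding manifold_with_boundary_def
proof (intro conjI ballI)
  let ?X = "cut_ball m g"
  show "Hausdorff_space (top_of_set ?X)"
    by (intro Hausdorff_space_subtopology Hausdorff_space_euclidean)
  show "second_countable (top_of_set ?X)"
    by (rule second_countable_top_of_set)
  fix x assume "x \<in> topspace (top_of_set ?X)"
  then have x: "x \<in> ?X"
    by simp
  show "\<exists>U H. openin (top_of_set ?X) U \<and> x \<in> U \<and> openin (half_space m) H \<and>
      subtopology (top_of_set ?X) U homeomorphic_space subtopology (half_space m) H"
  proof (cases "m = 0")
    \<comment> \<open>The Cayley transform needs a coordinate 0; for \<open>m = 0\<close> the cut
      ball and the half-space are the same single point.\<close>
    case True
    have E: "coord_space m = {0}"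
      using True by (auto simp: coord_space_def)
    have "{z \<in> coord_space m. 0 \<le> z 0} = {0}"
      unfolding E by auto
    moreover have "?X = {0}"
      using x E by (auto simp only: cut_ball_def)
    ultimately have "top_of_set ?X = half_space m"
      by (simp only: half_space_eq)
    moreover from this have "x \<in> topspace (half_space m)"
      using x by (metis topspace_euclidean_subtopology)
    ultimately show ?thesis
      using homeomorphic_space_refl[of "half_space m"]
      by (intro exI[of _ "topspace (half_space m)"]) (simp only: openin_topspace subtopology_topspace simp_thms)
  next
    case False
    \<comment> \<open>Two opposite poles are available; the one different from \<open>x\<close> is
      removed, so the charts at the two poles cover the cut ball.\<close>
    define \<epsilon> :: real where "\<epsilon> = (if x = pole 1 then -1 else 1)"
    have "pole 1 0 \<noteq> pole (-1) 0"
      using False pole_def[of m 1] pole_def[of m "-1"] by simp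
    then have "pole 1 \<noteq> pole (-1)"
      by metis
    then have \<epsilon>: "\<epsilon>\<^sup>2 = 1" "x \<noteq> pole \<epsilon>"
      by (auto simp: \<epsilon>_def)
    have hom: "homeomorphic_map (top_of_set (unit_ball m - {pole \<epsilon>})) (half_space m) (cayley m \<epsilon>)"
      using cayley_homeomorphic_maps[of m \<epsilon>] False \<epsilon>(1) homeomorphic_maps_map by blast
    obtain T where T: "open T" "?X = unit_ball m \<inter> T"
      using openin_cut_ball[OF assms] by (auto simp: openin_open)
    let ?U = "?X - {pole \<epsilon>}"
    have U: "?U = (unit_ball m - {pole \<epsilon>}) \<inter> T"
      using T(2) by blast
    have open_U: "openin (top_of_set ?X) ?U"
      unfolding Diff_eq by (rule openin_open_Int[OF open_Compl[OF closed_singleton]])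
    have "openin (top_of_set (unit_ball m - {pole \<epsilon>})) ?U"
      unfolding U using T(1) by (rule openin_open_Int)
    then have open_image: "openin (half_space m) (cayley m \<epsilon> ` ?U)"
      using homeomorphic_imp_open_map[OF hom] by (simp only: open_map_def)
    have "homeomorphic_map (subtopology (top_of_set (unit_ball m - {pole \<epsilon>})) ?U)
        (subtopology (half_space m) (cayley m \<epsilon> ` ?U)) (cayley m \<epsilon>)"
    proof (rule homeomorphic_map_subtopologies[OF hom])
      have "cayley m \<epsilon> ` ?U \<subseteq> topspace (half_space m)"
        using open_image by (rule openin_subset)
      moreover have "topspace (top_of_set (unit_ball m - {pole \<epsilon>})) \<inter> ?U = ?U"
        unfolding U by auto
      ultimately show "cayley m \<epsilon> ` (topspace (top_of_set (unit_ball m - {pole \<epsilon>})) \<inter> ?U)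
          = topspace (half_space m) \<inter> cayley m \<epsilon> ` ?U"
        by (simp only: Int_absorb1)
    qed
    moreover have "subtopology (top_of_set (unit_ball m - {pole \<epsilon>})) ?U = subtopology (top_of_set ?X) ?U"
      unfolding subtopology_subtopology
      by (rule arg_cong[where f = "subtopology euclidean"]) (use cut_ball_subset in blast)
    ultimately have "subtopology (top_of_set ?X) ?U homeomorphic_space
        subtopology (half_space m) (cayley m \<epsilon> ` ?U)"
      using homeomorphic_map_imp_homeomorphic_space by metis
    moreover have "x \<in> ?U"
      using x \<epsilon>(2) by blast
    ultimately show ?thesis
      using open_U open_image by blast
  qed
qed

subsection \<open>Logarithmic relations\<close>

text \<open>
  A relation \<open>(S, f)\<close> records the nonzero terms of a Pluecker relation: the term with index
  \<open>k \<in> S\<close> is the product of the values at the two components of \<open>f k\<close>.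
\<close>

type_synonym 'a relation = "nat set \<times> (nat \<Rightarrow> 'a \<times> 'a)"

definition log_term :: "('a \<Rightarrow> real) \<Rightarrow> 'a relation \<Rightarrow> nat \<Rightarrow> real" where
  "log_term v r k = v (fst (snd r k)) + v (snd (snd r k))"

definition log_null :: "ennreal \<Rightarrow> 'a relation \<Rightarrow> ('a \<Rightarrow> real) \<Rightarrow> bool" where
  "log_null q r v \<longleftrightarrow> q_null q (fst r) (\<lambda>k. exp (log_term v r k))"

lemma log_term_linear:
  assumes "linear \<sigma>"
  shows "log_term (\<sigma> (t *\<^sub>R x)) r k = t * log_term (\<sigma> x) r k"
  using assms by (simp add: log_term_def linear_cmul distrib_left)

lemma log_null_zero:
  assumes "finite (fst r)"
  shows "log_null 0 r v \<longleftrightarrow> (\<forall>k\<in>fst r. \<exists>l\<in>fst r - {k}. log_term v r k \<le> log_term v r l)"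
proof
  assume null: "log_null 0 r v"
  show "\<forall>k\<in>fst r. \<exists>l\<in>fst r - {k}. log_term v r k \<le> log_term v r l"
  proof
    fix k assume k: "k \<in> fst r"
    then have "max_attained_twice (fst r) (\<lambda>k. exp (log_term v r k))"
      using null by (auto simp: log_null_def q_null_def)
    then obtain i j where "i \<in> fst r" "j \<in> fst r" "i \<noteq> j" "log_term v r i = log_term v r j"
      "\<forall>l\<in>fst r. log_term v r l \<le> log_term v r i"
      by (auto simp: max_attained_twice_def)
    then show "\<exists>l\<in>fst r - {k}. log_term v r k \<le> log_term v r l"
      using k by (cases "k = i") (auto intro: bexI[of _ j] bexI[of _ i])
  qed
next
  assume *: "\<forall>k\<in>fst r. \<exists>l\<in>fst r - {k}. log_term v r k \<le> log_term v r l"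
  show "log_null 0 r v"
    unfolding log_null_def
  proof (rule q_null_zeroI[OF assms])
    fix k assume "k \<in> fst r"
    then obtain l where "l \<in> fst r" "l \<noteq> k" "log_term v r k \<le> log_term v r l"
      using * by blast
    then show "\<exists>l\<in>fst r. l \<noteq> k \<and> exp (log_term v r k) \<le> exp (log_term v r l)"
      by auto
  qed simp
qed

text \<open>All listed terms are exponentials, hence nonzero, so three or more of them impose
  nothing. Two terms must be equal, which is a linear equation in the logarithms; a single term
  could never be null.\<close>

lemma log_null_infinity:
  assumes "finite (fst r)" "card (fst r) \<noteq> 1"
  shows "log_null \<infinity> r v \<longleftrightarrow>
    (card (fst r) = 2 \<longrightarrow> (\<forall>k\<in>fst r. \<forall>l\<in>fst r. log_term v r k = log_term v r l))"
proof -
  have null: "log_null \<infinity> r v \<longleftrightarrow> fst r = {} \<or> 3 \<le> card (fst r) \<or>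
      max_attained_twice (fst r) (\<lambda>k. exp (log_term v r k))"
    by (auto simp: log_null_def q_null_def)
  consider "fst r = {}" | "3 \<le> card (fst r)" | "card (fst r) = 2"
  proof -
    have "card (fst r) = 0 \<Longrightarrow> fst r = {}"
      using assms(1) by simp
    then show ?thesis
      using that assms(2) by linarith
  qed
  then show ?thesis
  proof cases
    case 3
    then obtain a b where ab: "fst r = {a, b}" "a \<noteq> b"
      by (auto simp: card_2_iff)
    then show ?thesis
      using 3 unfolding null ab(1) max_attained_twice_def by auto
  qed (use null in auto)
qed

lemma log_null_finite:
  assumes "0 < q" "q < \<infinity>"
  shows "log_null q r v \<longleftrightarrow> (\<forall>k\<in>fst r. exp (log_term v r k / enn2real q)
      \<le> (\<Sum>l\<in>fst r - {k}. exp (log_term v r l / enn2real q)))"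
  using assms by (auto simp: log_null_def q_null_def powr_def)

text \<open>With \<open>Y\<close> the right-hand sum, the weights \<open>exp (a l) / Y\<close> add
  up to 1, and each is below 1 because there are at least two. A number in (0,1) is smaller than its
  \<open>t\<close>-th power for \<open>t < 1\<close>, so the \<open>t\<close>-th powers add up to
  more than 1; multiplying by the \<open>t\<close>-th power of \<open>Y\<close> gives the
  claim.\<close>

lemma exp_sum_strict:
  fixes a :: "nat \<Rightarrow> real"
  assumes T: "finite T" "2 \<le> card T" and le: "exp b \<le> (\<Sum>l\<in>T. exp (a l))" and t: "0 \<le> t" "t < 1"
  shows "exp (t * b) < (\<Sum>l\<in>T. exp (t * a l))"
proof -
  define Y where "Y = (\<Sum>l\<in>T. exp (a l))"
  have ne: "T \<noteq> {}"
    using T(2) by auto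
  have Y: "0 < Y"
    unfolding Y_def using T(1) ne by (intro sum_pos) auto
  have lt: "exp (a l) < Y" if "l \<in> T" for l
  proof -
    have "T - {l} \<noteq> {}"
    proof
      assume "T - {l} = {}"
      then have "T \<subseteq> {l}"
        by blast
      then have "card T \<le> card {l}"
        by (intro card_mono) auto
      then show False
        using T(2) by simp
    qed
    then have "0 < (\<Sum>l\<in>T - {l}. exp (a l))"
      using T(1) by (intro sum_pos) auto
    then show ?thesis
      unfolding Y_def using T(1) that by (simp add: sum.remove[of T l])
  qed
  have "exp (t * b) \<le> exp (t * ln Y)"
    using le Y t(1) by (simp add: Y_def[symmetric] mult_left_mono ln_ge_iff)
  also have "\<dots> = (\<Sum>l\<in>T. exp (a l) / Y) * exp (t * ln Y)"
    using Y by (simp add: sum_divide_distrib[symmetric] Y_def[symmetric])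
  also have "\<dots> < (\<Sum>l\<in>T. exp (t * a l))"
    unfolding sum_distrib_right
  proof (rule sum_strict_mono[OF T(1) ne])
    fix l assume l: "l \<in> T"
    have "a l < ln Y"
      using lt[OF l] Y by (metis exp_less_cancel_iff exp_ln)
    then have "0 < (1 - t) * (ln Y - a l)"
      using t by simp
    then have "a l - ln Y + t * ln Y < t * a l"
      by (simp add: algebra_simps)
    moreover have "exp (a l) / Y * exp (t * ln Y) = exp (a l - ln Y + t * ln Y)"
      using Y by (simp add: exp_add exp_diff)
    ultimately show "exp (a l) / Y * exp (t * ln Y) < exp (t * a l)"
      by simp
  qed
  finally show ?thesis .
qed

text \<open>If all \<open>a l\<close> stayed below \<open>b\<close> by a gap \<open>e\<close>, then
  \<open>exp (t * e)\<close> would be at most the number of terms for every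
  \<open>t\<close>.\<close>

lemma exp_sum_all_scales:
  fixes a :: "nat \<Rightarrow> real"
  assumes "finite T" "\<And>t. 0 \<le> t \<Longrightarrow> exp (t * b) \<le> (\<Sum>l\<in>T. exp (t * a l))"
  shows "\<exists>l\<in>T. b \<le> a l"
proof (rule ccontr)
  assume "\<not> ?thesis"
  then have lt: "\<And>l. l \<in> T \<Longrightarrow> a l < b"
    by force
  have "T \<noteq> {}"
    using assms(2)[of 0] by auto
  then have Mx: "Max (a ` T) < b" "\<And>l. l \<in> T \<Longrightarrow> a l \<le> Max (a ` T)"
    using lt assms(1) by auto
  define e where "e = b - Max (a ` T)"
  \<comment> \<open>Chosen so that \<open>t * e = card T\<close>; then
    \<open>exp N \<ge> 1 + N\<close> at \<open>N = card T\<close> is the contradiction.\<close>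
  define t where "t = real (card T) / e"
  have e: "0 < e"
    using Mx(1) by (simp add: e_def)
  have t: "0 \<le> t"
    using e by (simp add: t_def)
  have "exp (t * b) \<le> (\<Sum>l\<in>T. exp (t * a l))"
    by (rule assms(2)[OF t])
  also have "\<dots> \<le> (\<Sum>l\<in>T. exp (t * Max (a ` T)))"
    using Mx(2) t by (intro sum_mono) (simp add: mult_left_mono)
  finally have "exp (t * b) \<le> real (card T) * exp (t * Max (a ` T))"
    by simp
  moreover have "t * b = real (card T) + t * Max (a ` T)"
    using e by (simp add: t_def e_def field_simps)
  ultimately have "exp (real (card T)) \<le> real (card T)"
    by (simp add: exp_add)
  then show False
    using exp_ge_add_one_self[of "real (card T)"] by linarith
qed

text \<open>The gauge vanishes where the relations hold at all scales \<open>t\<close>, that is, for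
  all exponents \<open>q / t\<close>; comparing growth for large \<open>t\<close> turns this into
  nullity at q = 0.\<close>

lemma relation_gauge:
  fixes R :: "'a relation set" and \<sigma> :: "(nat \<Rightarrow> real) \<Rightarrow> 'a \<Rightarrow> real"
  assumes R: "finite R" "\<And>r. r \<in> R \<Longrightarrow> finite (fst r)" "\<And>r. r \<in> R \<Longrightarrow> card (fst r) \<noteq> 1"
    and \<sigma>: "linear \<sigma>" "continuous_on UNIV \<sigma>" and inf: "\<And>x r. r \<in> R \<Longrightarrow> log_null \<infinity> r (\<sigma> x)"
    and q: "0 < q" "q < \<infinity>"
  obtains g where "homogeneous_on (coord_space m) g" "continuous_on (coord_space m) g"
    "{x \<in> coord_space m. \<forall>r\<in>R. log_null q r (\<sigma> x)} = {x \<in> coord_space m. g x \<le> 1}"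
    "\<And>x. x \<in> coord_space m \<Longrightarrow> g x = 0 \<longleftrightarrow> (\<forall>r\<in>R. log_null 0 r (\<sigma> x))"
proof -
  define c where "c = enn2real q"
  have c: "0 < c"
    using q by (simp add: c_def enn2real_positive_iff)
  define a where "a x r k = log_term (\<sigma> x) r k / c" for x r k
  define L where "L = {x \<in> coord_space m. \<forall>r\<in>R. log_null q r (\<sigma> x)}"
  \<comment> \<open>Two-term relations are equalities on the range of \<open>\<sigma>\<close> and
    never become strict, so the open set \<open>U\<close> must omit them.\<close>
  define R3 where "R3 = {r\<in>R. 3 \<le> card (fst r)}"
  define U where "U = {x \<in> coord_space m. \<forall>r\<in>R3. \<forall>k\<in>fst r. exp (a x r k) < (\<Sum>l\<in>fst r - {k}. exp (a x r l))}"
  have L: "L = {x \<in> coord_space m. \<forall>r\<in>R. \<forall>k\<in>fst r. exp (a x r k) \<le> (\<Sum>l\<in>fst r - {k}. exp (a x r l))}"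
    unfolding L_def log_null_finite[OF q] a_def c_def ..
  have a_scale: "a (t *\<^sub>R x) r k = t * a x r k" for t x r k
    by (simp add: a_def log_term_linear[OF \<sigma>(1)])
  have a_cont: "continuous_on UNIV (\<lambda>x. a x r k)" for r k
  proof -
    have "continuous_on UNIV (\<lambda>x. \<sigma> x \<alpha>)" for \<alpha>
      using \<sigma>(2) by (rule continuous_on_product_then_coordinatewise)
    then show ?thesis
      unfolding a_def log_term_def using c by (intro continuous_on_divide continuous_on_add) auto
  qed
  have sum_cont: "continuous_on UNIV (\<lambda>x. exp (a x r k))"
    "continuous_on UNIV (\<lambda>x. \<Sum>l\<in>A. exp (a x r l))" for r k A
    by (intro continuous_on_exp a_cont continuous_on_sum)+
  have zero_a: "a 0 r k = 0" for r k
    using a_scale[of 0 0] by simp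
  have two: "exp (a x r k) \<le> (\<Sum>l\<in>fst r - {k}. exp (a x r l))"
    if rk: "r \<in> R" "k \<in> fst r" "\<not> 3 \<le> card (fst r)" for x r k
  proof -
    have "card (fst r) \<noteq> 0"
      using that R(2) by auto
    then have "card (fst r) = 2"
      using that(3) R(3)[OF that(1)] by linarith
    then obtain y z where "fst r = {y, z}" "y \<noteq> z"
      by (auto simp: card_2_iff)
    then obtain l where l: "fst r = {k, l}" "l \<noteq> k"
      using rk(2) by (cases "k = y") (auto simp: insert_commute)
    then have "log_term (\<sigma> x) r k = log_term (\<sigma> x) r l"
      using inf[OF that(1), of x] \<open>card (fst r) = 2\<close>
      unfolding log_null_infinity[OF R(2)[OF that(1)] R(3)[OF that(1)]] by blast
    moreover have "fst r - {k} = {l}"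
      using l by auto
    ultimately show ?thesis
      by (simp add: a_def)
  qed
  have UL: "U \<subseteq> L"
  proof
    fix x assume x: "x \<in> U"
    have "exp (a x r k) \<le> (\<Sum>l\<in>fst r - {k}. exp (a x r l))" if "r \<in> R" "k \<in> fst r" for r k
    proof (cases "3 \<le> card (fst r)")
      case True
      show ?thesis
      proof -
        have "r \<in> R3"
          using True that by (simp add: R3_def)
        then show ?thesis
          using x that(2) unfolding U_def by (blast intro: less_imp_le)
      qed
    qed (use two that in blast)
    then show "x \<in> L"
      using x by (simp add: L U_def)
  qed
  have closed_L: "closedin (top_of_set (coord_space m)) L"
  proof -
    have "closed (\<Inter>r\<in>R. \<Inter>k\<in>fst r. {x. exp (a x r k) \<le> (\<Sum>l\<in>fst r - {k}. exp (a x r l))})"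
      by (intro closed_INT ballI closed_Collect_le sum_cont)
    moreover have "L = coord_space m \<inter>
        (\<Inter>r\<in>R. \<Inter>k\<in>fst r. {x. exp (a x r k) \<le> (\<Sum>l\<in>fst r - {k}. exp (a x r l))})"
      unfolding L by blast
    ultimately show ?thesis
      using closedin_closed by blast
  qed
  have open_U: "openin (top_of_set (coord_space m)) U"
  proof -
    have "open (\<Inter>r\<in>R3. \<Inter>k\<in>fst r. {x. exp (a x r k) < (\<Sum>l\<in>fst r - {k}. exp (a x r l))})"
      using R(1,2) by (intro open_INT ballI open_Collect_less sum_cont) (auto simp: R3_def)
    moreover have "U = coord_space m \<inter>
        (\<Inter>r\<in>R3. \<Inter>k\<in>fst r. {x. exp (a x r k) < (\<Sum>l\<in>fst r - {k}. exp (a x r l))})"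
      unfolding U_def by blast
    ultimately show ?thesis
      using openin_open by blast
  qed
  have scale: "t *\<^sub>R x \<in> U" if "x \<in> L" "0 \<le> t" "t < 1" for x t
  proof -
    have "exp (t * a x r k) < (\<Sum>l\<in>fst r - {k}. exp (t * a x r l))" if rk: "r \<in> R3" "k \<in> fst r" for r k
    proof (rule exp_sum_strict)
      show "finite (fst r - {k})" "2 \<le> card (fst r - {k})"
        using rk R(2) by (auto simp: R3_def)
      show "exp (a x r k) \<le> (\<Sum>l\<in>fst r - {k}. exp (a x r l))"
        using \<open>x \<in> L\<close> rk unfolding L R3_def by blast
    qed (use \<open>0 \<le> t\<close> \<open>t < 1\<close> in auto)
    moreover have "t *\<^sub>R x \<in> coord_space m"
      using that(1) by (auto simp: L intro: scaleR_in_coord_space)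
    ultimately show ?thesis
      by (simp add: U_def a_scale)
  qed
  \<comment> \<open>At the origin every term is \<open>exp 0 = 1\<close>, so the inequality only
    says that at least one other term exists.\<close>
  have zero: "0 \<in> L"
  proof -
    have "exp (a 0 r k) \<le> (\<Sum>l\<in>fst r - {k}. exp (a 0 r l))" if "r \<in> R" "k \<in> fst r" for r k
    proof (cases "3 \<le> card (fst r)")
      case True
      then show ?thesis
        using that by (simp add: zero_a)
    qed (use two that in blast)
    then show ?thesis
      using zero_in_coord_space by (simp add: L)
  qed
  obtain g where g: "homogeneous_on (coord_space m) g" "continuous_on (coord_space m) g"
    "L = {x\<in>coord_space m. g x \<le> 1}"
    "\<And>x. x \<in> coord_space m \<Longrightarrow> g x = 0 \<longleftrightarrow> (\<forall>t\<ge>0. t *\<^sub>R x \<in> L)"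
    by (rule continuous_gauge[OF scaleR_in_coord_space closed_L zero open_U UL scale]) auto
  have "(\<forall>t\<ge>0. t *\<^sub>R x \<in> L) \<longleftrightarrow> (\<forall>r\<in>R. log_null 0 r (\<sigma> x))" if x: "x \<in> coord_space m" for x
  proof
    assume *: "\<forall>t\<ge>0. t *\<^sub>R x \<in> L"
    have "\<exists>l\<in>fst r - {k}. log_term (\<sigma> x) r k \<le> log_term (\<sigma> x) r l" if "r \<in> R" "k \<in> fst r" for r k
    proof -
      have "exp (t * a x r k) \<le> (\<Sum>l\<in>fst r - {k}. exp (t * a x r l))" if "0 \<le> t" for t
        using * that \<open>r \<in> R\<close> \<open>k \<in> fst r\<close> by (simp add: L a_scale)
      then have "\<exists>l\<in>fst r - {k}. a x r k \<le> a x r l"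
        using R(2)[OF that(1)] by (intro exp_sum_all_scales) auto
      then show ?thesis
        using c by (simp add: a_def divide_le_cancel)
    qed
    then show "\<forall>r\<in>R. log_null 0 r (\<sigma> x)"
      using log_null_zero R(2) by blast
  next
    assume *: "\<forall>r\<in>R. log_null 0 r (\<sigma> x)"
    have "exp (a (t *\<^sub>R x) r k) \<le> (\<Sum>l\<in>fst r - {k}. exp (a (t *\<^sub>R x) r l))"
      if rk: "r \<in> R" "k \<in> fst r" and t: "0 \<le> t" for t r k
    proof -
      obtain l where l: "l \<in> fst r - {k}" "log_term (\<sigma> x) r k \<le> log_term (\<sigma> x) r l"
        using * log_null_zero[OF R(2)[OF rk(1)]] rk by blast
      have "exp (a (t *\<^sub>R x) r k) \<le> exp (a (t *\<^sub>R x) r l)"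
        using l(2) t c unfolding a_scale by (simp add: a_def mult_left_mono divide_right_mono)
      also have "\<dots> \<le> (\<Sum>l\<in>fst r - {k}. exp (a (t *\<^sub>R x) r l))"
        using l(1) R(2)[OF rk(1)] by (intro member_le_sum) auto
      finally show ?thesis .
    qed
    then show "\<forall>t\<ge>0. t *\<^sub>R x \<in> L"
      using scaleR_in_coord_space[OF x] by (simp add: L)
  qed
  then show ?thesis
    using that[of g] g unfolding L_def by blast
qed

subsection \<open>Representations in logarithmic coordinates\<close>

text \<open>Zero entries add nothing to sums of powers, and a maximum of a list that is not all zero
  is attained at nonzero entries; this permits taking logarithms.\<close>

lemma q_null_support:
  assumes K: "finite K" and b: "\<And>k. k \<in> K \<Longrightarrow> 0 \<le> b k" and S: "S = {k\<in>K. b k \<noteq> 0}"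
  shows "q_null q K b \<longleftrightarrow> q_null q S b"
proof -
  have zero: "(\<forall>k\<in>K. b k = 0) \<longleftrightarrow> (\<forall>k\<in>S. b k = 0)"
    using S by blast
  have max: "max_attained_twice K b \<longleftrightarrow> max_attained_twice S b" if nz: "\<not> (\<forall>k\<in>K. b k = 0)"
  proof
    assume "max_attained_twice K b"
    then obtain i j where ij: "i \<in> K" "j \<in> K" "i \<noteq> j" "b i = b j" "\<forall>k\<in>K. b k \<le> b i"
      by (auto simp: max_attained_twice_def)
    obtain k where k: "k \<in> K" "b k \<noteq> 0"
      using nz by blast
    then have "0 < b k"
      using b[OF k(1)] by linarith
    then have "b i \<noteq> 0"
      using ij(5) k by force
    then have "i \<in> S" "j \<in> S" "\<forall>k\<in>S. b k \<le> b i"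
      using ij S by auto
    then show "max_attained_twice S b"
      using ij(3,4) unfolding max_attained_twice_def by blast
  next
    assume "max_attained_twice S b"
    then obtain i j where ij: "i \<in> S" "j \<in> S" "i \<noteq> j" "b i = b j" "\<forall>k\<in>S. b k \<le> b i"
      by (auto simp: max_attained_twice_def)
    have "b k \<le> b i" if "k \<in> K" for k
    proof (cases "k \<in> S")
      case False
      then show ?thesis
        using that S b[of i] ij(1) by auto
    qed (use ij in blast)
    moreover have "S \<subseteq> K"
      using S by blast
    ultimately show "max_attained_twice K b"
      using ij unfolding max_attained_twice_def by blast
  qed
  have card: "{k\<in>K. b k \<noteq> 0} = {k\<in>S. b k \<noteq> 0}"
    using S by blast
  have sum: "(\<Sum>j\<in>K - {i}. b j powr p) = (\<Sum>j\<in>S - {i}. b j powr p)" for i p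
    using K S by (intro sum.mono_neutral_right) auto
  have fin: "(\<forall>i\<in>K. b i powr p \<le> (\<Sum>j\<in>K - {i}. b j powr p)) \<longleftrightarrow>
      (\<forall>i\<in>S. b i powr p \<le> (\<Sum>j\<in>S - {i}. b j powr p))" for p
  proof -
    have "b i powr p \<le> (\<Sum>j\<in>S - {i}. b j powr p)" if "i \<in> K" "i \<notin> S" for i
    proof -
      have "b i = 0"
        using that S by blast
      then show ?thesis
        by (simp add: sum_nonneg)
    qed
    then show ?thesis
      unfolding sum using S by blast
  qed
  have zero_max: "(\<forall>k\<in>K. b k = 0) \<or> max_attained_twice K b \<longleftrightarrow>
      (\<forall>k\<in>S. b k = 0) \<or> max_attained_twice S b"
    using zero max by blast
  show ?thesis
    unfolding q_null_def disj_assoc[symmetric] zero_max card fin ..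
qed

lemma q_null_cong: "(\<And>k. k \<in> K \<Longrightarrow> b k = b' k) \<Longrightarrow> q_null q K b \<longleftrightarrow> q_null q K b'"
proof -
  assume *: "\<And>k. k \<in> K \<Longrightarrow> b k = b' k"
  have "max_attained_twice K b \<longleftrightarrow> max_attained_twice K b'"
    using * unfolding max_attained_twice_def by (intro bex_cong conj_cong ball_cong) auto
  moreover have "{k \<in> K. b k \<noteq> 0} = {k \<in> K. b' k \<noteq> 0}"
    using * by auto
  moreover have "(\<Sum>j\<in>K - {i}. b j powr p) = (\<Sum>j\<in>K - {i}. b' j powr p)" for i p
    using * by (intro sum.cong) auto
  ultimately show ?thesis
    using * unfolding q_null_def by (simp cong: ball_cong)
qed

text \<open>\<open>restrict\<close> fixes the values off \<open>S\<close>, so a relation is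
  determined by finite data and the family is finite, although infinitely many functions
  \<open>i\<close> and \<open>j\<close> represent the same indices.\<close>

definition pluecker_relation ::
    "(nat \<Rightarrow> nat) set \<Rightarrow> (nat \<Rightarrow> nat) \<Rightarrow> (nat \<Rightarrow> nat) \<Rightarrow> (nat \<Rightarrow> nat) \<Rightarrow> nat \<Rightarrow> (nat \<Rightarrow> nat) relation" where
  "pluecker_relation J \<alpha> i j s =
     (let S = {k\<in>{0..s}. left_term \<alpha> i s k \<in> J \<and> right_term \<alpha> i j s k \<in> J}
      in (S, restrict (\<lambda>k. (left_term \<alpha> i s k, right_term \<alpha> i j s k)) S))"

definition admissible ::
    "nat \<Rightarrow> nat \<Rightarrow> (nat \<Rightarrow> nat) set \<Rightarrow> nat \<Rightarrow> (nat \<Rightarrow> nat) \<Rightarrow> (nat \<Rightarrow> nat) \<Rightarrow> (nat \<Rightarrow> nat) \<Rightarrow> bool" where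
  "admissible n d J s \<alpha> i j \<longleftrightarrow> \<alpha> \<in> Delta n (d - s) \<and> delta_minus J \<le> \<alpha> \<and>
     i ` {0..s} \<subseteq> {1..n} \<and> mono_on {0..s} i \<and> j ` {2..s} \<subseteq> {1..n} \<and> mono_on {2..s} j \<and>
     \<alpha> + (\<Sum>m=0..s. unit_vec (i m)) + (\<Sum>m=2..s. unit_vec (j m)) \<le> delta_plus J"

definition pluecker_family ::
    "nat \<Rightarrow> nat \<Rightarrow> (nat \<Rightarrow> nat) set \<Rightarrow> nat set \<Rightarrow> (nat \<Rightarrow> nat) relation set" where
  "pluecker_family n d J D = {pluecker_relation J \<alpha> i j s | \<alpha> i j s. s \<in> D \<and> admissible n d J s \<alpha> i j}"

text \<open>\<open>D\<close> collects the allowed values of \<open>s\<close>: \<open>{2..d}\<close>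
  is the strong case and \<open>{2} \<inter> {2..d}\<close> the weak one, which is empty when
  \<open>d < 2\<close>.\<close>

definition reps ::
    "nat \<Rightarrow> nat \<Rightarrow> (nat \<Rightarrow> nat) set \<Rightarrow> nat set \<Rightarrow> ennreal \<Rightarrow> ((nat \<Rightarrow> nat) \<Rightarrow> real) set" where
  "reps n d J D q = {\<rho>. (\<forall>\<alpha>. \<rho> \<alpha> \<ge> 0) \<and> {\<alpha>. \<rho> \<alpha> \<noteq> 0} = J \<and>
     (\<forall>s\<in>D. pluecker_relations n d J q s \<rho>)}"

lemma strong_reps_eq: "strong_reps n d J q = reps n d J {2..d} q"
  unfolding strong_reps_def reps_def by auto

lemma weak_reps_eq: "weak_reps n d J q = reps n d J ({2} \<inter> {2..d}) q"
  unfolding weak_reps_def reps_def by auto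

lemma pluecker_relations_iff:
  assumes \<rho>: "\<And>\<alpha>. \<rho> \<alpha> \<ge> 0" "{\<alpha>. \<rho> \<alpha> \<noteq> 0} = J"
  shows "pluecker_relations n d J q s \<rho> \<longleftrightarrow>
    (\<forall>\<alpha> i j. admissible n d J s \<alpha> i j \<longrightarrow> log_null q (pluecker_relation J \<alpha> i j s) (log_on J \<rho>))"
proof -
  have eq: "q_null q {0..s} (\<lambda>k. \<rho> (left_term \<alpha> i s k) * \<rho> (right_term \<alpha> i j s k)) \<longleftrightarrow>
      log_null q (pluecker_relation J \<alpha> i j s) (log_on J \<rho>)" for \<alpha> i j
  proof -
    define S where "S = {k\<in>{0..s}. left_term \<alpha> i s k \<in> J \<and> right_term \<alpha> i j s k \<in> J}"
    have mem: "x \<in> J \<longleftrightarrow> \<rho> x \<noteq> 0" for x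
      using \<rho>(2) by blast
    have "S = {k\<in>{0..s}. \<rho> (left_term \<alpha> i s k) * \<rho> (right_term \<alpha> i j s k) \<noteq> 0}"
      by (simp add: S_def mem)
    then have "q_null q {0..s} (\<lambda>k. \<rho> (left_term \<alpha> i s k) * \<rho> (right_term \<alpha> i j s k)) \<longleftrightarrow>
        q_null q S (\<lambda>k. \<rho> (left_term \<alpha> i s k) * \<rho> (right_term \<alpha> i j s k))"
      using \<rho>(1) by (intro q_null_support) auto
    also have "\<dots> \<longleftrightarrow> q_null q S (\<lambda>k. exp (log_term (log_on J \<rho>) (pluecker_relation J \<alpha> i j s) k))"
    proof (rule q_null_cong)
      fix k assume k: "k \<in> S"
      then have J: "left_term \<alpha> i s k \<in> J" "right_term \<alpha> i j s k \<in> J"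
        by (simp_all add: S_def)
      have "0 < \<rho> x" if "x \<in> J" for x
        using that mem[of x] \<rho>(1)[of x] by linarith
      then have "0 < \<rho> (left_term \<alpha> i s k)" "0 < \<rho> (right_term \<alpha> i j s k)"
        using J by blast+
      then show "\<rho> (left_term \<alpha> i s k) * \<rho> (right_term \<alpha> i j s k)
          = exp (log_term (log_on J \<rho>) (pluecker_relation J \<alpha> i j s) k)"
        using k J by (simp add: log_term_def pluecker_relation_def Let_def S_def log_on_def exp_add)
    qed
    also have "S = fst (pluecker_relation J \<alpha> i j s)"
      by (simp add: pluecker_relation_def Let_def S_def)
    finally show ?thesis
      unfolding log_null_def .
  qed
  show ?thesis
    unfolding pluecker_relations_def admissible_def left_term_def[symmetric] right_term_def[symmetric]
      eq Ball_def imp_conjL by (simp only: all_simps)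
qed

lemma reps_iff:
  "\<rho> \<in> reps n d J D q \<longleftrightarrow> (\<forall>\<alpha>. \<rho> \<alpha> \<ge> 0) \<and> {\<alpha>. \<rho> \<alpha> \<noteq> 0} = J \<and>
    (\<forall>r\<in>pluecker_family n d J D. log_null q r (log_on J \<rho>))"
proof -
  have "(\<forall>s\<in>D. pluecker_relations n d J q s \<rho>) \<longleftrightarrow>
      (\<forall>r\<in>pluecker_family n d J D. log_null q r (log_on J \<rho>))"
    if "\<forall>\<alpha>. \<rho> \<alpha> \<ge> 0" "{\<alpha>. \<rho> \<alpha> \<noteq> 0} = J"
  proof -
    have "pluecker_relations n d J q s \<rho> \<longleftrightarrow> (\<forall>\<alpha> i j. admissible n d J s \<alpha> i j \<longrightarrow>
        log_null q (pluecker_relation J \<alpha> i j s) (log_on J \<rho>))" for s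
      using that by (intro pluecker_relations_iff) auto
    then show ?thesis
      unfolding pluecker_family_def by blast
  qed
  then show ?thesis
    unfolding reps_def by blast
qed

definition exp_on :: "'a set \<Rightarrow> ('a \<Rightarrow> real) \<Rightarrow> 'a \<Rightarrow> real" where
  "exp_on J v = (\<lambda>\<alpha>. if \<alpha> \<in> J then exp (v \<alpha>) else 0)"

lemma log_exp_on: "(\<And>\<alpha>. \<alpha> \<notin> J \<Longrightarrow> v \<alpha> = 0) \<Longrightarrow> log_on J (exp_on J v) = v"
  by (auto simp: log_on_def exp_on_def)

lemma exp_on_reps:
  assumes "\<And>\<alpha>. \<alpha> \<notin> J \<Longrightarrow> v \<alpha> = 0"
  shows "exp_on J v \<in> reps n d J D q \<longleftrightarrow> (\<forall>r\<in>pluecker_family n d J D. log_null q r v)"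
proof -
  have "log_on J (exp_on J v) = v"
    using assms by (rule log_exp_on)
  then show ?thesis
    unfolding reps_iff by (auto simp: exp_on_def)
qed

lemma log_reps:
  "log_on J ` reps n d J D q =
    {v. (\<forall>\<alpha>. \<alpha> \<notin> J \<longrightarrow> v \<alpha> = 0) \<and> (\<forall>r\<in>pluecker_family n d J D. log_null q r v)}"
proof (intro equalityI subsetI)
  fix v assume "v \<in> log_on J ` reps n d J D q"
  then show "v \<in> {v. (\<forall>\<alpha>. \<alpha> \<notin> J \<longrightarrow> v \<alpha> = 0) \<and> (\<forall>r\<in>pluecker_family n d J D. log_null q r v)}"
    by (auto simp: reps_iff log_on_def[abs_def])
next
  fix v
  assume v: "v \<in> {v. (\<forall>\<alpha>. \<alpha> \<notin> J \<longrightarrow> v \<alpha> = 0) \<and> (\<forall>r\<in>pluecker_family n d J D. log_null q r v)}"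
  then have "exp_on J v \<in> reps n d J D q"
    using exp_on_reps[of J v] by blast
  moreover have "v = log_on J (exp_on J v)"
    using v log_exp_on[of J v] by auto
  ultimately show "v \<in> log_on J ` reps n d J D q"
    by blast
qed

lemma fst_pluecker_relation:
  "fst (pluecker_relation J \<alpha> i j s) = {k\<in>{0..s}. left_term \<alpha> i s k \<in> J \<and> right_term \<alpha> i j s k \<in> J}"
  by (simp add: pluecker_relation_def Let_def)

lemma finite_fst_pluecker_family: "r \<in> pluecker_family n d J D \<Longrightarrow> finite (fst r)"
  by (auto simp: pluecker_family_def fst_pluecker_relation)

lemma finite_pluecker_family:
  assumes "finite J" "D \<subseteq> {..d}"
  shows "finite (pluecker_family n d J D)"
proof (rule finite_subset)
  show "pluecker_family n d J D \<subseteq> (SIGMA S : Pow {0..d}. S \<rightarrow>\<^sub>E J \<times> J)"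
  proof
    fix r assume "r \<in> pluecker_family n d J D"
    then obtain \<alpha> i j s where r: "r = pluecker_relation J \<alpha> i j s" and s: "s \<in> D"
      unfolding pluecker_family_def by blast
    then have "s \<le> d"
      using assms(2) by blast
    then show "r \<in> (SIGMA S : Pow {0..d}. S \<rightarrow>\<^sub>E J \<times> J)"
      unfolding r pluecker_relation_def Let_def by auto
  qed
  show "finite (SIGMA S : Pow {0..d}. S \<rightarrow>\<^sub>E J \<times> J)"
    using assms(1) by (intro finite_SigmaI finite_PiE) (auto intro: finite_subset)
qed

lemma (in M_convex_set) card_fst_pluecker_family:
  assumes "r \<in> pluecker_family n d J D"
  shows "card (fst r) \<noteq> 1"
proof
  assume "card (fst r) = 1"
  then obtain k where k: "fst r = {k}"
    by (auto simp: card_1_singleton_iff)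
  obtain \<alpha> i j s where r: "r = pluecker_relation J \<alpha> i j s"
    using assms unfolding pluecker_family_def by blast
  have "k \<le> s" "left_term \<alpha> i s k \<in> J" "right_term \<alpha> i j s k \<in> J"
    using k unfolding r fst_pluecker_relation by auto
  from support_partner[OF this] obtain l where
    "l \<le> s" "l \<noteq> k" "left_term \<alpha> i s l \<in> J" "right_term \<alpha> i j s l \<in> J"
    by blast
  then have "l \<in> fst r"
    unfolding r fst_pluecker_relation by simp
  then show False
    using k \<open>l \<noteq> k\<close> by blast
qed

text \<open>Elements of \<open>W\<close> are linear functionals of the exponent vector, restricted
  to \<open>J\<close>; the coefficients are the logarithms of torus parameters.\<close>

lemma W_space_iff:
  "W_space n J = {\<lambda>\<alpha>. if \<alpha> \<in> J then \<Sum>i=1..n. c i * real (\<alpha> i) else 0 | c. True}" (is "_ = ?R")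
proof
  define w where "w = (\<lambda>i \<alpha>. if \<alpha> \<in> J then real (\<alpha> i) else 0)"
  have W: "W_space n J = span (w ` {1..n})"
    by (simp add: W_space_def w_def)
  have R: "?R = range (\<lambda>c. \<Sum>i=1..n. c i *\<^sub>R w i)"
  proof -
    have "(\<lambda>\<alpha>. if \<alpha> \<in> J then \<Sum>i=1..n. c i * real (\<alpha> i) else 0) = (\<Sum>i=1..n. c i *\<^sub>R w i)" for c
      by (simp add: w_def sum_fun_apply fun_eq_iff)
    then show ?thesis
      by (simp only: full_SetCompr_eq simp_thms)
  qed
  show "?R \<subseteq> W_space n J"
    unfolding R W by (auto intro!: span_sum span_scale intro: span_base)
  show "W_space n J \<subseteq> ?R"
    unfolding W
  proof (rule span_minimal)
    show "w ` {1..n} \<subseteq> ?R"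
    proof
      fix z assume "z \<in> w ` {1..n}"
      then obtain k where k: "k \<in> {1..n}" "z = w k"
        by blast
      have "w k = (\<Sum>i=1..n. (if i = k then 1 else 0) *\<^sub>R w i)"
        using k(1) by (simp add: if_distrib[of "\<lambda>c. c *\<^sub>R _"] cong: if_cong)
      then show "z \<in> ?R"
        unfolding R k(2) by (rule range_eqI[where x = "\<lambda>i. if i = k then 1 else 0"])
    qed
    show "subspace ?R"
      unfolding R
    proof (rule subspaceI)
      show "0 \<in> range (\<lambda>c. \<Sum>i=1..n. c i *\<^sub>R w i)"
        by (rule range_eqI[of _ _ "\<lambda>_. 0"]) simp
      fix x y :: "(nat \<Rightarrow> nat) \<Rightarrow> real" and t :: real
      assume "x \<in> range (\<lambda>c. \<Sum>i=1..n. c i *\<^sub>R w i)"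
      then obtain a where a: "x = (\<Sum>i=1..n. a i *\<^sub>R w i)"
        by blast
      have "t *\<^sub>R x = (\<Sum>i=1..n. (t * a i) *\<^sub>R w i)"
        unfolding a by (simp add: scaleR_right.sum)
      then show "t *\<^sub>R x \<in> range (\<lambda>c. \<Sum>i=1..n. c i *\<^sub>R w i)"
        by (rule range_eqI[where x = "\<lambda>i. t * a i"])
      assume "y \<in> range (\<lambda>c. \<Sum>i=1..n. c i *\<^sub>R w i)"
      then obtain b where b: "y = (\<Sum>i=1..n. b i *\<^sub>R w i)"
        by blast
      have "x + y = (\<Sum>i=1..n. (a i + b i) *\<^sub>R w i)"
        unfolding a b by (simp add: scaleR_add_left sum.distrib)
      then show "x + y \<in> range (\<lambda>c. \<Sum>i=1..n. c i *\<^sub>R w i)"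
        by (rule range_eqI[where x = "\<lambda>i. a i + b i"])
    qed
  qed
qed

text \<open>The two arguments of a term have a sum that does not depend on the index, and an element
  of \<open>W\<close> is additive in exponent vectors from \<open>J\<close>.\<close>

lemma log_term_W_space:
  assumes w: "w \<in> W_space n J" and r: "r \<in> pluecker_family n d J D" and k: "k \<in> fst r" "l \<in> fst r"
  shows "log_term w r k = log_term w r l"
proof -
  obtain \<alpha> i j s where r: "r = pluecker_relation J \<alpha> i j s"
    using r unfolding pluecker_family_def by blast
  obtain c where c: "w = (\<lambda>\<alpha>. if \<alpha> \<in> J then \<Sum>i=1..n. c i * real (\<alpha> i) else 0)"
    using w unfolding W_space_iff by blast
  have "log_term w r k = (\<Sum>a=1..n. c a * real ((\<alpha> + (\<Sum>m=0..s. unit_vec (i m)) + (\<alpha> + (\<Sum>m=2..s. unit_vec (j m)))) a))"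
    if "k \<in> fst r" for k
  proof -
    have k: "k \<le> s" "left_term \<alpha> i s k \<in> J" "right_term \<alpha> i j s k \<in> J"
      using that unfolding r fst_pluecker_relation by auto
    have "left_term \<alpha> i s k + right_term \<alpha> i j s k
        = \<alpha> + (\<Sum>m=0..s. unit_vec (i m)) + (\<alpha> + (\<Sum>m=2..s. unit_vec (j m)))"
      unfolding right_term_eq left_term_add[OF k(1), symmetric] by (simp only: ac_simps)
    moreover have "log_term w r k = w (left_term \<alpha> i s k) + w (right_term \<alpha> i j s k)"
      using k by (simp add: log_term_def r pluecker_relation_def Let_def)
    moreover have "\<dots> = (\<Sum>a=1..n. c a * real ((left_term \<alpha> i s k + right_term \<alpha> i j s k) a))"
      using k(2,3) by (simp add: c sum.distrib distrib_left)
    ultimately show ?thesis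
      by (simp only:)
  qed
  then show ?thesis
    using k by (simp only:)
qed

text \<open>All terms are multiplied by one positive factor, which nullity ignores for every
  q.\<close>

lemma log_null_shift:
  assumes fin: "finite (fst r)" "card (fst r) \<noteq> 1"
    and w: "\<And>k l. k \<in> fst r \<Longrightarrow> l \<in> fst r \<Longrightarrow> log_term w r k = log_term w r l"
  shows "log_null q r (v + w) \<longleftrightarrow> log_null q r v"
proof -
  obtain c where "\<forall>k\<in>fst r. log_term w r k = c"
    using w by (metis all_not_in_conv)
  then have shift: "log_term (v + w) r k = log_term v r k + c" if "k \<in> fst r" for k
    using that by (auto simp: log_term_def)
  consider "q = 0" | "q = \<infinity>" | "0 < q" "q < \<infinity>"
    by (metis less_top infinity_ennreal_def not_gr_zero)
  then show ?thesis
  proof cases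
    case 1
    then show ?thesis
      using log_null_zero[OF fin(1)] shift by auto
  next
    case 2
    then show ?thesis
      using log_null_infinity[OF fin] shift by auto
  next
    case 3
    have "exp (log_term (v + w) r k / enn2real q) = exp (c / enn2real q) * exp (log_term v r k / enn2real q)"
      if "k \<in> fst r" for k
      using shift[OF that] by (simp add: add_divide_distrib exp_add)
    note shift_exp = this
    have "exp (log_term (v + w) r k / enn2real q)
          \<le> (\<Sum>l\<in>fst r - {k}. exp (log_term (v + w) r l / enn2real q)) \<longleftrightarrow>
        exp (log_term v r k / enn2real q) \<le> (\<Sum>l\<in>fst r - {k}. exp (log_term v r l / enn2real q))"
      if k: "k \<in> fst r" for k
    proof -
      have "(\<Sum>l\<in>fst r - {k}. exp (log_term (v + w) r l / enn2real q))
          = exp (c / enn2real q) * (\<Sum>l\<in>fst r - {k}. exp (log_term v r l / enn2real q))"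
        unfolding sum_distrib_left by (intro sum.cong) (auto simp: shift_exp)
      then show ?thesis
        by (simp add: shift_exp[OF k])
    qed
    then show ?thesis
      unfolding log_null_finite[OF 3] by blast
  qed
qed

text \<open>The logarithm of the monomial in \<open>t\<close> is the linear functional with
  coefficients \<open>ln (t i)\<close>; conversely, coefficients \<open>c i\<close> come from
  \<open>t i = exp (c i)\<close>.\<close>

lemma torus_orbit_eq_iff:
  assumes \<rho>: "\<And>\<alpha>. \<rho> \<alpha> \<ge> 0" "{\<alpha>. \<rho> \<alpha> \<noteq> 0} = J" and \<rho>': "\<And>\<alpha>. \<rho>' \<alpha> \<ge> 0" "{\<alpha>. \<rho>' \<alpha> \<noteq> 0} = J"
  shows "torus_orbit n \<rho> = torus_orbit n \<rho>' \<longleftrightarrow> log_on J \<rho>' - log_on J \<rho> \<in> W_space n J"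
proof -
  have act_act: "torus_act n t (torus_act n s \<rho>) = torus_act n (\<lambda>i. t i * s i) \<rho>" for t s \<rho>
    by (simp add: torus_act_def fun_eq_iff power_mult_distrib prod.distrib)
  have act_one: "torus_act n (\<lambda>_. 1) \<rho> = \<rho>" for \<rho>
    by (simp add: torus_act_def)
  have act_inverse: "torus_act n (\<lambda>i. inverse (t i)) (torus_act n t \<rho>) = \<rho>" if "\<forall>i\<in>{1..n}. t i > 0" for t \<rho>
  proof -
    have "inverse (t i) * t i = 1" if "i \<in> {1..n}" for i
      using \<open>\<forall>i\<in>{1..n}. t i > 0\<close> that by (metis left_inverse less_irrefl)
    then show ?thesis
      unfolding act_act by (simp add: torus_act_def)
  qed
  have orbits: "torus_orbit n \<rho> = torus_orbit n \<rho>' \<longleftrightarrow>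
      (\<exists>t. (\<forall>i\<in>{1..n}. t i > 0) \<and> \<rho>' = torus_act n t \<rho>)"
  proof
    assume "torus_orbit n \<rho> = torus_orbit n \<rho>'"
    moreover have "\<rho>' \<in> torus_orbit n \<rho>'"
      unfolding torus_orbit_def using act_one[of \<rho>'] by (intro CollectI exI[of _ "\<lambda>_. 1"]) simp
    ultimately show "\<exists>t. (\<forall>i\<in>{1..n}. t i > 0) \<and> \<rho>' = torus_act n t \<rho>"
      unfolding torus_orbit_def by blast
  next
    assume "\<exists>t. (\<forall>i\<in>{1..n}. t i > 0) \<and> \<rho>' = torus_act n t \<rho>"
    then obtain t where t: "\<forall>i\<in>{1..n}. t i > 0" "\<rho>' = torus_act n t \<rho>"
      by blast
    have inverse_act: "\<rho> = torus_act n (\<lambda>i. inverse (t i)) \<rho>'"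
      using act_inverse[OF t(1)] t(2) by simp
    show "torus_orbit n \<rho> = torus_orbit n \<rho>'"
    proof (intro equalityI subsetI)
      fix z assume "z \<in> torus_orbit n \<rho>"
      then obtain s where s: "\<forall>i\<in>{1..n}. s i > 0" "z = torus_act n s \<rho>"
        unfolding torus_orbit_def by blast
      have "z = torus_act n (\<lambda>i. s i * inverse (t i)) \<rho>'"
        using s(2) inverse_act act_act by metis
      then show "z \<in> torus_orbit n \<rho>'"
        unfolding torus_orbit_def using s(1) t(1)
        by (intro CollectI exI[of _ "\<lambda>i. s i * inverse (t i)"]) auto
    next
      fix z assume "z \<in> torus_orbit n \<rho>'"
      then obtain s where s: "\<forall>i\<in>{1..n}. s i > 0" "z = torus_act n s \<rho>'"
        unfolding torus_orbit_def by blast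
      have "z = torus_act n (\<lambda>i. s i * t i) \<rho>"
        unfolding s(2) t(2) act_act ..
      then show "z \<in> torus_orbit n \<rho>"
        unfolding torus_orbit_def using s(1) t(1)
        by (intro CollectI exI[of _ "\<lambda>i. s i * t i"]) auto
    qed
  qed
  have pos: "0 < \<rho> \<alpha>" "0 < \<rho>' \<alpha>" if "\<alpha> \<in> J" for \<alpha>
  proof -
    have "\<rho> \<alpha> \<noteq> 0" "\<rho>' \<alpha> \<noteq> 0"
      using that \<rho>(2) \<rho>'(2) by blast+
    then show "0 < \<rho> \<alpha>" "0 < \<rho>' \<alpha>"
      using \<rho>(1)[of \<alpha>] \<rho>'(1)[of \<alpha>] by linarith+
  qed
  have off: "\<rho> \<alpha> = 0" "\<rho>' \<alpha> = 0" if "\<alpha> \<notin> J" for \<alpha>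
    using that \<rho>(2) \<rho>'(2) by blast+
  have ln_act: "ln (\<Prod>i=1..n. t i ^ \<alpha> i) = (\<Sum>i=1..n. ln (t i) * real (\<alpha> i))"
    if "\<forall>i\<in>{1..n}. t i > 0" for t \<alpha>
  proof -
    have "ln (\<Prod>i=1..n. t i ^ \<alpha> i) = (\<Sum>i=1..n. ln (t i ^ \<alpha> i))"
      using that by (intro ln_prod) force+
    also have "\<dots> = (\<Sum>i=1..n. ln (t i) * real (\<alpha> i))"
      using that by (intro sum.cong) (auto simp: ln_realpow mult.commute)
    finally show ?thesis .
  qed
  show ?thesis
    unfolding orbits W_space_iff
  proof
    assume "\<exists>t. (\<forall>i\<in>{1..n}. t i > 0) \<and> \<rho>' = torus_act n t \<rho>"
    then obtain t where t: "\<forall>i\<in>{1..n}. t i > 0" "\<rho>' = torus_act n t \<rho>"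
      by blast
    have "log_on J \<rho>' - log_on J \<rho> = (\<lambda>\<alpha>. if \<alpha> \<in> J then \<Sum>i=1..n. ln (t i) * real (\<alpha> i) else 0)"
    proof
      fix \<alpha>
      have P: "0 < (\<Prod>i=1..n. t i ^ \<alpha> i)"
        using t(1) by (intro prod_pos) auto
      show "(log_on J \<rho>' - log_on J \<rho>) \<alpha> = (if \<alpha> \<in> J then \<Sum>i=1..n. ln (t i) * real (\<alpha> i) else 0)"
      proof (cases "\<alpha> \<in> J")
        case True
        have "ln (\<rho>' \<alpha>) = ln (\<Prod>i=1..n. t i ^ \<alpha> i) + ln (\<rho> \<alpha>)"
          unfolding t(2) torus_act_def by (rule ln_mult_pos[OF P pos(1)[OF True]])
        then show ?thesis
          using True ln_act[OF t(1)] by (simp add: log_on_def)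
      qed (simp add: log_on_def)
    qed
    then show "log_on J \<rho>' - log_on J \<rho> \<in> {\<lambda>\<alpha>. if \<alpha> \<in> J then \<Sum>i=1..n. c i * real (\<alpha> i) else 0 | c. True}"
      by (intro CollectI exI[of _ "\<lambda>i. ln (t i)"] conjI TrueI)
  next
    assume "log_on J \<rho>' - log_on J \<rho> \<in> {\<lambda>\<alpha>. if \<alpha> \<in> J then \<Sum>i=1..n. c i * real (\<alpha> i) else 0 | c. True}"
    then obtain c where c: "log_on J \<rho>' - log_on J \<rho> = (\<lambda>\<alpha>. if \<alpha> \<in> J then \<Sum>i=1..n. c i * real (\<alpha> i) else 0)"
      by blast
    define t where "t i = exp (c i)" for i
    have t: "\<forall>i\<in>{1..n}. t i > 0"
      by (simp add: t_def)
    have "\<rho>' = torus_act n t \<rho>"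
    proof
      fix \<alpha>
      show "\<rho>' \<alpha> = torus_act n t \<rho> \<alpha>"
      proof (cases "\<alpha> \<in> J")
        case True
        have P: "0 < (\<Prod>i=1..n. t i ^ \<alpha> i)"
          by (intro prod_pos) (simp add: t_def)
        have "ln (\<rho>' \<alpha>) - ln (\<rho> \<alpha>) = (\<Sum>i=1..n. c i * real (\<alpha> i))"
          using fun_cong[OF c, of \<alpha>] True by (simp add: log_on_def)
        also have "\<dots> = ln (\<Prod>i=1..n. t i ^ \<alpha> i)"
          unfolding ln_act[OF t] by (simp add: t_def)
        finally have "ln (\<rho>' \<alpha>) = ln (\<Prod>i=1..n. t i ^ \<alpha> i) + ln (\<rho> \<alpha>)"
          by simp
        also have "\<dots> = ln (torus_act n t \<rho> \<alpha>)"
          unfolding torus_act_def by (rule ln_mult_pos[OF P pos(1)[OF True], symmetric])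
        finally show ?thesis
          using pos[OF True] P by (simp add: torus_act_def)
      qed (simp add: off torus_act_def)
    qed
    then show "\<exists>t. (\<forall>i\<in>{1..n}. t i > 0) \<and> \<rho>' = torus_act n t \<rho>"
      using t by blast
  qed
qed

lemma subspace_W_space: "subspace (W_space n J)"
  unfolding W_space_def by (rule subspace_span)

lemma coset_eq_iff:
  assumes W: "subspace W"
  shows "coset W x = coset W y \<longleftrightarrow> x - y \<in> W"
proof
  assume "coset W x = coset W y"
  moreover have "x \<in> coset W x"
    unfolding coset_def using subspace_0[OF W] by (rule rev_image_eqI) simp
  ultimately obtain w where "w \<in> W" "x = y + w"
    unfolding coset_def by blast
  then show "x - y \<in> W"
    by simp
next
  assume xy: "x - y \<in> W"
  show "coset W x = coset W y"
  proof (intro equalityI subsetI)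
    fix z assume "z \<in> coset W x"
    then obtain w where w: "w \<in> W" "z = x + w"
      unfolding coset_def by blast
    have "z = y + ((x - y) + w)"
      using w(2) by simp
    then show "z \<in> coset W y"
      unfolding coset_def using subspace_add[OF W xy w(1)] by blast
  next
    fix z assume "z \<in> coset W y"
    then obtain w where w: "w \<in> W" "z = y + w"
      unfolding coset_def by blast
    have "z = x + (w - (x - y))"
      using w(2) by simp
    then show "z \<in> coset W x"
      unfolding coset_def using subspace_diff[OF W w(1) xy] by blast
  qed
qed

context M_convex_set
begin

lemma V_space_eq: "V_space n d J =
    {v. (\<forall>\<alpha>. \<alpha> \<notin> J \<longrightarrow> v \<alpha> = 0) \<and> (\<forall>r\<in>pluecker_family n d J {2..d}. log_null \<infinity> r v)}"
  unfolding V_space_def strong_reps_eq log_reps ..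

text \<open>At q = \<infinity> only the two-term relations constrain, and they are linear
  equations.\<close>

lemma subspace_V_space: "subspace (V_space n d J)"
proof -
  have inf: "log_null \<infinity> r v \<longleftrightarrow>
      (card (fst r) = 2 \<longrightarrow> (\<forall>k\<in>fst r. \<forall>l\<in>fst r. log_term v r k = log_term v r l))"
    if "r \<in> pluecker_family n d J {2..d}" for r v
    by (rule log_null_infinity[OF finite_fst_pluecker_family[OF that] card_fst_pluecker_family[OF that]])
  have lin: "log_term 0 r k = 0" "log_term (x + y) r k = log_term x r k + log_term y r k"
    "log_term (c *\<^sub>R x) r k = c * log_term x r k" for x y :: "(nat \<Rightarrow> nat) \<Rightarrow> real" and r k c
    by (simp_all add: log_term_def distrib_left)
  define V where "V = {v. (\<forall>\<alpha>. \<alpha> \<notin> J \<longrightarrow> v \<alpha> = 0) \<and> (\<forall>r\<in>pluecker_family n d J {2..d}.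
      card (fst r) = 2 \<longrightarrow> (\<forall>k\<in>fst r. \<forall>l\<in>fst r. log_term v r k = log_term v r l))}"
  have "V_space n d J = V"
    unfolding V_space_eq V_def by (intro Collect_cong conj_cong ball_cong refl inf)
  moreover have "subspace V"
  proof (rule subspaceI)
    show "0 \<in> V"
      by (simp add: V_def lin)
    fix x y :: "(nat \<Rightarrow> nat) \<Rightarrow> real" and c :: real
    assume x: "x \<in> V"
    show "c *\<^sub>R x \<in> V"
      unfolding V_def
    proof (intro CollectI conjI allI ballI impI)
      show "(c *\<^sub>R x) \<alpha> = 0" if "\<alpha> \<notin> J" for \<alpha>
        using x that by (simp add: V_def)
      fix r k l assume "r \<in> pluecker_family n d J {2..d}" "card (fst r) = 2" "k \<in> fst r" "l \<in> fst r"
      then have "log_term x r k = log_term x r l"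
        using x unfolding V_def by blast
      then show "log_term (c *\<^sub>R x) r k = log_term (c *\<^sub>R x) r l"
        by (simp only: lin)
    qed
    assume y: "y \<in> V"
    show "x + y \<in> V"
      unfolding V_def
    proof (intro CollectI conjI allI ballI impI)
      show "(x + y) \<alpha> = 0" if "\<alpha> \<notin> J" for \<alpha>
        using x y that by (simp add: V_def)
      fix r k l assume "r \<in> pluecker_family n d J {2..d}" "card (fst r) = 2" "k \<in> fst r" "l \<in> fst r"
      then have "log_term x r k = log_term x r l" "log_term y r k = log_term y r l"
        using x y unfolding V_def by blast+
      then show "log_term (x + y) r k = log_term (x + y) r l"
        by (simp only: lin)
    qed
  qed
  ultimately show ?thesis
    by simp
qed

lemma W_space_subset_V_space: "W_space n J \<subseteq> V_space n d J"
proof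
  fix w assume w: "w \<in> W_space n J"
  have "log_null \<infinity> r w" if r: "r \<in> pluecker_family n d J {2..d}" for r
    unfolding log_null_infinity[OF finite_fst_pluecker_family[OF r] card_fst_pluecker_family[OF r]]
    using log_term_W_space[OF w r] by blast
  moreover have "w \<alpha> = 0" if "\<alpha> \<notin> J" for \<alpha>
    using w that unfolding W_space_iff by auto
  ultimately show "w \<in> V_space n d J"
    unfolding V_space_eq by blast
qed

lemma log_null_W_space:
  assumes r: "r \<in> pluecker_family n d J D" and w: "v' - v \<in> W_space n J"
  shows "log_null q r v' \<longleftrightarrow> log_null q r v"
proof -
  have "log_null q r (v + (v' - v)) \<longleftrightarrow> log_null q r v"
    by (rule log_null_shift[OF finite_fst_pluecker_family[OF r] card_fst_pluecker_family[OF r]])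
      (rule log_term_W_space[OF w r])
  then show ?thesis
    by simp
qed

end

text \<open>The triangle inequality over the standard basis bounds \<open>N\<close> by a weighted l1
  norm, so \<open>N\<close> is Lipschitz for it. This makes an arbitrary norm compatible with the
  product topology.\<close>

lemma norm_continuous_on_coord_space:
  fixes N :: "(nat \<Rightarrow> real) \<Rightarrow> real"
  assumes nonneg: "\<And>x. x \<in> coord_space m \<Longrightarrow> 0 \<le> N x"
    and scale: "\<And>x c. x \<in> coord_space m \<Longrightarrow> N (c *\<^sub>R x) = \<bar>c\<bar> * N x"
    and add: "\<And>x y. x \<in> coord_space m \<Longrightarrow> y \<in> coord_space m \<Longrightarrow> N (x + y) \<le> N x + N y"
  shows "continuous_on (coord_space m) N"
proof -
  define b :: "nat \<Rightarrow> nat \<Rightarrow> real" where "b i = (\<lambda>k. if k = i then 1 else 0)" for i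
  define K where "K x y = (\<Sum>i<m. \<bar>x i - y i\<bar> * N (b i))" for x y :: "nat \<Rightarrow> real"
  have b: "b i \<in> coord_space m" if "i < m" for i
    using that by (simp add: b_def coord_space_def)
  have N0: "N 0 = 0"
    using scale[OF zero_in_coord_space[of m], of 0] by simp
  have sum_bound: "N (\<Sum>i\<in>A. c i *\<^sub>R b i) \<le> (\<Sum>i\<in>A. \<bar>c i\<bar> * N (b i))"
    if "A \<subseteq> {..<m}" "finite A" for A and c :: "nat \<Rightarrow> real"
    using that(2,1)
  proof (induction A rule: finite_induct)
    case (insert i A)
    have i: "c i *\<^sub>R b i \<in> coord_space m"
      using insert.prems b by (simp add: scaleR_in_coord_space)
    have s: "(\<Sum>i\<in>A. c i *\<^sub>R b i) \<in> coord_space m"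
    proof -
      have "(\<Sum>i\<in>A. c i *\<^sub>R b i) k = 0" if "m \<le> k" for k
        unfolding sum_fun_apply using insert.prems that by (intro sum.neutral) (auto simp: b_def)
      then show ?thesis
        by (simp add: coord_space_def)
    qed
    have "N (\<Sum>i\<in>insert i A. c i *\<^sub>R b i) \<le> N (c i *\<^sub>R b i) + N (\<Sum>i\<in>A. c i *\<^sub>R b i)"
      unfolding sum.insert[OF insert.hyps] by (rule add[OF i s])
    also have "\<dots> \<le> \<bar>c i\<bar> * N (b i) + (\<Sum>i\<in>A. \<bar>c i\<bar> * N (b i))"
    proof -
      have "N (\<Sum>i\<in>A. c i *\<^sub>R b i) \<le> (\<Sum>i\<in>A. \<bar>c i\<bar> * N (b i))"
        by (rule insert.IH) (use insert.prems in blast)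
      moreover have "N (c i *\<^sub>R b i) = \<bar>c i\<bar> * N (b i)"
        by (rule scale[OF b]) (use insert.prems in blast)
      ultimately show ?thesis
        by linarith
    qed
    finally show ?case
      by (simp only: sum.insert[OF insert.hyps])
  qed (simp add: N0)
  have bound: "N x \<le> (\<Sum>i<m. \<bar>x i\<bar> * N (b i))" if "x \<in> coord_space m" for x
  proof -
    have "(\<Sum>i<m. x i *\<^sub>R b i) k = x k" for k
    proof -
      have "(\<Sum>i<m. x i *\<^sub>R b i) k = (\<Sum>i<m. if i = k then x i else 0)"
        unfolding sum_fun_apply by (intro sum.cong) (auto simp: b_def)
      then show ?thesis
        using that by (simp add: coord_space_def)
    qed
    then have "(\<Sum>i<m. x i *\<^sub>R b i) = x"
      by (rule ext)
    then show ?thesis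
      using sum_bound[of "{..<m}" x] by simp
  qed
  have half: "N y - N x \<le> K y x" if "x \<in> coord_space m" "y \<in> coord_space m" for x y
  proof -
    have "y - x \<in> coord_space m"
      using that by (simp add: coord_space_def)
    then have "N y \<le> N x + N (y - x)" "N (y - x) \<le> K y x"
      using add[of x "y - x"] bound[of "y - x"] that by (simp_all add: K_def)
    then show ?thesis
      by simp
  qed
  have lip: "\<bar>N y - N x\<bar> \<le> K y x" if "x \<in> coord_space m" "y \<in> coord_space m" for x y
  proof -
    have "K x y = K y x"
      by (simp add: K_def abs_minus_commute)
    then show ?thesis
      using half[OF that] half[OF that(2,1)] by simp
  qed
  show ?thesis
    unfolding continuous_on_def
  proof
    fix x assume x: "x \<in> coord_space m"
    have "continuous_on UNIV (\<lambda>y. K y x)"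
      unfolding K_def
      by (intro continuous_on_sum continuous_on_mult continuous_on_rabs continuous_on_diff
          continuous_on_const continuous_on_coordinate)
    then have "((\<lambda>y. K y x) \<longlongrightarrow> K x x) (at x within coord_space m)"
      by (meson UNIV_I continuous_on_def subset_UNIV tendsto_within_subset)
    moreover have "K x x = 0"
      by (simp add: K_def)
    ultimately have lim: "((\<lambda>y. K y x) \<longlongrightarrow> 0) (at x within coord_space m)"
      by simp
    have "((\<lambda>y. N y - N x) \<longlongrightarrow> 0) (at x within coord_space m)"
    proof (rule Lim_null_comparison[OF _ lim])
      show "\<forall>\<^sub>F y in at x within coord_space m. norm (N y - N x) \<le> K y x"
        using lip[OF x] by (auto simp: eventually_at_filter)
    qed
    then show "(N \<longlongrightarrow> N x) (at x within coord_space m)"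
      by (rule LIM_zero_cancel)
  qed
qed

text \<open>Points with \<open>N x < 1\<close> are interior by continuity; a point with
  \<open>N x = 1\<close> leaves the ball when scaled by \<open>1 + e / 2\<close>, for arbitrarily
  small \<open>e\<close>.\<close>

lemma frontier_of_norm_ball:
  assumes N: "homogeneous_on (coord_space m) N" "continuous_on (coord_space m) N"
  shows "top_of_set (coord_space m) frontier_of {x \<in> coord_space m. N x \<le> 1}
    = {x \<in> coord_space m. N x = 1}"
proof -
  let ?E = "coord_space m" and ?B = "{x \<in> coord_space m. N x \<le> 1}"
  have "closedin (top_of_set ?E) (?E \<inter> N -` {..1})"
    by (rule continuous_closedin_preimage[OF N(2)]) simp
  moreover have "?E \<inter> N -` {..1} = ?B"
    by auto
  ultimately have closure: "top_of_set ?E closure_of ?B = ?B"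
    by (simp add: closure_of_eq)
  have "openin (top_of_set ?E) (?E \<inter> N -` {..<1})"
    by (rule continuous_openin_preimage_gen[OF N(2)]) simp
  then have inner: "?E \<inter> N -` {..<1} \<subseteq> top_of_set ?E interior_of ?B"
    by (rule interior_of_maximal[rotated]) auto
  have outer: "x \<notin> top_of_set ?E interior_of ?B" if x: "x \<in> ?E" "N x = 1" for x
  proof
    assume "x \<in> top_of_set ?E interior_of ?B"
    then obtain T where T: "openin (top_of_set ?E) T" "x \<in> T" "T \<subseteq> ?B"
      by (auto simp: interior_of_def)
    then obtain T' where T': "open T'" "T = ?E \<inter> T'"
      by (auto simp: openin_open)
    have "continuous_on UNIV (\<lambda>t. t *\<^sub>R x)"
      by (intro continuous_on_scaleR_fun continuous_on_id continuous_on_const)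
    then have "open ((\<lambda>t. t *\<^sub>R x) -` T')"
      using T'(1) by (simp add: open_vimage)
    moreover have "1 \<in> (\<lambda>t. t *\<^sub>R x) -` T'"
      using T(2) T'(2) by simp
    ultimately obtain e where e: "0 < e" "ball 1 e \<subseteq> (\<lambda>t. t *\<^sub>R x) -` T'"
      using openE by blast
    have "1 + e / 2 \<in> ball 1 e"
      using e(1) by (simp add: dist_real_def)
    then have "(1 + e / 2) *\<^sub>R x \<in> T'"
      using e(2) by blast
    then have "(1 + e / 2) *\<^sub>R x \<in> ?B"
      using T(3) T'(2) scaleR_in_coord_space[OF x(1)] by blast
    moreover have "N ((1 + e / 2) *\<^sub>R x) = (1 + e / 2) * N x"
      using N(1) x(1) e(1) unfolding homogeneous_on_def by (meson add_nonneg_nonneg half_gt_zero less_eq_real_def zero_le_one)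
    ultimately show False
      using e(1) x(2) by simp
  qed
  show ?thesis
    unfolding frontier_of_def closure
  proof (intro equalityI subsetI)
    fix x assume "x \<in> ?B - top_of_set ?E interior_of ?B"
    then show "x \<in> {x \<in> ?E. N x = 1}"
      using inner by force
  qed (use outer in auto)
qed

context M_convex_set
begin

text \<open>The set \<open>D\<close> of relation lengths influences the gauge, but
  \<open>inf\<close> ensures that the same \<open>V\<close> contains the logarithms and
  \<open>zero\<close> that the gauge vanishes on the same set. Weak and strong spaces are thus
  treated at once.\<close>

lemma realization_space:
  assumes D: "D \<subseteq> {2..d}" and zero: "reps n d J D 0 = reps n d J {2..d} 0"
    and inf: "reps n d J D \<infinity> = reps n d J {2..d} \<infinity>" and q: "0 < q" "q < \<infinity>"
    and \<pi>: "linear \<pi>" "continuous_on (V_space n d J) \<pi>" and \<sigma>: "linear \<sigma>" "continuous_on UNIV \<sigma>"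
    and \<sigma>_V: "\<And>x. \<sigma> x \<in> V_space n d J" and \<pi>_coord: "\<And>v. \<pi> v \<in> coord_space m"
    and \<pi>\<sigma>: "\<And>x. x \<in> coord_space m \<Longrightarrow> \<pi> (\<sigma> x) = x"
    and \<sigma>\<pi>: "\<And>v. v \<in> V_space n d J \<Longrightarrow> v - \<sigma> (\<pi> v) \<in> W_space n J"
    and \<pi>_W: "\<And>w. w \<in> W_space n J \<Longrightarrow> \<pi> w = 0"
  shows "\<exists>g. homogeneous_on (coord_space m) g \<and> continuous_on (coord_space m) g \<and>
    quotient_topology (top_of_set (reps n d J D q)) (torus_orbit n) homeomorphic_space
      top_of_set {x \<in> coord_space m. g x \<le> 1} \<and>
    (\<forall>x\<in>coord_space m. g x = 0 \<longleftrightarrow> \<sigma> x \<in> log_on J ` strong_reps n d J 0)"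
proof -
  define R where "R = pluecker_family n d J D"
  have R: "finite R" "\<And>r. r \<in> R \<Longrightarrow> finite (fst r)" "\<And>r. r \<in> R \<Longrightarrow> card (fst r) \<noteq> 1"
  proof -
    have "D \<subseteq> {..d}"
      using D by auto
    then show "finite R"
      unfolding R_def by (rule finite_pluecker_family[OF finite_J])
    show "finite (fst r)" "card (fst r) \<noteq> 1" if "r \<in> R" for r
      using that unfolding R_def by (rule finite_fst_pluecker_family, rule card_fst_pluecker_family)
  qed
  have V: "V_space n d J = {v. (\<forall>\<alpha>. \<alpha> \<notin> J \<longrightarrow> v \<alpha> = 0) \<and> (\<forall>r\<in>R. log_null \<infinity> r v)}"
    unfolding V_space_def strong_reps_eq inf[symmetric] log_reps R_def ..
  have \<sigma>_off: "\<sigma> x \<alpha> = 0" if "\<alpha> \<notin> J" for x \<alpha>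
    using \<sigma>_V[of x] that unfolding V by blast
  have \<sigma>_inf: "log_null \<infinity> r (\<sigma> x)" if "r \<in> R" for r x
    using \<sigma>_V[of x] that unfolding V by blast
  obtain g where g: "homogeneous_on (coord_space m) g" "continuous_on (coord_space m) g"
    "{x \<in> coord_space m. \<forall>r\<in>R. log_null q r (\<sigma> x)} = {x \<in> coord_space m. g x \<le> 1}"
    and g0: "\<And>x. x \<in> coord_space m \<Longrightarrow> g x = 0 \<longleftrightarrow> (\<forall>r\<in>R. log_null 0 r (\<sigma> x))"
    using relation_gauge[OF R \<sigma> \<sigma>_inf q, where m = m] by blast
  define Y where "Y = {x \<in> coord_space m. \<forall>r\<in>R. log_null q r (\<sigma> x)}"
  \<comment> \<open>In a relation with two nonzero terms, nullity at finite q is an inequality in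
    both directions, hence the equation that defines \<open>V\<close>.\<close>
  have reps_V: "log_on J \<rho> \<in> V_space n d J" if \<rho>: "\<rho> \<in> reps n d J D q" for \<rho>
  proof -
    have "log_null \<infinity> r (log_on J \<rho>)" if r: "r \<in> R" for r
      unfolding log_null_infinity[OF R(2,3)[OF r]]
    proof (intro impI ballI)
      fix k l assume "card (fst r) = 2" and kl: "k \<in> fst r" "l \<in> fst r"
      then obtain a b where ab: "fst r = {a, b}" "a \<noteq> b"
        by (auto simp: card_2_iff)
      have "log_null q r (log_on J \<rho>)"
        using \<rho> r by (simp add: reps_iff R_def)
      moreover have "0 < enn2real q"
        using q by (simp add: enn2real_positive_iff)
      moreover have "{a, b} - {a} = {b}" "{a, b} - {b} = {a}"
        using ab(2) by auto
      ultimately have "log_term (log_on J \<rho>) r a = log_term (log_on J \<rho>) r b"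
        unfolding log_null_finite[OF q] ab(1) by (auto simp: divide_le_cancel)
      then show "log_term (log_on J \<rho>) r k = log_term (log_on J \<rho>) r l"
        using kl ab(1) by auto
    qed
    then show ?thesis
      unfolding V by (simp add: log_on_def)
  qed
  have shift: "log_null q' r (\<sigma> (\<pi> v)) \<longleftrightarrow> log_null q' r v" if "v \<in> V_space n d J" "r \<in> R" for q' r v
    using log_null_W_space[OF that(2)[unfolded R_def] \<sigma>\<pi>[OF that(1)]] by blast
  have "homeomorphic_map (top_of_set Y) (quotient_topology (top_of_set (reps n d J D q)) (torus_orbit n))
      (torus_orbit n \<circ> (exp_on J \<circ> \<sigma>))"
  proof (rule homeomorphic_map_quotient_section)
    \<comment> \<open>Logarithm followed by \<open>\<pi>\<close> is the projection;
      \<open>\<sigma>\<close> followed by the exponential is its section. Nullity survives the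
      passage to \<open>\<sigma> (\<pi> v)\<close> by \<open>shift\<close>, and the fibers are torus
      orbits because the orbit relation is translation by \<open>W\<close>.\<close>
    let ?p = "\<pi> \<circ> log_on J"
    have "continuous_on (reps n d J D q) (log_on J)"
    proof (rule continuous_on_coordinatewise_then_product)
      fix \<alpha>
      show "continuous_on (reps n d J D q) (\<lambda>\<rho>. log_on J \<rho> \<alpha>)"
      proof (cases "\<alpha> \<in> J")
        case True
        then have "\<rho> \<alpha> \<noteq> 0" if "\<rho> \<in> reps n d J D q" for \<rho>
          using that by (auto simp: reps_def)
        then have "continuous_on (reps n d J D q) (\<lambda>\<rho>. ln (\<rho> \<alpha>))"
          by (intro continuous_on_ln continuous_on_coordinate) auto
        then show ?thesis
          using True by (simp add: log_on_def)
      qed (simp add: log_on_def)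
    qed
    moreover have "log_on J ` reps n d J D q \<subseteq> V_space n d J"
      using reps_V by blast
    ultimately have "continuous_on (reps n d J D q) ?p"
      using continuous_on_compose continuous_on_subset[OF \<pi>(2)] by blast
    moreover have "?p \<rho> \<in> Y" if \<rho>: "\<rho> \<in> reps n d J D q" for \<rho>
    proof -
      have "log_null q r (\<sigma> (\<pi> (log_on J \<rho>)))" if "r \<in> R" for r
        unfolding shift[OF reps_V[OF \<rho>] that] using \<rho> that by (simp add: reps_iff R_def)
      then show ?thesis
        using \<pi>_coord by (simp add: Y_def)
    qed
    ultimately show "continuous_map (top_of_set (reps n d J D q)) (top_of_set Y) ?p"
      by (auto simp: continuous_map_in_subtopology)
    have "continuous_on Y (exp_on J \<circ> \<sigma>)"
    proof (rule continuous_on_coordinatewise_then_product)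
      fix \<alpha>
      have "continuous_on Y (\<lambda>x. \<sigma> x \<alpha>)"
        by (rule continuous_on_product_then_coordinatewise[OF continuous_on_subset[OF \<sigma>(2) subset_UNIV]])
      then show "continuous_on Y (\<lambda>x. (exp_on J \<circ> \<sigma>) x \<alpha>)"
        by (cases "\<alpha> \<in> J") (simp_all add: exp_on_def continuous_on_exp)
    qed
    moreover have "(exp_on J \<circ> \<sigma>) x \<in> reps n d J D q" if "x \<in> Y" for x
      using exp_on_reps[of J "\<sigma> x"] \<sigma>_off that by (simp add: Y_def R_def)
    ultimately show "continuous_map (top_of_set Y) (top_of_set (reps n d J D q)) (exp_on J \<circ> \<sigma>)"
      by (auto simp: continuous_map_in_subtopology)
    show "?p ((exp_on J \<circ> \<sigma>) x) = x" if "x \<in> topspace (top_of_set Y)" for x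
    proof -
      have "log_on J (exp_on J (\<sigma> x)) = \<sigma> x"
        by (rule log_exp_on[OF \<sigma>_off])
      then show ?thesis
        using that \<pi>\<sigma> by (simp add: Y_def)
    qed
    fix \<rho> \<rho>' assume "\<rho> \<in> topspace (top_of_set (reps n d J D q))" "\<rho>' \<in> topspace (top_of_set (reps n d J D q))"
    then have \<rho>: "\<rho> \<in> reps n d J D q" "\<rho>' \<in> reps n d J D q"
      by simp_all
    let ?v = "log_on J \<rho>" and ?v' = "log_on J \<rho>'"
    have "torus_orbit n \<rho> = torus_orbit n \<rho>' \<longleftrightarrow> ?v' - ?v \<in> W_space n J"
      using \<rho> by (intro torus_orbit_eq_iff) (auto simp: reps_def)
    also have "\<dots> \<longleftrightarrow> \<pi> ?v = \<pi> ?v'"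
    proof
      assume "?v' - ?v \<in> W_space n J"
      then have "\<pi> (?v' - ?v) = 0"
        by (rule \<pi>_W)
      then show "\<pi> ?v = \<pi> ?v'"
        by (simp add: linear_diff[OF \<pi>(1)])
    next
      assume eq: "\<pi> ?v = \<pi> ?v'"
      have "(?v' - \<sigma> (\<pi> ?v')) - (?v - \<sigma> (\<pi> ?v)) \<in> W_space n J"
        using \<rho> by (intro subspace_diff subspace_W_space \<sigma>\<pi> reps_V)
      then show "?v' - ?v \<in> W_space n J"
        unfolding eq by simp
    qed
    finally show "torus_orbit n \<rho> = torus_orbit n \<rho>' \<longleftrightarrow> ?p \<rho> = ?p \<rho>'"
      by simp
  qed
  then have "quotient_topology (top_of_set (reps n d J D q)) (torus_orbit n) homeomorphic_space
      top_of_set {x \<in> coord_space m. g x \<le> 1}"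
    using homeomorphic_map_imp_homeomorphic_space homeomorphic_space_sym unfolding Y_def g(3) by blast
  moreover have "g x = 0 \<longleftrightarrow> \<sigma> x \<in> log_on J ` strong_reps n d J 0" if "x \<in> coord_space m" for x
    unfolding g0[OF that] strong_reps_eq zero[symmetric] log_reps R_def[symmetric] using \<sigma>_off by blast
  ultimately show ?thesis
    using g(1,2) by blast
qed

end

theorem theorem3p26:
  fixes n d :: nat
    and J :: "(nat \<Rightarrow> nat) set"
    and q :: ennreal
    and N :: "((nat \<Rightarrow> nat) \<Rightarrow> real) set \<Rightarrow> real"
    and B X :: "((nat \<Rightarrow> nat) \<Rightarrow> real) set set"
  assumes "M_convex n d J"
    and "0 < q" and "q < \<infinity>"
    and "norm_on_quotient (V_space n d J) (W_space n J) N"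
    and "B = {v \<in> topspace (VW_topology n d J). N v \<le> 1}"
    and "X = B - (reduced_Dressian n d J \<inter> (VW_topology n d J frontier_of B))"
  shows "reduced_Gr n d J q homeomorphic_space subtopology (VW_topology n d J) X \<and>
    weak_reduced_Gr n d J q homeomorphic_space subtopology (VW_topology n d J) X \<and>
    (\<exists>m. manifold_with_boundary m (reduced_Gr n d J q) \<and>
         manifold_with_boundary m (weak_reduced_Gr n d J q) \<and>
         compactifies_to (reduced_Gr n d J q) (closed_ball m) \<and>
         compactifies_to (weak_reduced_Gr n d J q) (closed_ball m))"
proof -
  interpret M_convex_set n d J
    using assms(1) by unfold_locales
  let ?V = "V_space n d J" and ?W = "W_space n J"
  have V: "subspace ?V" and W: "subspace ?W" "?W \<subseteq> ?V"
    by (rule subspace_V_space, rule subspace_W_space, rule W_space_subset_V_space)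
  have V_off: "\<forall>v\<in>?V. \<forall>a. a \<notin> J \<longrightarrow> v a = 0"
    unfolding V_space_eq by blast
  obtain m \<pi> \<sigma> where \<pi>: "linear \<pi>" and \<sigma>: "linear \<sigma>" and \<pi>_cont: "continuous_on ?V \<pi>"
    and \<sigma>_cont: "continuous_on UNIV \<sigma>" and \<sigma>_V: "\<And>x. \<sigma> x \<in> ?V"
    and \<pi>_coord: "\<And>v. \<pi> v \<in> coord_space m" and \<pi>\<sigma>: "\<And>x. x \<in> coord_space m \<Longrightarrow> \<pi> (\<sigma> x) = x"
    and \<sigma>\<pi>: "\<And>v. v \<in> ?V \<Longrightarrow> v - \<sigma> (\<pi> v) \<in> ?W" and \<pi>_W: "\<And>w. w \<in> ?W \<Longrightarrow> \<pi> w = 0"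
  proof (rule quotient_coordinates[OF finite_J V_off V W], goal_cases)
    case (1 m \<pi> \<sigma>)
    show ?case
      by (rule that[of \<pi> \<sigma> m]) (fact 1)+
  qed
  let ?E = "coord_space m"
  define L where "L = log_on J ` strong_reps n d J 0"
  have realization: "\<exists>g. homogeneous_on ?E g \<and> continuous_on ?E g \<and>
      quotient_topology (top_of_set (reps n d J D q)) (torus_orbit n) homeomorphic_space
        top_of_set {x \<in> ?E. g x \<le> 1} \<and> (\<forall>x\<in>?E. g x = 0 \<longleftrightarrow> \<sigma> x \<in> L)"
    if "D \<subseteq> {2..d}" "reps n d J D 0 = reps n d J {2..d} 0"
      "reps n d J D \<infinity> = reps n d J {2..d} \<infinity>" for D
    unfolding L_def
    by (rule realization_space[where \<pi> = \<pi> and \<sigma> = \<sigma>])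
      (fact that assms \<pi> \<pi>_cont \<sigma> \<sigma>_cont \<sigma>_V \<pi>_coord \<pi>\<sigma> \<sigma>\<pi> \<pi>_W)+
  obtain g where g: "homogeneous_on ?E g" "continuous_on ?E g"
    "reduced_Gr n d J q homeomorphic_space top_of_set {x \<in> ?E. g x \<le> 1}"
    and g0: "\<And>x. x \<in> ?E \<Longrightarrow> g x = 0 \<longleftrightarrow> \<sigma> x \<in> L"
    using realization[OF order_refl refl refl] unfolding reduced_Gr_def strong_reps_eq by blast
  \<comment> \<open>The only input specific to weak representations: agreement with the strong ones
    at the two extreme values of q.\<close>
  have weak: "reps n d J ({2} \<inter> {2..d}) 0 = reps n d J {2..d} 0"
    "reps n d J ({2} \<inter> {2..d}) \<infinity> = reps n d J {2..d} \<infinity>"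
    using weak_reps_eq_strong_reps[OF assms(1)] unfolding weak_reps_eq strong_reps_eq by simp_all
  obtain h where h: "homogeneous_on ?E h" "continuous_on ?E h"
    "weak_reduced_Gr n d J q homeomorphic_space top_of_set {x \<in> ?E. h x \<le> 1}"
    and h0: "\<And>x. x \<in> ?E \<Longrightarrow> h x = 0 \<longleftrightarrow> \<sigma> x \<in> L"
    using realization[OF Int_lower2 weak] unfolding weak_reduced_Gr_def weak_reps_eq by blast

  \<comment> \<open>The linear chart of V/W, obtained from the same \<open>\<sigma>\<close> as the
    coordinates on the realization spaces.\<close>
  define c where "c = coset ?W \<circ> \<sigma>"
  have c: "homeomorphic_map (top_of_set ?E) (VW_topology n d J) c"
    unfolding c_def VW_topology_def
  proof (rule homeomorphic_map_quotient_section)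
    show "continuous_map (top_of_set ?V) (top_of_set ?E) \<pi>"
      using \<pi>_cont \<pi>_coord by (auto simp: continuous_map_in_subtopology)
    show "continuous_map (top_of_set ?E) (top_of_set ?V) \<sigma>"
      using continuous_on_subset[OF \<sigma>_cont subset_UNIV] \<sigma>_V by (auto simp: continuous_map_in_subtopology)
    show "\<pi> (\<sigma> x) = x" if "x \<in> topspace (top_of_set ?E)" for x
      using that \<pi>\<sigma> by simp
    fix v v' assume "v \<in> topspace (top_of_set ?V)" "v' \<in> topspace (top_of_set ?V)"
    then have v: "v \<in> ?V" "v' \<in> ?V"
      by simp_all
    show "coset ?W v = coset ?W v' \<longleftrightarrow> \<pi> v = \<pi> v'"
      unfolding coset_eq_iff[OF W(1)]
    proof
      assume "v - v' \<in> ?W"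
      then have "\<pi> (v - v') = 0"
        by (rule \<pi>_W)
      then show "\<pi> v = \<pi> v'"
        by (simp add: linear_diff[OF \<pi>])
    next
      assume eq: "\<pi> v = \<pi> v'"
      have "(v - \<sigma> (\<pi> v)) - (v' - \<sigma> (\<pi> v')) \<in> ?W"
        using v by (intro subspace_diff[OF W(1)] \<sigma>\<pi>)
      then show "v - v' \<in> ?W"
        unfolding eq by simp
    qed
  qed
  have c_top: "topspace (VW_topology n d J) = c ` ?E"
    using homeomorphic_imp_surjective_map[OF c] by simp
  have c_inj: "inj_on c ?E"
    using homeomorphic_imp_injective_map[OF c] by simp

  \<comment> \<open>The given norm pulled back to coordinates; its continuity is what identifies the
    topological frontier of \<open>B\<close> with the unit sphere.\<close>
  define M where "M x = N (c x)" for x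
  have M_nonneg: "0 \<le> M x" and M_zero: "M x = 0 \<longleftrightarrow> coset ?W (\<sigma> x) = coset ?W 0" for x
    using assms(4) \<sigma>_V[of x] unfolding norm_on_quotient_def M_def c_def comp_apply by blast+
  have M_scale: "M (t *\<^sub>R x) = \<bar>t\<bar> * M x" for t x
  proof -
    have "N (coset ?W (t *\<^sub>R \<sigma> x)) = \<bar>t\<bar> * N (coset ?W (\<sigma> x))"
      using assms(4) \<sigma>_V[of x] unfolding norm_on_quotient_def by blast
    then show ?thesis
      by (simp add: M_def c_def linear_cmul[OF \<sigma>])
  qed
  have M_add: "M (x + y) \<le> M x + M y" for x y
  proof -
    have "N (coset ?W (\<sigma> x + \<sigma> y)) \<le> N (coset ?W (\<sigma> x)) + N (coset ?W (\<sigma> y))"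
      using assms(4) \<sigma>_V[of x] \<sigma>_V[of y] unfolding norm_on_quotient_def by blast
    then show ?thesis
      by (simp add: M_def c_def linear_add[OF \<sigma>])
  qed
  have M: "homogeneous_on ?E M" "continuous_on ?E M"
    using M_nonneg M_scale M_add by (simp add: homogeneous_on_def, intro norm_continuous_on_coord_space)
  have M_definite: "x = 0" if "x \<in> ?E" "M x = 0" for x
  proof -
    have "\<sigma> x \<in> ?W"
      using that(2) unfolding M_zero coset_eq_iff[OF W(1)] by simp
    then show ?thesis
      using \<pi>_W \<pi>\<sigma>[OF that(1)] by metis
  qed

  define X' where "X' = {x \<in> ?E. M x \<le> 1 \<and> \<not> (M x = 1 \<and> g x = 0)}"
  have "B = c ` {x \<in> ?E. M x \<le> 1}"
    unfolding assms(5) c_top M_def by blast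
  moreover from this have "VW_topology n d J frontier_of B = c ` {x \<in> ?E. M x = 1}"
    using homeomorphic_map_frontier_of[OF c, of "{x \<in> ?E. M x \<le> 1}"] frontier_of_norm_ball[OF M] by auto
  moreover have "reduced_Dressian n d J = c ` {x \<in> ?E. g x = 0}"
  proof -
    \<comment> \<open>A list that is null at 0 is null at \<infinity>, so \<open>L\<close> lies in
      \<open>V\<close> and \<open>\<pi>\<close> applies. The representative
      \<open>\<sigma> (\<pi> v)\<close> differs from \<open>v\<close> by an element of
      \<open>W\<close>, which leaves nullity unchanged.\<close>
    have "\<sigma> (\<pi> v) \<in> L" "coset ?W v = c (\<pi> v)" if "v \<in> L" for v
    proof -
      have L: "L = {v. (\<forall>\<alpha>. \<alpha> \<notin> J \<longrightarrow> v \<alpha> = 0) \<and> (\<forall>r\<in>pluecker_family n d J {2..d}. log_null 0 r v)}"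
        unfolding L_def strong_reps_eq log_reps ..
      have v_V: "v \<in> ?V"
      proof -
        have "log_null \<infinity> r v" if "log_null 0 r v" for r :: "(nat \<Rightarrow> nat) relation"
          using that by (auto simp: log_null_def q_null_def)
        then show ?thesis
          using that unfolding L V_space_eq by blast
      qed
      have diff: "v - \<sigma> (\<pi> v) \<in> ?W"
        by (rule \<sigma>\<pi>[OF v_V])
      then show "coset ?W v = c (\<pi> v)"
        by (simp add: c_def coset_eq_iff[OF W(1)])
      have "\<sigma> (\<pi> v) \<alpha> = 0" if "\<alpha> \<notin> J" for \<alpha>
        using \<sigma>_V[of "\<pi> v"] that unfolding V_space_eq by blast
      then show "\<sigma> (\<pi> v) \<in> L"
        using that log_null_W_space[OF _ diff] unfolding L by blast
    qed
    then have "coset ?W ` L = c ` {x \<in> ?E. \<sigma> x \<in> L}"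
      using \<pi>_coord by (auto simp: c_def image_iff)
    moreover have "{x \<in> ?E. \<sigma> x \<in> L} = {x \<in> ?E. g x = 0}"
      using g0 by blast
    ultimately show ?thesis
      unfolding reduced_Dressian_def L_def by simp
  qed
  ultimately have X: "X = c ` X'"
    unfolding assms(6) X'_def using c_inj by (auto simp: inj_on_def)
  have "homeomorphic_map (top_of_set X') (subtopology (VW_topology n d J) X) c"
  proof -
    have "X' \<subseteq> ?E"
      by (auto simp: X'_def)
    then have "homeomorphic_map (subtopology (top_of_set ?E) X') (subtopology (VW_topology n d J) X) c"
      using c_top by (intro homeomorphic_map_subtopologies[OF c]) (auto simp: X)
    then show ?thesis
      using \<open>X' \<subseteq> ?E\<close> by (simp add: subtopology_subtopology Int_absorb1)
  qed
  then have X': "top_of_set X' homeomorphic_space subtopology (VW_topology n d J) X"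
    by (rule homeomorphic_map_imp_homeomorphic_space)

  \<comment> \<open>Both gauges vanish exactly on the coordinates of the reduced Dressian, so their
    radial maps, although different, have the common target \<open>X'\<close>.\<close>
  have "h x = 0 \<longleftrightarrow> g x = 0" if "x \<in> ?E" for x
    using g0[OF that] h0[OF that] by simp
  then have X'_h: "X' = {x \<in> ?E. M x \<le> 1 \<and> \<not> (M x = 1 \<and> h x = 0)}"
    unfolding X'_def by (intro Collect_cong conj_cong refl) simp
  have ball: "top_of_set {x \<in> ?E. g x \<le> 1} homeomorphic_space top_of_set X'"
    unfolding X'_def by (rule gauge_ball_homeomorphic[OF scaleR_in_coord_space g(1,2) M M_definite])
  have ball_h: "top_of_set {x \<in> ?E. h x \<le> 1} homeomorphic_space top_of_set X'"
    unfolding X'_h by (rule gauge_ball_homeomorphic[OF scaleR_in_coord_space h(1,2) M M_definite])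
  \<comment> \<open>The radial map is applied again, now with the Euclidean norm instead of
    \<open>M\<close>: the Cayley charts need a round ball.\<close>
  have euclid: "top_of_set {x \<in> ?E. f x \<le> 1} homeomorphic_space top_of_set (cut_ball m f)"
    if "homogeneous_on ?E f" "continuous_on ?E f" for f
    unfolding cut_ball_def
    by (rule gauge_ball_homeomorphic[OF scaleR_in_coord_space that homogeneous_on_norm])
      (auto intro: continuous_on_real_sqrt continuous_on_sq_norm sq_norm_eq_0)
  have Gr: "reduced_Gr n d J q homeomorphic_space top_of_set (cut_ball m g)"
    and weak_Gr: "weak_reduced_Gr n d J q homeomorphic_space top_of_set (cut_ball m h)"
    by (rule homeomorphic_space_trans[OF g(3) euclid[OF g(1,2)]],
        rule homeomorphic_space_trans[OF h(3) euclid[OF h(1,2)]])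
  show ?thesis
  proof (intro conjI exI[of _ m])
    show "reduced_Gr n d J q homeomorphic_space subtopology (VW_topology n d J) X"
      by (rule homeomorphic_space_trans[OF homeomorphic_space_trans[OF g(3) ball] X'])
    show "weak_reduced_Gr n d J q homeomorphic_space subtopology (VW_topology n d J) X"
      by (rule homeomorphic_space_trans[OF homeomorphic_space_trans[OF h(3) ball_h] X'])
    show "manifold_with_boundary m (reduced_Gr n d J q)"
      by (rule homeomorphic_manifold_with_boundary[OF Gr cut_ball_manifold[OF g(1,2)]])
    show "manifold_with_boundary m (weak_reduced_Gr n d J q)"
      by (rule homeomorphic_manifold_with_boundary[OF weak_Gr cut_ball_manifold[OF h(1,2)]])
    show "compactifies_to (reduced_Gr n d J q) (closed_ball m)"
      by (rule homeomorphic_compactifies_to[OF Gr cut_ball_compactifies[OF g(1,2)]])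
    show "compactifies_to (weak_reduced_Gr n d J q) (closed_ball m)"
      by (rule homeomorphic_compactifies_to[OF weak_Gr cut_ball_compactifies[OF h(1,2)]])
  qed
qed

end
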